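(* Let $(X,G)$ be a minimal system. Assume that $n\geq 2$ and that $X\times X$ has a dense set of minimal points. Then $(X,G)$ is $n$-sensitive if and only if there exists $x\in X$ such that $\#Q[x]\geq n$.
   Context: Throughout, $G$ is a countable discrete group. A topological dynamical system $(X,G)$ is a (nonempty) compact metric space $X$ with metric $d$ together with a continuous action of $G$ on $X$, written $(g,x)\mapsto gx$. For $n\in\mathbb{N}$, $G$ acts diagonally on $X^n$ by $g(x_1,\dots,x_n)=(gx_1,\dots,gx_n)$. A subsystem is a nonempty closed $G$-invariant subset with the restricted action; a system is minimal if it contains no proper subsystem. A point is a minimal point if it belongs to some minimal subsystem; minimal points of $X\times X$ are taken with respect to the diagonal action. A pair $(x_1,x_2)\in X\times X$ is regionally proximal if for each $\varepsilon>0$ there exist $x_1',x_2'\in X$ with $d(x_i,x_i')<\varepsilon$ for $i=1,2$ and $g\in G$ such that $d(gx_1',gx_2')<\varepsilon$. $Q(X,G)$ is the set of all regionally proximal pairs, and $Q[x]=\{y\in X:(x,y)\in Q(X,G)\}$. $\#(\cdot)$ denotes cardinality. For $n\geq 2$, $(X,G)$ is $n$-sensitive if there exists $\delta>0$ such that for every nonempty open subset $U$ of $X$ there exist pairwise distinct points $x_1,\dots,x_n\in U$ and $g\in G$ such that $\min_{1\le i<j\le n}d(gx_i,gx_j)>\delta$. *)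

theory Defs
  imports "HOL-Analysis.Analysis" "HOL-Algebra.Group_Action"
begin

text \<open>A system is a nonempty compact subset \<open>X\<close> of a metric space, acted on by a group \<open>G\<close> in the
  sense of \<^locale>\<open>group_action\<close>. In particular every \<open>\<phi> g\<close> is \<^const>\<open>undefined\<close> outside \<open>X\<close>, which is
  why the derived actions below are restricted to their carriers. As \<open>G\<close> is discrete, joint
  continuity of the action is continuity of each \<open>\<phi> g\<close>.\<close>

locale topological_dynamical_system = group_action G X \<phi>
  for G :: "('g, 'm) monoid_scheme" (structure)
    and X :: "'a::metric_space set"
    and \<phi> :: "'g \<Rightarrow> 'a \<Rightarrow> 'a" +
  assumes countable_group: "countable (carrier G)"
    and nonempty_space: "X \<noteq> {}"
    and compact_space: "compact X"
    and continuous_action: "\<And>g. g \<in> carrier G \<Longrightarrow> continuous_on X (\<phi> g)"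

definition subsystem ::
  "('g, 'm) monoid_scheme \<Rightarrow> 'a::metric_space set \<Rightarrow> ('g \<Rightarrow> 'a \<Rightarrow> 'a) \<Rightarrow> 'a set \<Rightarrow> bool" where
  "subsystem G X \<phi> Y \<longleftrightarrow>
     Y \<noteq> {} \<and> closedin (top_of_set X) Y \<and> (\<forall>g\<in>carrier G. \<phi> g ` Y \<subseteq> Y)"

definition restricted_action :: "('g \<Rightarrow> 'a \<Rightarrow> 'a) \<Rightarrow> 'a set \<Rightarrow> 'g \<Rightarrow> 'a \<Rightarrow> 'a" where
  "restricted_action \<phi> Y g = restrict (\<phi> g) Y"

definition minimal_system ::
  "('g, 'm) monoid_scheme \<Rightarrow> 'a::metric_space set \<Rightarrow> ('g \<Rightarrow> 'a \<Rightarrow> 'a) \<Rightarrow> bool" where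
  "minimal_system G X \<phi> \<longleftrightarrow>
     topological_dynamical_system G X \<phi> \<and> (\<forall>Y. subsystem G X \<phi> Y \<longrightarrow> Y = X)"

definition minimal_points ::
  "('g, 'm) monoid_scheme \<Rightarrow> 'a::metric_space set \<Rightarrow> ('g \<Rightarrow> 'a \<Rightarrow> 'a) \<Rightarrow> 'a set" where
  "minimal_points G X \<phi> =
     {x. \<exists>Y. subsystem G X \<phi> Y \<and> minimal_system G Y (restricted_action \<phi> Y) \<and> x \<in> Y}"

definition diagonal_action :: "('g \<Rightarrow> 'a \<Rightarrow> 'a) \<Rightarrow> 'a set \<Rightarrow> 'g \<Rightarrow> 'a \<times> 'a \<Rightarrow> 'a \<times> 'a" where
  "diagonal_action \<phi> X g = restrict (map_prod (\<phi> g) (\<phi> g)) (X \<times> X)"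

definition regionally_proximal ::
  "('g, 'm) monoid_scheme \<Rightarrow> 'a::metric_space set \<Rightarrow> ('g \<Rightarrow> 'a \<Rightarrow> 'a) \<Rightarrow> ('a \<times> 'a) set" where
  "regionally_proximal G X \<phi> =
     {(x1, x2). x1 \<in> X \<and> x2 \<in> X \<and>
        (\<forall>\<epsilon>>0. \<exists>y1\<in>X. \<exists>y2\<in>X. \<exists>g\<in>carrier G.
           dist x1 y1 < \<epsilon> \<and> dist x2 y2 < \<epsilon> \<and> dist (\<phi> g y1) (\<phi> g y2) < \<epsilon>)}"

definition n_sensitive ::
  "nat \<Rightarrow> ('g, 'm) monoid_scheme \<Rightarrow> 'a::metric_space set \<Rightarrow> ('g \<Rightarrow> 'a \<Rightarrow> 'a) \<Rightarrow> bool" where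
  "n_sensitive n G X \<phi> \<longleftrightarrow>
     (\<exists>\<delta>>0. \<forall>U. openin (top_of_set X) U \<and> U \<noteq> {} \<longrightarrow>
        (\<exists>x :: nat \<Rightarrow> 'a. \<exists>g\<in>carrier G.
           x ` {1..n} \<subseteq> U \<and> inj_on x {1..n} \<and>
           (\<forall>i j. 1 \<le> i \<and> i < j \<and> j \<le> n \<longrightarrow> dist (\<phi> g (x i)) (\<phi> g (x j)) > \<delta>)))"

text \<open>The clause for infinite sets is needed because \<^const>\<open>card\<close> is \<open>0\<close> on them.\<close>

definition at_least_card :: "nat \<Rightarrow> 'a set \<Rightarrow> bool" where
  "at_least_card n A \<longleftrightarrow> infinite A \<or> n \<le> card A"

text \<open>The diagonal action on \<open>X \<times> X\<close> and the restriction to a subsystem are systems again.\<close>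

lemma group_actionI:
  assumes G: "group G"
    and ext: "\<And>g. g \<in> carrier G \<Longrightarrow> \<psi> g \<in> extensional Y"
    and closed: "\<And>g y. g \<in> carrier G \<Longrightarrow> y \<in> Y \<Longrightarrow> \<psi> g y \<in> Y"
    and one: "\<And>y. y \<in> Y \<Longrightarrow> \<psi> \<one>\<^bsub>G\<^esub> y = y"
    and mult: "\<And>g h y. g \<in> carrier G \<Longrightarrow> h \<in> carrier G \<Longrightarrow> y \<in> Y \<Longrightarrow>
                 \<psi> (g \<otimes>\<^bsub>G\<^esub> h) y = \<psi> g (\<psi> h y)"
  shows "group_action G Y \<psi>"
proof -
  interpret group G by fact
  have bij: "\<psi> g \<in> Bij Y" if g: "g \<in> carrier G" for g
  proof -
    have l: "\<psi> (inv\<^bsub>G\<^esub> g) (\<psi> g y) = y" and r: "\<psi> g (\<psi> (inv\<^bsub>G\<^esub> g) y) = y" if "y \<in> Y" for y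
      using mult[of "inv\<^bsub>G\<^esub> g" g y] mult[of g "inv\<^bsub>G\<^esub> g" y] one[OF that] g that by auto
    have "bij_betw (\<psi> g) Y Y"
      by (rule bij_betw_byWitness[where f' = "\<psi> (inv\<^bsub>G\<^esub> g)"]) (use l r closed g in auto)
    then show ?thesis using ext[OF g] by (simp add: Bij_def)
  qed
  have "\<psi> (g \<otimes>\<^bsub>G\<^esub> h) = compose Y (\<psi> g) (\<psi> h)" if "g \<in> carrier G" "h \<in> carrier G" for g h
    by (rule extensionalityI[of _ Y]) (use that ext mult in \<open>auto simp: compose_def\<close>)
  then have "\<psi> \<in> hom G (BijGroup Y)"
    using bij by (auto simp: hom_def BijGroup_def)
  then show ?thesis
    by (simp add: group_action_def group_hom_def group_hom_axioms_def group_BijGroup G)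
qed

context topological_dynamical_system
begin

lemma restricted_system:
  assumes "subsystem G X \<phi> Y"
  shows "topological_dynamical_system G Y (restricted_action \<phi> Y)"
proof -
  have Y: "Y \<noteq> {}" "closedin (top_of_set X) Y" "\<And>g y. g \<in> carrier G \<Longrightarrow> y \<in> Y \<Longrightarrow> \<phi> g y \<in> Y"
    using assms by (auto simp: subsystem_def)
  then have sub: "Y \<subseteq> X" by (simp add: closedin_imp_subset)
  have "group G" using group_hom by (simp add: group_hom_def)
  then have act: "group_action G Y (restricted_action \<phi> Y)"
  proof (rule group_actionI)
    interpret group G by fact
    show "restricted_action \<phi> Y \<one> y = y" if "y \<in> Y" for y
      using that sub id_eq_one[symmetric] by (auto simp: restricted_action_def)
    show "restricted_action \<phi> Y (g \<otimes> h) y = restricted_action \<phi> Y g (restricted_action \<phi> Y h y)"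
      if "g \<in> carrier G" "h \<in> carrier G" "y \<in> Y" for g h y
      using that Y(3) sub composition_rule[of y g h] by (simp add: restricted_action_def subset_iff)
  qed (use Y in \<open>auto simp: restricted_action_def\<close>)
  have "continuous_on Y (restricted_action \<phi> Y g)" if "g \<in> carrier G" for g
    using continuous_on_subset[OF continuous_action[OF that] sub]
    by (rule iffD1[OF continuous_on_cong[OF refl], rotated]) (simp add: restricted_action_def)
  moreover have "compact Y"
    using Y(2) compact_space closedin_compact by blast
  ultimately show ?thesis
    using act Y(1) countable_group
    by (simp add: topological_dynamical_system_def topological_dynamical_system_axioms_def)
qed

lemma diagonal_system: "topological_dynamical_system G (X \<times> X) (diagonal_action \<phi> X)"
proof -
  have "group G" using group_hom by (simp add: group_hom_def)
  have stay: "\<phi> g x \<in> X" if "g \<in> carrier G" "x \<in> X" for g x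
    using element_image[OF that refl] .
  have act: "group_action G (X \<times> X) (diagonal_action \<phi> X)"
    using \<open>group G\<close>
  proof (rule group_actionI)
    interpret group G by fact
    show "diagonal_action \<phi> X \<one> p = p" if "p \<in> X \<times> X" for p
      using that id_eq_one[symmetric] by (auto simp: diagonal_action_def)
    show "diagonal_action \<phi> X (g \<otimes> h) p = diagonal_action \<phi> X g (diagonal_action \<phi> X h p)"
      if "g \<in> carrier G" "h \<in> carrier G" "p \<in> X \<times> X" for g h p
      using that stay by (auto simp: diagonal_action_def composition_rule)
    show "diagonal_action \<phi> X g p \<in> X \<times> X" if "g \<in> carrier G" "p \<in> X \<times> X" for g p
      using that stay by (auto simp: diagonal_action_def)
  qed (simp add: diagonal_action_def)
  have "continuous_on (X \<times> X) (diagonal_action \<phi> X g)" if "g \<in> carrier G" for g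
  proof -
    have "continuous_on (X \<times> X) (\<lambda>p. (\<phi> g (fst p), \<phi> g (snd p)))"
      by (intro continuous_on_Pair continuous_on_compose2[OF continuous_action[OF that]]
          continuous_intros) auto
    then show ?thesis
      by (rule iffD1[OF continuous_on_cong[OF refl], rotated]) (auto simp: diagonal_action_def)
  qed
  then show ?thesis
    using act nonempty_space compact_space countable_group
    by (simp add: topological_dynamical_system_def topological_dynamical_system_axioms_def
        compact_Times)
qed

end

end

theory Submission
  imports Defs
begin

text \<open>If the system is \<open>n\<close>-sensitive, a limit of separated tuples coming from shrinking open sets consists of
  \<open>n\<close> distinct points that are pairwise regionally proximal.

  For the converse one shows that \<open>n\<close> points of \<open>Q[x]\<close> can be gathered: arbitrarily close to them there are
  points which some \<open>g\<close> moves into a prescribed open set. If \<open>#Q[z] \<ge> n\<close> for a generic \<open>z\<close>, then, as minimal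
  points are dense in \<open>X \<times> X\<close>, the points of \<open>Q[z]\<close> are limits of points \<open>c\<close> with \<open>(z, c)\<close> minimal and
  with \<open>gz\<close>, \<open>gc\<close> arbitrarily close for some \<open>g\<close>; recurrence of these pairs gathers several points at once.
  Otherwise \<open>Q[z]\<close> is finite for generic \<open>z\<close>. Since \<open>Q\<close> is generically lower semicontinuous, distinct points
  of a generic \<open>Q[z]\<close> are never proximal, so tuples of generic points are minimal by the Auslander--Ellis
  theorem. It follows that replacing a coordinate of a gatherable tuple by a regionally proximal point does not
  leave the interior of the closure of the gatherable tuples. All tuples from a generic fibre lie in this
  interior, and every fibre can be carried close to a generic one.\<close>

section \<open>Minimal sets of compact group actions\<close>

text \<open>Sensitivity is gathering read backwards: once \<open>g\<close> has moved points near
  \<open>x 1\<close>, ..., \<open>x n\<close> into \<open>U\<close>, the element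
  \<open>inv g\<close> separates their images. The obstacle is that every pair in \<open>Q\<close>
  comes with its own approximating pair and its own group element, whereas one \<open>g\<close> has
  to serve all \<open>n\<close> points, and only pairs, not tuples, are assumed to have dense
  minimal points. Over a generic base point all first coordinates can be frozen at \<open>z\<close>,
  and then syndetic sets of return times combine. A fibre with \<open>n\<close> points may however
  lie only over exceptional base points. In that case the small size of the generic fibres has to
  supply minimal tuples instead. The interior of the closure enters because exchanging a coordinate
  yields only limits of gatherable tuples, while the next exchange has to start from an open
  set.\<close>

lemma compact_imp_closed_fun:
  fixes K :: "('i \<Rightarrow> 'b::t2_space) set"
  assumes "compact K"
  shows "closed K"
proof -
  have "Hausdorff_space (euclidean :: 'b topology)"
    unfolding Hausdorff_space_def disjnt_def open_openin[symmetric] by (metis hausdorff)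
  then have "Hausdorff_space (product_topology (\<lambda>i :: 'i. euclidean :: 'b topology) UNIV)"
    by (simp add: Hausdorff_space_product_topology)
  then have "Hausdorff_space (euclidean :: ('i \<Rightarrow> 'b) topology)"
    by (simp only: euclidean_product_topology)
  then show ?thesis
    using compactin_imp_closedin[of euclidean K] assms by simp
qed

lemma compact_PiE_UNIV:
  fixes K :: "'i \<Rightarrow> 'b::topological_space set"
  assumes "\<And>i. compact (K i)"
  shows "compact (PiE UNIV K)"
proof -
  have "compactin (product_topology (\<lambda>i. euclidean) UNIV) (PiE UNIV K)"
    using assms by (simp add: compactin_PiE)
  then show ?thesis by (simp add: euclidean_product_topology)
qed

text \<open>Zorn's lemma on complements; compactness keeps the intersection of a chain nonempty. The
  parameter \<open>P\<close> covers two uses: invariant sets, which give minimal sets, and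
  subsemigroups, which give idempotents.\<close>

lemma minimal_closed_subset:
  fixes K :: "'b::topological_space set"
  assumes K: "compact K" "closed K" "K \<noteq> {}" "P K"
    and Inter: "\<And>\<C>. \<C> \<noteq> {} \<Longrightarrow> (\<And>S. S \<in> \<C> \<Longrightarrow> closed S \<and> S \<subseteq> K \<and> S \<noteq> {} \<and> P S) \<Longrightarrow>
      (\<And>S T. S \<in> \<C> \<Longrightarrow> T \<in> \<C> \<Longrightarrow> S \<subseteq> T \<or> T \<subseteq> S) \<Longrightarrow> P (\<Inter>\<C>)"
  obtains M where "closed M" "M \<subseteq> K" "M \<noteq> {}" "P M"
    "\<And>S. closed S \<Longrightarrow> S \<subseteq> M \<Longrightarrow> S \<noteq> {} \<Longrightarrow> P S \<Longrightarrow> S = M"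
proof -
  define \<A> where "\<A> = uminus ` {S. closed S \<and> S \<subseteq> K \<and> S \<noteq> {} \<and> P S}"
  have mem: "A \<in> \<A> \<longleftrightarrow> closed (- A) \<and> - A \<subseteq> K \<and> - A \<noteq> {} \<and> P (- A)" for A
    unfolding \<A>_def by (smt (verit, del_insts) double_complement imageE imageI mem_Collect_eq)
  have "\<exists>M\<in>\<A>. \<forall>A\<in>\<A>. M \<subseteq> A \<longrightarrow> A = M"
  proof (rule subset_Zorn_nonempty)
    show "\<A> \<noteq> {}" using K mem[of "- K"] by auto
    fix \<C> assume C: "\<C> \<noteq> {}" "subset.chain \<A> \<C>"
    define \<D> where "\<D> = uminus ` \<C>"
    have CA: "\<C> \<subseteq> \<A>" and lin: "\<And>A B. A \<in> \<C> \<Longrightarrow> B \<in> \<C> \<Longrightarrow> A \<subseteq> B \<or> B \<subseteq> A"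
      using C(2) by (auto simp: subset_chain_def)
    have D: "closed S \<and> S \<subseteq> K \<and> S \<noteq> {} \<and> P S" if "S \<in> \<D>" for S
      using that CA mem unfolding \<D>_def by auto
    have linD: "S \<subseteq> T \<or> T \<subseteq> S" if "S \<in> \<D>" "T \<in> \<D>" for S T
      using that lin unfolding \<D>_def by auto
    have ne: "\<D> \<noteq> {}" using C(1) by (simp add: \<D>_def)
    have "K \<inter> \<Inter>\<D> \<noteq> {}"
    proof (rule compact_imp_fip[OF K(1)])
      show "closed T" if "T \<in> \<D>" for T using D that by blast
      fix \<F> assume F: "finite \<F>" "\<F> \<subseteq> \<D>"
      show "K \<inter> \<Inter>\<F> \<noteq> {}"
      proof (cases "\<F> = {}")
        case False
        have "\<exists>S\<in>\<F>. \<forall>T\<in>\<F>. S \<subseteq> T"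
          using F(1) False F(2)
        proof (induction rule: finite_ne_induct)
          case (insert T \<F>)
          then obtain S where S: "S \<in> \<F>" "\<forall>T\<in>\<F>. S \<subseteq> T" by auto
          have "S \<in> \<D>" "T \<in> \<D>" using insert.prems S(1) by auto
          then have "S \<subseteq> T \<or> T \<subseteq> S" by (rule linD)
          then show ?case using S by (metis insert_iff order_refl order_trans)
        qed auto
        then obtain S where S: "S \<in> \<F>" "\<forall>T\<in>\<F>. S \<subseteq> T" by blast
        moreover have "S \<subseteq> K" "S \<noteq> {}" using D S(1) F(2) by blast+
        ultimately show ?thesis by blast
      qed (use K in auto)
    qed
    moreover have "P (\<Inter>\<D>)" using Inter[OF ne] D linD by blast
    moreover have "closed (\<Inter>\<D>)" using D by (intro closed_Inter) auto
    moreover have "\<Inter>\<D> \<subseteq> K" using ne D by blast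
    moreover have "- \<Union>\<C> = \<Inter>\<D>" by (auto simp: \<D>_def)
    ultimately show "\<Union>\<C> \<in> \<A>" by (auto simp: mem)
  qed
  then obtain A where A: "A \<in> \<A>" "\<And>B. B \<in> \<A> \<Longrightarrow> A \<subseteq> B \<Longrightarrow> B = A" by blast
  show thesis
  proof (rule that[of "- A"])
    fix S assume S: "closed S" "S \<subseteq> - A" "S \<noteq> {}" "P S"
    have "- A \<subseteq> K" using A(1) mem by blast
    then have "- S \<in> \<A>" using S mem[of "- S"] by auto
    then show "S = - A" using A(2)[of "- S"] S(2) by blast
  qed (use A mem in auto)
qed

text \<open>Values outside \<open>Y\<close> are unrestricted, so that \<open>map_prod\<close> and
  composition with a sequence act directly. The space may also be a set of functions, as for the
  enveloping semigroup.\<close>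

locale compact_action = group G
  for G :: "('g, 'm) monoid_scheme" (structure)
    and Y :: "'b::topological_space set"
    and \<psi> :: "'g \<Rightarrow> 'b \<Rightarrow> 'b" +
  assumes compact_carrier: "compact Y"
    and closed_carrier: "closed Y"
    and cont: "g \<in> carrier G \<Longrightarrow> continuous_on Y (\<psi> g)"
    and stay: "g \<in> carrier G \<Longrightarrow> y \<in> Y \<Longrightarrow> \<psi> g y \<in> Y"
    and act_one: "y \<in> Y \<Longrightarrow> \<psi> \<one> y = y"
    and act_mult: "g \<in> carrier G \<Longrightarrow> h \<in> carrier G \<Longrightarrow> y \<in> Y \<Longrightarrow> \<psi> (g \<otimes> h) y = \<psi> g (\<psi> h y)"
begin

lemma inv_act [simp]:
  assumes "g \<in> carrier G" "y \<in> Y"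
  shows "\<psi> (inv g) (\<psi> g y) = y" "\<psi> g (\<psi> (inv g) y) = y"
  using assms act_mult[of "inv g" g y] act_mult[of g "inv g" y] act_one by auto

definition invariant :: "'b set \<Rightarrow> bool" where
  "invariant S \<longleftrightarrow> S \<subseteq> Y \<and> (\<forall>g\<in>carrier G. \<forall>y\<in>S. \<psi> g y \<in> S)"

definition minimal_set :: "'b set \<Rightarrow> bool" where
  "minimal_set N \<longleftrightarrow> N \<noteq> {} \<and> closed N \<and> invariant N \<and>
     (\<forall>K. K \<noteq> {} \<and> closed K \<and> invariant K \<and> K \<subseteq> N \<longrightarrow> K = N)"

lemma invariant_subset: "invariant S \<Longrightarrow> S \<subseteq> Y"
  by (simp add: invariant_def)

lemma invariantD: "invariant S \<Longrightarrow> g \<in> carrier G \<Longrightarrow> y \<in> S \<Longrightarrow> \<psi> g y \<in> S"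
  by (simp add: invariant_def)

lemma invariant_iff: "invariant S \<Longrightarrow> g \<in> carrier G \<Longrightarrow> y \<in> Y \<Longrightarrow> \<psi> g y \<in> S \<longleftrightarrow> y \<in> S"
  using invariantD inv_act(1) inv_closed by metis

lemma minimal_setD:
  assumes "minimal_set N"
  shows "N \<noteq> {}" "closed N" "invariant N" "N \<subseteq> Y" "compact N"
  using assms closed_carrier compact_carrier compact_Int_closed[of Y N] invariant_subset[of N]
  by (auto simp: minimal_set_def Int_absorb1)

lemma minimal_set_eq:
  "minimal_set N \<Longrightarrow> K \<noteq> {} \<Longrightarrow> closed K \<Longrightarrow> invariant K \<Longrightarrow> K \<subseteq> N \<Longrightarrow> K = N"
  by (simp add: minimal_set_def)

lemma closure_invariant:
  assumes "invariant S"
  shows "invariant (closure S)"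
proof -
  have sub: "closure S \<subseteq> Y"
    using assms closed_carrier by (simp add: closure_minimal invariant_def)
  have "\<psi> g y \<in> closure S" if "g \<in> carrier G" "y \<in> closure S" for g y
  proof -
    have "\<psi> g ` closure S \<subseteq> closure S"
    proof (rule image_closure_subset)
      show "continuous_on (closure S) (\<psi> g)"
        using cont[OF that(1)] sub continuous_on_subset by blast
      show "\<psi> g ` S \<subseteq> closure S"
        using invariantD[OF assms that(1)] closure_subset by blast
    qed simp
    then show ?thesis using that by blast
  qed
  then show ?thesis using sub by (simp add: invariant_def)
qed

definition orbit_set :: "'b \<Rightarrow> 'b set" where
  "orbit_set y = (\<lambda>g. \<psi> g y) ` carrier G"

lemma orbit_invariant: "y \<in> Y \<Longrightarrow> invariant (orbit_set y)"
  unfolding invariant_def orbit_set_def by (auto simp: stay act_mult[symmetric])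

lemma self_in_orbit: "y \<in> Y \<Longrightarrow> y \<in> orbit_set y"
  unfolding orbit_set_def by (rule image_eqI[of _ _ \<one>]) (auto simp: act_one)

lemma orbit_subset: "invariant S \<Longrightarrow> y \<in> S \<Longrightarrow> orbit_set y \<subseteq> S"
  unfolding orbit_set_def using invariantD by blast

lemma minimal_set_dense_orbit:
  assumes "minimal_set N" "y \<in> N"
  shows "closure (orbit_set y) = N"
proof -
  have "invariant (closure (orbit_set y))"
    using assms minimal_setD(4) by (intro closure_invariant orbit_invariant) auto
  moreover have "closure (orbit_set y) \<subseteq> N"
    using assms minimal_setD(2,3) orbit_subset by (simp add: closure_minimal)
  moreover have "closure (orbit_set y) \<noteq> {}"
    using assms minimal_setD(4) self_in_orbit by fastforce
  ultimately show ?thesis using assms(1) by (simp add: minimal_set_def)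
qed

lemma minimal_set_visits:
  assumes "minimal_set N" "y \<in> N" "open U" "N \<inter> U \<noteq> {}"
  obtains g where "g \<in> carrier G" "\<psi> g y \<in> U"
proof -
  have "orbit_set y \<inter> U \<noteq> {}"
    using assms minimal_set_dense_orbit open_Int_closure_eq_empty[of U "orbit_set y"] by blast
  then show thesis using that by (auto simp: orbit_set_def)
qed

text \<open>Every orbit in \<open>N\<close> is dense in \<open>N\<close> and so enters
  \<open>U\<close>; invariance carries membership in \<open>S\<close> back along the orbit. One
  point of \<open>N\<close> in an open part of \<open>S\<close> thus forces all of \<open>N\<close>
  into \<open>S\<close>.\<close>

lemma minimal_set_subset_open:
  assumes "minimal_set N" "invariant S" "open U" "U \<inter> Y \<subseteq> S" "N \<inter> U \<noteq> {}"
  shows "N \<subseteq> S"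
proof
  fix y assume y: "y \<in> N"
  then obtain g where g: "g \<in> carrier G" "\<psi> g y \<in> U"
    using minimal_set_visits assms by blast
  have "y \<in> Y" using y minimal_setD(4) assms(1) by blast
  then show "y \<in> S" using g assms(2,4) stay invariant_iff by blast
qed

text \<open>The preimages of \<open>U\<close> cover the compact set \<open>N\<close>, so finitely
  many suffice. As \<open>F\<close> serves all points of \<open>N\<close>, it serves all translates
  of one point, which makes the times of return to \<open>U\<close> syndetic.\<close>

lemma minimal_set_syndetic:
  assumes N: "minimal_set N" and U: "open U" "N \<inter> U \<noteq> {}"
  obtains F where "finite F" "F \<subseteq> carrier G" "\<And>y. y \<in> N \<Longrightarrow> \<exists>f\<in>F. \<psi> f y \<in> U"
proof -
  have "\<exists>T. open T \<and> T \<inter> N = \<psi> g -` U \<inter> N" if "g \<in> carrier G" for g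
    using continuous_on_open_invariant U(1) continuous_on_subset[OF cont[OF that]] minimal_setD(4)[OF N] by metis
  then obtain T where T: "\<And>g. g \<in> carrier G \<Longrightarrow> open (T g)"
    "\<And>g. g \<in> carrier G \<Longrightarrow> T g \<inter> N = \<psi> g -` U \<inter> N" by metis
  have "N \<subseteq> (\<Union>g\<in>carrier G. T g)"
  proof
    fix y assume y: "y \<in> N"
    then obtain g where g: "g \<in> carrier G" "\<psi> g y \<in> U" using minimal_set_visits N U by blast
    then have "y \<in> T g" using T(2)[OF g(1)] y by blast
    then show "y \<in> (\<Union>g\<in>carrier G. T g)" using g by blast
  qed
  then obtain F where F: "F \<subseteq> carrier G" "finite F" "N \<subseteq> (\<Union>g\<in>F. T g)"
    using compactE_image[OF minimal_setD(5)[OF N], of "carrier G" T] T(1) by metis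
  show thesis
  proof (rule that)
    fix y assume "y \<in> N"
    then show "\<exists>f\<in>F. \<psi> f y \<in> U" using F(1,3) T(2) by blast
  qed (use F in auto)
qed

lemma minimal_set_exists:
  assumes "closed K" "invariant K" "K \<noteq> {}"
  obtains N where "minimal_set N" "N \<subseteq> K"
proof -
  have "compact K"
    using compact_Int_closed[OF compact_carrier assms(1)] invariant_subset[OF assms(2)]
    by (simp add: Int_absorb1)
  moreover have "invariant (\<Inter>\<C>)"
    if "\<C> \<noteq> {}" "\<And>S. S \<in> \<C> \<Longrightarrow> invariant S" for \<C>
    using that unfolding invariant_def by blast
  ultimately obtain N where "closed N" "N \<subseteq> K" "N \<noteq> {}" "invariant N"
    "\<And>S. closed S \<Longrightarrow> S \<subseteq> N \<Longrightarrow> S \<noteq> {} \<Longrightarrow> invariant S \<Longrightarrow> S = N"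
    using minimal_closed_subset[of K invariant] assms by metis
  then show thesis using that unfolding minimal_set_def by metis
qed

end

section \<open>Proximal minimal points\<close>

locale compact_t2_action = compact_action G Y \<psi>
  for G :: "('g, 'm) monoid_scheme" (structure)
    and Y :: "'b::t2_space set"
    and \<psi> :: "'g \<Rightarrow> 'b \<Rightarrow> 'b"
begin

definition total :: "'g \<Rightarrow> 'b \<Rightarrow> 'b" where
  "total g x = (if x \<in> Y then \<psi> g x else x)"

text \<open>The compact space of all maps from \<open>Y\<close> to \<open>Y\<close>, extended by the
  identity so that composition is plain and \<open>id\<close> is an element. The enveloping
  semigroup is the closure of the maps \<open>total g\<close> in it.\<close>

definition self_maps :: "('b \<Rightarrow> 'b) set" where
  "self_maps = PiE UNIV (\<lambda>x. if x \<in> Y then Y else {x})"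

lemma self_maps_iff: "p \<in> self_maps \<longleftrightarrow> (\<forall>x. if x \<in> Y then p x \<in> Y else p x = x)"
  unfolding self_maps_def PiE_def Pi_def by (auto split: if_splits)

lemma compact_self_maps: "compact self_maps"
  unfolding self_maps_def by (rule compact_PiE_UNIV) (simp add: compact_carrier)

lemma self_maps_action: "compact_action G self_maps (\<lambda>g p. total g \<circ> p)"
proof unfold_locales
  show "compact self_maps" by (rule compact_self_maps)
  then show "closed self_maps" by (rule compact_imp_closed_fun)
  show "continuous_on self_maps (\<lambda>p. total g \<circ> p)" if g: "g \<in> carrier G" for g
  proof (rule continuous_on_coordinatewise_then_product)
    fix x
    have eval: "continuous_on self_maps (\<lambda>p. p x)"
      by (rule continuous_on_subset[OF continuous_on_product_coordinates]) simp
    show "continuous_on self_maps (\<lambda>p. (total g \<circ> p) x)"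
    proof (cases "x \<in> Y")
      case True
      then have "(\<lambda>p. p x) ` self_maps \<subseteq> Y" by (auto simp: self_maps_iff)
      then have "continuous_on self_maps (\<lambda>p. \<psi> g (p x))"
        using continuous_on_compose2[OF cont[OF g] eval] by blast
      then show ?thesis
        by (rule continuous_on_eq) (use True in \<open>auto simp: self_maps_iff total_def\<close>)
    next
      case False
      have "continuous_on self_maps (\<lambda>p. x)" by simp
      then show ?thesis
        by (rule continuous_on_eq) (use False in \<open>auto simp: self_maps_iff total_def\<close>)
    qed
  qed
  fix g p assume "g \<in> carrier G" "p \<in> self_maps"
  then show "total g \<circ> p \<in> self_maps" by (auto simp: self_maps_iff total_def stay)
next
  fix p assume "p \<in> self_maps"
  then show "total \<one> \<circ> p = p" by (auto simp: fun_eq_iff self_maps_iff total_def act_one)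
next
  fix g h p assume "g \<in> carrier G" "h \<in> carrier G" "p \<in> self_maps"
  then show "total (g \<otimes> h) \<circ> p = total g \<circ> (total h \<circ> p)"
    by (auto simp: fun_eq_iff self_maps_iff total_def act_mult stay)
qed

text \<open>For pointwise convergence, composition is continuous in its left argument whatever
  \<open>q\<close> is; the semigroup arguments below rest on this one-sided continuity.\<close>

lemma compose_right_continuous: "continuous_on S (\<lambda>r :: 'b \<Rightarrow> 'b. r \<circ> q)"
proof (rule continuous_on_coordinatewise_then_product)
  show "continuous_on S (\<lambda>r :: 'b \<Rightarrow> 'b. (r \<circ> q) x)" for x
    unfolding o_def by (rule continuous_on_subset[OF continuous_on_product_coordinates]) simp
qed

text \<open>The Ellis--Numakura lemma. In a minimal closed subsemigroup \<open>S\<close> with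
  \<open>u \<in> S\<close>, the products \<open>s \<circ> u\<close> form a closed subsemigroup,
  hence all of \<open>S\<close>, so \<open>s \<circ> u = u\<close> is solvable. The solutions form a
  closed subsemigroup again, hence all of \<open>S\<close>, and \<open>u\<close> is one of
  them.\<close>

lemma idempotent_exists:
  fixes I :: "('b \<Rightarrow> 'b) set"
  assumes I: "compact I" "I \<noteq> {}" and comp: "\<And>p q. p \<in> I \<Longrightarrow> q \<in> I \<Longrightarrow> p \<circ> q \<in> I"
  obtains u where "u \<in> I" "u \<circ> u = u"
proof -
  define P where "P S \<longleftrightarrow> (\<forall>p\<in>S. \<forall>q\<in>S. p \<circ> q \<in> S)" for S :: "('b \<Rightarrow> 'b) set"
  have clI: "closed I" using I compact_imp_closed_fun by blast
  show thesis
  proof (rule minimal_closed_subset[OF I(1) clI I(2), of P])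
    show "P I" using comp by (simp add: P_def)
    show "P (\<Inter>\<C>)" if "\<And>S. S \<in> \<C> \<Longrightarrow> closed S \<and> S \<subseteq> I \<and> S \<noteq> {} \<and> P S" for \<C>
      using that unfolding P_def by blast
  next
    fix S assume S: "closed S" "S \<subseteq> I" "S \<noteq> {}" "P S"
      and min: "\<And>T. closed T \<Longrightarrow> T \<subseteq> S \<Longrightarrow> T \<noteq> {} \<Longrightarrow> P T \<Longrightarrow> T = S"
    have cS: "compact S" using compact_Int_closed[OF I(1) S(1)] S(2) by (simp add: Int_absorb1)
    obtain u where u: "u \<in> S" using S(3) by blast
    have "(\<lambda>s. s \<circ> u) ` S = S"
    proof (rule min)
      show "closed ((\<lambda>s. s \<circ> u) ` S)"
        by (intro compact_imp_closed_fun compact_continuous_image compose_right_continuous cS)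
      show "(\<lambda>s. s \<circ> u) ` S \<subseteq> S" using S(4) u by (auto simp: P_def)
      show "P ((\<lambda>s. s \<circ> u) ` S)"
        unfolding P_def
      proof (intro ballI)
        fix p q assume "p \<in> (\<lambda>s. s \<circ> u) ` S" "q \<in> (\<lambda>s. s \<circ> u) ` S"
        then obtain s t where st: "s \<in> S" "t \<in> S" "p = s \<circ> u" "q = t \<circ> u" by blast
        then have "s \<circ> u \<circ> t \<in> S" using S(4) u by (simp add: P_def)
        then show "p \<circ> q \<in> (\<lambda>s. s \<circ> u) ` S" unfolding st(3,4) o_assoc by (rule imageI)
      qed
    qed (use S in auto)
    then obtain s where s: "s \<in> S" "s \<circ> u = u" using u by (metis imageE)
    have cl: "closed {s \<in> S. s \<circ> u = u}"
    proof -
      have "closed (S \<inter> (\<lambda>s. s \<circ> u) -` {u})"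
        by (rule continuous_closed_preimage[OF compose_right_continuous S(1)])
          (simp add: compact_imp_closed_fun)
      moreover have "{s \<in> S. s \<circ> u = u} = S \<inter> (\<lambda>s. s \<circ> u) -` {u}" by auto
      ultimately show ?thesis by simp
    qed
    have "{s \<in> S. s \<circ> u = u} = S"
    proof (rule min[OF cl])
      show "P {s \<in> S. s \<circ> u = u}" using S(4) unfolding P_def by (simp add: comp_assoc)
    qed (use s in auto)
    then show thesis using that u S(2) by blast
  qed
qed

text \<open>The Auslander--Ellis theorem, through an idempotent \<open>u\<close> in a minimal left ideal of the enveloping
  semigroup: \<open>y\<close> and \<open>y' = u y\<close> are proximal because \<open>u y = u y'\<close>.\<close>

theorem proximal_minimal_point:
  assumes y: "y \<in> Y"
  obtains N y' s where "minimal_set N" "y' \<in> N" "y' \<in> closure (orbit_set y)"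
    "(s, s) \<in> closure ((\<lambda>g. (\<psi> g y, \<psi> g y')) ` carrier G)"
proof -
  interpret E: compact_action G self_maps "\<lambda>g p. total g \<circ> p" by (rule self_maps_action)
  have id: "id \<in> self_maps" by (simp add: self_maps_iff)
  have orb: "E.orbit_set id = total ` carrier G" by (simp add: E.orbit_set_def)
  have inv: "E.invariant (closure (E.orbit_set id))"
    by (intro E.closure_invariant E.orbit_invariant id)
  moreover have "closure (E.orbit_set id) \<noteq> {}" using E.self_in_orbit[OF id] closure_subset by blast
  ultimately obtain I where I: "E.minimal_set I" "I \<subseteq> closure (total ` carrier G)"
    using E.minimal_set_exists[of "closure (E.orbit_set id)"] orb by auto
  have sub: "I \<subseteq> self_maps" "closed I" "compact I" "I \<noteq> {}"
    using E.minimal_setD[OF I(1)] by auto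
  \<comment> \<open>Invariance gives this for \<open>total g\<close> in place of \<open>p\<close>;
    continuity in the left factor extends it to the closure, which contains \<open>I\<close>. This
    makes \<open>I\<close> a left ideal.\<close>
  have "p \<circ> q \<in> I" if "p \<in> I" "q \<in> I" for p q
  proof -
    have "(\<lambda>r. r \<circ> q) ` closure (total ` carrier G) \<subseteq> I"
    proof (rule image_closure_subset[OF compose_right_continuous sub(2)])
      show "(\<lambda>r. r \<circ> q) ` total ` carrier G \<subseteq> I"
        using E.invariantD[OF E.minimal_setD(3)[OF I(1)] _ that(2)] by auto
    qed
    then show ?thesis using that I(2) by blast
  qed
  then obtain u where u: "u \<in> I" "u \<circ> u = u"
    using idempotent_exists[OF sub(3,4)] by blast
  have eval: "continuous_on S (\<lambda>p. p y)" for S :: "('b \<Rightarrow> 'b) set"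
    by (rule continuous_on_subset[OF continuous_on_product_coordinates]) simp
  define N where "N = (\<lambda>p. p y) ` I"
  have N: "minimal_set N"
    unfolding minimal_set_def
  proof (intro conjI allI impI)
    show "N \<noteq> {}" using sub(4) by (simp add: N_def)
    show "closed N" unfolding N_def
      by (intro compact_imp_closed compact_continuous_image eval sub(3))
    have "N \<subseteq> Y" using sub(1) y by (auto simp: N_def self_maps_iff)
    moreover have "\<psi> g (p y) \<in> N" if "g \<in> carrier G" "p \<in> I" for g p
    proof -
      have "total g \<circ> p \<in> I" using E.invariantD[OF E.minimal_setD(3)[OF I(1)]] that by blast
      moreover have "(total g \<circ> p) y = \<psi> g (p y)"
        using sub(1) y that by (auto simp: self_maps_iff total_def)
      ultimately show ?thesis unfolding N_def by (metis imageI)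
    qed
    ultimately show "invariant N" unfolding invariant_def by (auto simp: N_def)
    fix K assume K: "K \<noteq> {} \<and> closed K \<and> invariant K \<and> K \<subseteq> N"
    \<comment> \<open>Evaluation at \<open>y\<close> maps \<open>I\<close> onto \<open>N\<close> and
      commutes with the action, so the part of \<open>I\<close> over \<open>K\<close> is closed and
      invariant. In this way minimality passes from \<open>I\<close> to \<open>N\<close>.\<close>
    have "I \<inter> (\<lambda>p. p y) -` K = I"
    proof -
      have "closed (I \<inter> (\<lambda>p. p y) -` K)"
        using continuous_closed_preimage[OF eval sub(2)] K by blast
      moreover have "I \<inter> (\<lambda>p. p y) -` K \<noteq> {}" using K by (auto simp: N_def)
      moreover have "E.invariant (I \<inter> (\<lambda>p. p y) -` K)"
        unfolding E.invariant_def
      proof (intro conjI ballI)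
        fix g p assume gp: "g \<in> carrier G" "p \<in> I \<inter> (\<lambda>p. p y) -` K"
        have "(total g \<circ> p) y = \<psi> g (p y)"
          using sub(1) y gp by (auto simp: self_maps_iff total_def)
        then show "total g \<circ> p \<in> I \<inter> (\<lambda>p. p y) -` K"
          using gp K invariantD E.invariantD[OF E.minimal_setD(3)[OF I(1)]] by auto
      qed (use sub in auto)
      ultimately show ?thesis by (intro E.minimal_set_eq[OF I(1)]) (assumption+, simp)
    qed
    then show "K = N" using K by (auto simp: N_def)
  qed
  \<comment> \<open>Evaluating at \<open>y\<close> and \<open>u y\<close> simultaneously sends
    \<open>u\<close> to a diagonal point, which is therefore a limit of simultaneous
    translates.\<close>
  have "continuous_on UNIV (\<lambda>p. (p y, p (u y)))"
    by (intro continuous_intros continuous_on_product_coordinates)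
  then have "(\<lambda>p. (p y, p (u y))) ` closure (total ` carrier G)
      \<subseteq> closure ((\<lambda>p. (p y, p (u y))) ` total ` carrier G)"
    by (intro image_closure_subset closed_closure closure_subset) (rule continuous_on_subset, assumption, simp)
  moreover have "(\<lambda>p. (p y, p (u y))) ` total ` carrier G = (\<lambda>g. (\<psi> g y, \<psi> g (u y))) ` carrier G"
  proof -
    have "u y \<in> Y" using y u(1) sub(1) by (auto simp: self_maps_iff subset_iff split: if_splits)
    then show ?thesis using y by (simp add: image_image total_def)
  qed
  moreover have "u (u y) = u y" using u(2) by (metis comp_apply)
  ultimately have prox: "(u y, u y) \<in> closure ((\<lambda>g. (\<psi> g y, \<psi> g (u y))) ` carrier G)"
  proof -
    assume a: "(\<lambda>p. (p y, p (u y))) ` closure (total ` carrier G)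
      \<subseteq> closure ((\<lambda>p. (p y, p (u y))) ` total ` carrier G)"
      and b: "(\<lambda>p. (p y, p (u y))) ` total ` carrier G = (\<lambda>g. (\<psi> g y, \<psi> g (u y))) ` carrier G"
      and c: "u (u y) = u y"
    have "u \<in> closure (total ` carrier G)" using u(1) I(2) by blast
    then have "(u y, u (u y)) \<in> closure ((\<lambda>p. (p y, p (u y))) ` total ` carrier G)" using a by blast
    then show ?thesis unfolding b c .
  qed
  have "(\<lambda>p. p y) ` closure (total ` carrier G) \<subseteq> closure ((\<lambda>p. p y) ` total ` carrier G)"
    by (intro image_closure_subset closed_closure closure_subset eval)
  moreover have "(\<lambda>p. p y) ` total ` carrier G = orbit_set y"
    using y by (auto simp: orbit_set_def image_image total_def)
  moreover have "u \<in> closure (total ` carrier G)" using u(1) I(2) by blast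
  ultimately have "u y \<in> closure (orbit_set y)" by (metis (no_types, lifting) image_subset_iff)
  then show thesis using that[OF N _ _ prox] u(1) by (simp add: N_def)
qed

end

section \<open>Generic points of a compact set\<close>

lemma compact_countable_basis:
  fixes K :: "'b::metric_space set"
  assumes "compact K"
  obtains \<B> where "countable \<B>" "\<And>V. V \<in> \<B> \<Longrightarrow> open V"
    "\<And>x r. x \<in> K \<Longrightarrow> r > 0 \<Longrightarrow> \<exists>V\<in>\<B>. x \<in> V \<and> V \<subseteq> ball x r"
proof -
  have "\<exists>S. finite S \<and> S \<subseteq> K \<and> K \<subseteq> (\<Union>x\<in>S. ball x (1 / real (Suc k)))" for k
  proof -
    obtain S where "S \<subseteq> K" "finite S" "K \<subseteq> (\<Union>x\<in>S. ball x (1 / real (Suc k)))"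
      using compactE_image[OF assms, of K "\<lambda>x. ball x (1 / real (Suc k))"] by force
    then show ?thesis by blast
  qed
  then obtain S where S: "\<And>k. finite (S k)" "\<And>k. K \<subseteq> (\<Union>x\<in>S k. ball x (1 / real (Suc k)))"
    by metis
  define \<B> where "\<B> = (\<Union>k. (\<lambda>x. ball x (1 / real (Suc k))) ` S k)"
  show thesis
  proof (rule that)
    show "countable \<B>" unfolding \<B>_def using S(1) by (intro countable_UN countable_image) (auto simp: countable_finite)
    show "open V" if "V \<in> \<B>" for V using that by (auto simp: \<B>_def)
    fix x :: 'b and r :: real assume x: "x \<in> K" "r > 0"
    obtain k where k: "1 / real (Suc k) < r / 2"
      using nat_approx_posE[of "r / 2"] x(2) by auto
    obtain s where s: "s \<in> S k" "dist s x < 1 / real (Suc k)" using S(2)[of k] x(1) by auto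
    have "ball s (1 / real (Suc k)) \<subseteq> ball x r"
    proof
      fix t assume "t \<in> ball s (1 / real (Suc k))"
      then show "t \<in> ball x r" using s(2) k dist_triangle[of x t s] by (simp add: dist_commute)
    qed
    then show "\<exists>V\<in>\<B>. x \<in> V \<and> V \<subseteq> ball x r"
      using s by (intro bexI[of _ "ball s (1 / real (Suc k))"]) (auto simp: \<B>_def)
  qed
qed

text \<open>Closed sets are removed one at a time: either \<open>C\<close> contains
  \<open>B \<inter> X\<close>, or the open set \<open>B - C\<close> still meets \<open>X\<close> and
  is covered by the others.\<close>

lemma finite_closed_cover_interior:
  assumes "finite \<C>" "\<And>C. C \<in> \<C> \<Longrightarrow> closed C" "open B" "B \<inter> X \<noteq> {}" "B \<inter> X \<subseteq> \<Union>\<C>"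
  shows "\<exists>C\<in>\<C>. \<exists>B'. open B' \<and> B' \<subseteq> B \<and> B' \<inter> X \<noteq> {} \<and> B' \<inter> X \<subseteq> C"
  using assms
proof (induction arbitrary: B rule: finite_induct)
  case (insert C \<C>)
  show ?case
  proof (cases "B \<inter> X \<subseteq> C")
    case False
    have "open (B - C)" "(B - C) \<inter> X \<noteq> {}" "(B - C) \<inter> X \<subseteq> \<Union>\<C>"
      using False insert.prems by (auto intro: open_Diff)
    then obtain C' B' where "C' \<in> \<C>" "open B'" "B' \<subseteq> B - C" "B' \<inter> X \<noteq> {}" "B' \<inter> X \<subseteq> C'"
      using insert.IH[of "B - C"] insert.prems(1) by blast
    then show ?thesis by blast
  qed (use insert.prems in blast)
qed auto

section \<open>Residual properties relative to a compact set\<close>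

definition dense_open_in :: "'b::topological_space set \<Rightarrow> 'b set \<Rightarrow> bool" where
  "dense_open_in X U \<longleftrightarrow> open U \<and> (\<forall>B. open B \<longrightarrow> B \<inter> X \<noteq> {} \<longrightarrow> B \<inter> U \<inter> X \<noteq> {})"

definition generic :: "'b::topological_space set \<Rightarrow> ('b \<Rightarrow> bool) \<Rightarrow> bool" where
  "generic X P \<longleftrightarrow> (\<exists>\<U>. countable \<U> \<and> (\<forall>U\<in>\<U>. dense_open_in X U) \<and> (\<forall>x\<in>X. (\<forall>U\<in>\<U>. x \<in> U) \<longrightarrow> P x))"

lemma generic_dense_open: "dense_open_in X U \<Longrightarrow> generic X (\<lambda>x. x \<in> U)"
  unfolding generic_def by (intro exI[of _ "{U}"]) auto

lemma generic_mono: "generic X P \<Longrightarrow> (\<And>x. x \<in> X \<Longrightarrow> P x \<Longrightarrow> R x) \<Longrightarrow> generic X R"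
  unfolding generic_def by (elim exE conjE, rule exI, intro conjI, assumption+) simp

lemma generic_ball:
  assumes "countable I" "\<And>i. i \<in> I \<Longrightarrow> generic X (P i)"
  shows "generic X (\<lambda>x. \<forall>i\<in>I. P i x)"
proof -
  obtain \<U> where \<U>: "\<And>i. i \<in> I \<Longrightarrow> countable (\<U> i)" "\<And>i U. i \<in> I \<Longrightarrow> U \<in> \<U> i \<Longrightarrow> dense_open_in X U"
    "\<And>i x. i \<in> I \<Longrightarrow> x \<in> X \<Longrightarrow> (\<forall>U\<in>\<U> i. x \<in> U) \<Longrightarrow> P i x"
    using assms(2) unfolding generic_def by metis
  show ?thesis
    unfolding generic_def
  proof (intro exI conjI ballI impI)
    show "countable (\<Union>i\<in>I. \<U> i)" using assms(1) \<U>(1) by (rule countable_UN)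
    show "dense_open_in X U" if "U \<in> (\<Union>i\<in>I. \<U> i)" for U using that \<U>(2) by auto
    show "P i x" if "x \<in> X" "\<forall>U\<in>\<Union>i\<in>I. \<U> i. x \<in> U" "i \<in> I" for x i
      using that by (intro \<U>(3)) auto
  qed
qed

lemma generic_conj:
  assumes "generic X P" "generic X R"
  shows "generic X (\<lambda>x. P x \<and> R x)"
proof -
  have "generic X (\<lambda>x. \<forall>S\<in>{P, R}. S x)"
    by (rule generic_ball) (use assms in \<open>auto split: if_splits\<close>)
  then show ?thesis by (rule generic_mono) auto
qed

lemma generic_dense:
  fixes X :: "'b::t2_space set"
  assumes "compact X" "generic X P" "open B" "B \<inter> X \<noteq> {}"
  obtains x where "x \<in> B" "x \<in> X" "P x"
proof -
  obtain \<U> where \<U>: "countable \<U>" "\<And>U. U \<in> \<U> \<Longrightarrow> dense_open_in X U"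
    "\<And>x. x \<in> X \<Longrightarrow> (\<forall>U\<in>\<U>. x \<in> U) \<Longrightarrow> P x"
    using assms(2) unfolding generic_def by blast
  have H: "Hausdorff_space (top_of_set X)"
    unfolding Hausdorff_space_def disjnt_def
  proof (intro allI impI)
    fix x y assume xy: "x \<in> topspace (top_of_set X) \<and> y \<in> topspace (top_of_set X) \<and> x \<noteq> y"
    then have "x \<noteq> y" by blast
    from hausdorff[OF this] obtain U V where "open U" "open V" "x \<in> U" "y \<in> V" "U \<inter> V = {}"
      by (elim exE conjE)
    then show "\<exists>U V. openin (top_of_set X) U \<and> openin (top_of_set X) V \<and> x \<in> U \<and> y \<in> V \<and> U \<inter> V = {}"
      using xy by (intro exI[of _ "X \<inter> U"] exI[of _ "X \<inter> V"]) auto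
  qed
  have c: "compact_space (top_of_set X)" using assms(1) by (simp add: compact_space_subtopology)
  define \<V> where "\<V> = (\<lambda>U. X \<inter> U) ` \<U>"
  have "top_of_set X closure_of \<Inter>\<V> = topspace (top_of_set X)"
  proof (rule Baire_category)
    show "completely_metrizable_space (top_of_set X) \<or>
        locally_compact_space (top_of_set X) \<and> regular_space (top_of_set X)"
      using H c compact_Hausdorff_imp_regular_space compact_imp_locally_compact_space by blast
    show "countable \<V>" using \<U>(1) by (simp add: \<V>_def)
    fix T assume "T \<in> \<V>"
    then obtain U where U: "U \<in> \<U>" "T = X \<inter> U" by (auto simp: \<V>_def)
    have "x \<in> top_of_set X closure_of T" if "x \<in> X" for x
      unfolding in_closure_of
    proof (intro conjI allI impI)
      fix S assume "x \<in> S \<and> openin (top_of_set X) S"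
      then obtain B where "open B" "S = X \<inter> B" "x \<in> B" by (auto simp: openin_open)
      then show "\<exists>y. y \<in> T \<and> y \<in> S"
        using \<U>(2)[OF U(1)] that U(2) unfolding dense_open_in_def by blast
    qed (use that in simp)
    then show "openin (top_of_set X) T \<and> top_of_set X closure_of T = topspace (top_of_set X)"
      using U \<U>(2)[OF U(1)] closure_of_subset_topspace[of "top_of_set X" T]
      by (auto simp: dense_open_in_def)
  qed
  moreover obtain b where b: "b \<in> B" "b \<in> X" using assms(4) by blast
  ultimately have "b \<in> top_of_set X closure_of \<Inter>\<V>" by simp
  moreover have "openin (top_of_set X) (X \<inter> B)" using assms(3) by blast
  ultimately obtain y where "y \<in> \<Inter>\<V>" "y \<in> X \<inter> B"
    using b unfolding in_closure_of by blast
  moreover from this have "\<forall>U\<in>\<U>. y \<in> U" unfolding \<V>_def by blast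
  ultimately show thesis using that[of y] \<U>(3)[of y] by blast
qed

text \<open>The exceptional points lie on the relative boundary of an open set, which is nowhere
  dense in \<open>X\<close>.\<close>

lemma generic_closure_imp:
  assumes "open U"
  shows "generic X (\<lambda>x. x \<in> closure (U \<inter> X) \<longrightarrow> x \<in> U)"
proof -
  have "dense_open_in X (- closure (U \<inter> X) \<union> U)"
    unfolding dense_open_in_def
  proof (intro conjI allI impI)
    fix B assume B: "open B" "B \<inter> X \<noteq> {}"
    show "B \<inter> (- closure (U \<inter> X) \<union> U) \<inter> X \<noteq> {}"
    proof (cases "B \<inter> (U \<inter> X) = {}")
      case True
      then have "B \<inter> closure (U \<inter> X) = {}" using B open_Int_closure_eq_empty by blast
      then show ?thesis using B by blast
    qed blast
  qed (use assms in auto)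
  then show ?thesis by (rule generic_mono[OF generic_dense_open]) auto
qed

text \<open>The complement of a closed set together with its relative interior is open and dense in
  \<open>X\<close>.\<close>

lemma generic_closed_imp_interior:
  assumes "closed C"
  shows "generic X (\<lambda>x. x \<in> C \<longrightarrow> (\<exists>B. open B \<and> x \<in> B \<and> B \<inter> X \<subseteq> C))"
proof -
  define U where "U = - C \<union> \<Union>{B. open B \<and> B \<inter> X \<subseteq> C}"
  have "dense_open_in X U"
    unfolding dense_open_in_def
  proof (intro conjI allI impI)
    show "open U" using assms by (auto simp: U_def)
    fix B assume B: "open B" "B \<inter> X \<noteq> {}"
    show "B \<inter> U \<inter> X \<noteq> {}"
      by (cases "B \<inter> X \<subseteq> C") (use B in \<open>auto simp: U_def\<close>)
  qed
  then show ?thesis by (rule generic_mono[OF generic_dense_open]) (auto simp: U_def)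
qed

section \<open>Regional proximality in a minimal action\<close>

locale minimal_action = compact_t2_action G X \<phi>
  for G :: "('g, 'm) monoid_scheme" (structure)
    and X :: "'a::metric_space set"
    and \<phi> :: "'g \<Rightarrow> 'a \<Rightarrow> 'a" +
  assumes minimal: "minimal_set X"
begin

lemma syndetic_visits:
  assumes "open U" "U \<inter> X \<noteq> {}"
  obtains F where "finite F" "F \<subseteq> carrier G" "\<And>x. x \<in> X \<Longrightarrow> \<exists>f\<in>F. \<phi> f x \<in> U"
  using minimal_set_syndetic[OF minimal assms(1)] assms(2) by (metis Int_commute)

lemma visits:
  assumes "open U" "U \<inter> X \<noteq> {}" "x \<in> X"
  obtains g where "g \<in> carrier G" "\<phi> g x \<in> U"
  using minimal_set_visits[OF minimal assms(3,1)] assms(2) by (metis Int_commute)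

lemma equicontinuous_finite:
  assumes "finite F" "F \<subseteq> carrier G" "e > 0"
  obtains d where "d > 0"
    "\<And>f a b. f \<in> F \<Longrightarrow> a \<in> X \<Longrightarrow> b \<in> X \<Longrightarrow> dist a b < d \<Longrightarrow> dist (\<phi> f a) (\<phi> f b) < e"
proof -
  have "\<exists>d>0. \<forall>f\<in>F. \<forall>a\<in>X. \<forall>b\<in>X. dist a b < d \<longrightarrow> dist (\<phi> f a) (\<phi> f b) < e"
    using assms(1,2)
  proof (induction rule: finite_induct)
    case empty
    show ?case by (rule exI[of _ 1]) simp
  next
    case (insert f F)
    then obtain d where d: "d > 0" "\<And>h a b. h \<in> F \<Longrightarrow> a \<in> X \<Longrightarrow> b \<in> X \<Longrightarrow> dist a b < d \<Longrightarrow> dist (\<phi> h a) (\<phi> h b) < e"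
      by (metis insert_subset)
    have "uniformly_continuous_on X (\<phi> f)"
      using insert.prems by (intro compact_uniformly_continuous cont compact_carrier) auto
    then obtain d' where d': "d' > 0" "\<And>a b. a \<in> X \<Longrightarrow> b \<in> X \<Longrightarrow> dist a b < d' \<Longrightarrow> dist (\<phi> f a) (\<phi> f b) < e"
      using assms(3) unfolding uniformly_continuous_on_def by (metis dist_commute)
    show ?case
      by (rule exI[of _ "min d d'"]) (use d d' in auto)
  qed
  then show thesis using that by blast
qed

text \<open>A finite set of group elements brings every point into a ball of radius
  \<open>e / 2\<close>; its equicontinuity takes up the other half, so a whole ball about
  \<open>x\<close> is carried by one \<open>h\<close>.\<close>

lemma uniform_visits:
  assumes "open U" "U \<inter> X \<noteq> {}"
  obtains d where "d > 0"
    "\<And>x. x \<in> X \<Longrightarrow> \<exists>h\<in>carrier G. \<forall>y\<in>X. dist x y < d \<longrightarrow> \<phi> h y \<in> U"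
proof -
  obtain p where p: "p \<in> U" "p \<in> X" using assms(2) by blast
  then obtain e where e: "e > 0" "ball p e \<subseteq> U" using assms(1) open_contains_ball by blast
  have ne: "ball p (e / 2) \<inter> X \<noteq> {}" using p e centre_in_ball[of p "e / 2"] by fastforce
  obtain F where F: "finite F" "F \<subseteq> carrier G" "\<And>x. x \<in> X \<Longrightarrow> \<exists>f\<in>F. \<phi> f x \<in> ball p (e / 2)"
    using syndetic_visits[OF open_ball ne] by blast
  obtain d where d: "d > 0"
    "\<And>f a b. f \<in> F \<Longrightarrow> a \<in> X \<Longrightarrow> b \<in> X \<Longrightarrow> dist a b < d \<Longrightarrow> dist (\<phi> f a) (\<phi> f b) < e / 2"
    using equicontinuous_finite[OF F(1,2), of "e / 2"] e by auto
  show thesis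
  proof (rule that[OF d(1)])
    fix x assume x: "x \<in> X"
    then obtain f where f: "f \<in> F" "dist p (\<phi> f x) < e / 2" using F(3) by auto
    have "\<phi> f y \<in> U" if "y \<in> X" "dist x y < d" for y
      using d(2)[OF f(1) x that] f(2) dist_triangle[of p "\<phi> f y" "\<phi> f x"] e(2) by auto
    then show "\<exists>h\<in>carrier G. \<forall>y\<in>X. dist x y < d \<longrightarrow> \<phi> h y \<in> U" using f(1) F(2) by blast
  qed
qed

section \<open>The regionally proximal relation\<close>

definition near_orbit :: "real \<Rightarrow> ('a \<times> 'a) set" where
  "near_orbit e = {(a, b). a \<in> X \<and> b \<in> X \<and> (\<exists>g\<in>carrier G. dist (\<phi> g a) (\<phi> g b) < e)}"

abbreviation RP :: "('a \<times> 'a) set" where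
  "RP \<equiv> regionally_proximal G X \<phi>"

text \<open>This presents the relation as the intersection over \<open>e\<close> of the closures of
  the sets \<open>near_orbit e\<close>, each of which is invariant and open relative to
  \<open>X \<times> X\<close>.\<close>

lemma RP_iff: "(x, y) \<in> RP \<longleftrightarrow> x \<in> X \<and> y \<in> X \<and>
    (\<forall>e>0. \<exists>a b. (a, b) \<in> near_orbit e \<and> dist x a < e \<and> dist y b < e)"
  unfolding regionally_proximal_def near_orbit_def by fastforce

lemma near_orbit_mono: "d \<le> e \<Longrightarrow> near_orbit d \<subseteq> near_orbit e"
  unfolding near_orbit_def by (clarsimp, meson order.strict_trans2)

lemma RP_D:
  assumes "(x, y) \<in> RP" "r > 0" "e > 0"
  obtains a b where "(a, b) \<in> near_orbit e" "dist x a < r" "dist y b < r"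
proof -
  have "min r e > 0" using assms by simp
  then obtain a b where "(a, b) \<in> near_orbit (min r e)" "dist x a < min r e" "dist y b < min r e"
    using assms(1) RP_iff by blast
  then show thesis using that near_orbit_mono[of "min r e" e] by auto
qed

lemma near_orbit_sym: "(a, b) \<in> near_orbit e \<Longrightarrow> (b, a) \<in> near_orbit e"
  unfolding near_orbit_def by (auto simp: dist_commute)

lemma RP_sym: "(x, y) \<in> RP \<Longrightarrow> (y, x) \<in> RP"
  unfolding RP_iff using near_orbit_sym by blast

lemma RP_subset: "(x, y) \<in> RP \<Longrightarrow> x \<in> X \<and> y \<in> X"
  by (simp add: RP_iff)

lemma RP_refl: "x \<in> X \<Longrightarrow> (x, x) \<in> RP"
  unfolding RP_iff near_orbit_def by (auto intro!: exI[of _ x])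

lemma near_orbit_act: "g \<in> carrier G \<Longrightarrow> (a, b) \<in> near_orbit e \<Longrightarrow> (\<phi> g a, \<phi> g b) \<in> near_orbit e"
proof -
  assume g: "g \<in> carrier G" and "(a, b) \<in> near_orbit e"
  then obtain h where h: "h \<in> carrier G" "dist (\<phi> h a) (\<phi> h b) < e" "a \<in> X" "b \<in> X"
    by (auto simp: near_orbit_def)
  have "\<phi> (h \<otimes> inv g) (\<phi> g x) = \<phi> h x" if "x \<in> X" for x
    using that g h(1) by (simp add: act_mult stay)
  then show ?thesis using g h unfolding near_orbit_def
    by (auto simp: stay intro!: bexI[of _ "h \<otimes> inv g"])
qed

lemma cont_at:
  assumes "g \<in> carrier G" "x \<in> X" "e > 0"
  obtains d where "d > 0" "\<And>y. y \<in> X \<Longrightarrow> dist x y < d \<Longrightarrow> dist (\<phi> g x) (\<phi> g y) < e"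
  using cont[OF assms(1)] assms(2,3) unfolding continuous_on_iff by (metis dist_commute)

lemma RP_act:
  assumes g: "g \<in> carrier G" and xy: "(x, y) \<in> RP"
  shows "(\<phi> g x, \<phi> g y) \<in> RP"
  unfolding RP_iff
proof (intro conjI allI impI)
  have X: "x \<in> X" "y \<in> X" using xy RP_subset by auto
  then show "\<phi> g x \<in> X" "\<phi> g y \<in> X" using g stay by auto
  fix e :: real assume e: "e > 0"
  obtain d1 d2 where d: "d1 > 0" "\<And>z. z \<in> X \<Longrightarrow> dist x z < d1 \<Longrightarrow> dist (\<phi> g x) (\<phi> g z) < e"
    "d2 > 0" "\<And>z. z \<in> X \<Longrightarrow> dist y z < d2 \<Longrightarrow> dist (\<phi> g y) (\<phi> g z) < e"
    using cont_at[OF g X(1) e] cont_at[OF g X(2) e] by metis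
  obtain a b where ab: "(a, b) \<in> near_orbit e" "dist x a < min d1 d2" "dist y b < min d1 d2"
    using RP_D[OF xy, of "min d1 d2" e] d e by auto
  then have "a \<in> X" "b \<in> X" by (auto simp: near_orbit_def)
  then show "\<exists>a b. (a, b) \<in> near_orbit e \<and> dist (\<phi> g x) a < e \<and> dist (\<phi> g y) b < e"
    using d ab near_orbit_act[OF g ab(1)] by (intro exI[of _ "\<phi> g a"] exI[of _ "\<phi> g b"]) auto
qed

lemma RP_image:
  assumes "g \<in> carrier G" "x \<in> X"
  shows "RP `` {\<phi> g x} = \<phi> g ` (RP `` {x})"
proof -
  have "y \<in> \<phi> g ` (RP `` {x})" if "(\<phi> g x, y) \<in> RP" for y
  proof -
    have y: "y \<in> X" using that RP_subset by blast
    then have "(x, \<phi> (inv g) y) \<in> RP"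
      using RP_act[OF _ that, of "inv g"] assms by simp
    then show ?thesis using y assms(1) by (intro image_eqI[of _ _ "\<phi> (inv g) y"]) auto
  qed
  then show ?thesis using assms(1) RP_act by blast
qed

lemma act_inj: "g \<in> carrier G \<Longrightarrow> inj_on (\<phi> g) X"
  by (metis inj_onI inv_act(1))

lemma near_orbit_open:
  assumes "(a, b) \<in> near_orbit e"
  obtains r where "r > 0" "\<And>a' b'. a' \<in> X \<Longrightarrow> b' \<in> X \<Longrightarrow> dist a a' < r \<Longrightarrow> dist b b' < r \<Longrightarrow> (a', b') \<in> near_orbit e"
proof -
  obtain g where g: "g \<in> carrier G" "dist (\<phi> g a) (\<phi> g b) < e" "a \<in> X" "b \<in> X"
    using assms by (auto simp: near_orbit_def)
  define s where "s = (e - dist (\<phi> g a) (\<phi> g b)) / 2"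
  have s: "s > 0" using g(2) by (simp add: s_def)
  obtain d1 d2 where d: "d1 > 0" "\<And>z. z \<in> X \<Longrightarrow> dist a z < d1 \<Longrightarrow> dist (\<phi> g a) (\<phi> g z) < s"
    "d2 > 0" "\<And>z. z \<in> X \<Longrightarrow> dist b z < d2 \<Longrightarrow> dist (\<phi> g b) (\<phi> g z) < s"
    using cont_at[OF g(1,3) s] cont_at[OF g(1,4) s] by metis
  show thesis
  proof (rule that[of "min d1 d2"])
    fix a' b' assume "a' \<in> X" "b' \<in> X" "dist a a' < min d1 d2" "dist b b' < min d1 d2"
    then have "dist (\<phi> g a) (\<phi> g a') < s" "dist (\<phi> g b) (\<phi> g b') < s" "a' \<in> X" "b' \<in> X" using d by auto
    moreover have "dist (\<phi> g a') (\<phi> g b') \<le> dist (\<phi> g a) (\<phi> g a') + dist (\<phi> g a) (\<phi> g b) + dist (\<phi> g b) (\<phi> g b')"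
      using dist_triangle[of "\<phi> g a'" "\<phi> g b'" "\<phi> g a"] dist_triangle[of "\<phi> g a" "\<phi> g b'" "\<phi> g b"]
      by (simp add: dist_commute)
    ultimately show "(a', b') \<in> near_orbit e"
      unfolding near_orbit_def using g(1) by (auto simp: s_def intro!: bexI[of _ g])
  qed (use d in auto)
qed

text \<open>A pair in \<open>RP\<close> is itself a limit of pairs in \<open>near_orbit\<close>, so
  half of \<open>e\<close> is spent on reaching it. Admitting both kinds of approximation serves
  closedness of \<open>RP\<close> as well as limits of nearly proximal pairs.\<close>

lemma RP_closure:
  assumes "x \<in> X" "y \<in> X"
    "\<And>e. e > 0 \<Longrightarrow> \<exists>a b. (a, b) \<in> RP \<union> near_orbit e \<and> dist x a < e \<and> dist y b < e"
  shows "(x, y) \<in> RP"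
  unfolding RP_iff
proof (intro conjI allI impI)
  fix e :: real assume e: "e > 0"
  obtain a b where ab: "(a, b) \<in> RP \<union> near_orbit (e / 2)" "dist x a < e / 2" "dist y b < e / 2"
    using assms(3)[of "e / 2"] e by auto
  show "\<exists>a b. (a, b) \<in> near_orbit e \<and> dist x a < e \<and> dist y b < e"
  proof (cases "(a, b) \<in> RP")
    case True
    obtain a' b' where "(a', b') \<in> near_orbit e" "dist a a' < e / 2" "dist b b' < e / 2"
      using RP_D[OF True, of "e / 2" e] e by auto
    then show ?thesis using ab dist_triangle[of x a' a] dist_triangle[of y b' b]
      by (intro exI[of _ a'] exI[of _ b']) auto
  next
    case False
    then show ?thesis using ab near_orbit_mono[of "e / 2" e] e by (intro exI[of _ a] exI[of _ b]) auto
  qed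
qed (use assms in auto)

lemma RP_closed: "closed RP"
proof -
  have "p \<in> RP" if p: "p \<in> closure RP" for p
  proof -
    obtain x y where xy: "p = (x, y)" by (cases p)
    have "closure RP \<subseteq> X \<times> X"
      by (rule closure_minimal) (auto simp: RP_iff closed_Times closed_carrier)
    then have "x \<in> X" "y \<in> X" using p xy by auto
    moreover have "\<exists>a b. (a, b) \<in> RP \<union> near_orbit e \<and> dist x a < e \<and> dist y b < e" if e: "e > 0" for e
    proof -
      obtain q where q: "q \<in> RP" "dist q p < e" using p e unfolding closure_approachable by blast
      then show ?thesis
        using dist_fst_le[of q p] dist_snd_le[of q p] xy
        by (intro exI[of _ "fst q"] exI[of _ "snd q"]) (auto simp: dist_commute)
    qed
    ultimately show ?thesis using RP_closure xy by blast
  qed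
  then show ?thesis by (simp add: closure_subset_eq[symmetric] subsetI)
qed

text \<open>Upper semicontinuity of the sections: the set is the projection of a compact part of
  \<open>RP\<close>.\<close>

lemma RP_preimage_closed:
  assumes "closed C"
  shows "closed {x \<in> X. RP `` {x} \<inter> C \<noteq> {}}"
proof -
  have "{x \<in> X. RP `` {x} \<inter> C \<noteq> {}} = fst ` (RP \<inter> X \<times> (X \<inter> C))"
    using RP_subset by force
  moreover have "compact (RP \<inter> X \<times> (X \<inter> C))"
    using assms by (intro closed_Int_compact RP_closed compact_Times compact_carrier compact_Int_closed)
  ultimately show ?thesis by (simp add: compact_imp_closed compact_continuous_image continuous_on_fst)
qed

text \<open>Otherwise, for counterexamples with \<open>d\<close> tending to \<open>0\<close>, the
  second coordinates accumulate at some \<open>c\<close> with \<open>(z, c) \<in> RP\<close>,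
  against their distance from the section.\<close>

lemma RP_near_section:
  assumes z: "z \<in> X" and e: "e > 0"
  obtains d where "d > 0"
    "\<And>a b. dist z a < d \<Longrightarrow> (a, b) \<in> near_orbit d \<Longrightarrow> \<exists>q\<in>RP `` {z}. dist q b < e"
proof -
  have "\<exists>d>0. \<forall>a b. dist z a < d \<longrightarrow> (a, b) \<in> near_orbit d \<longrightarrow> (\<exists>q\<in>RP `` {z}. dist q b < e)"
  proof (rule ccontr)
    assume "\<not> ?thesis"
    then have "\<exists>a b. dist z a < 1 / real (Suc k) \<and> (a, b) \<in> near_orbit (1 / real (Suc k)) \<and>
        (\<forall>q\<in>RP `` {z}. dist q b \<ge> e)" for k
      by (metis linorder_not_less of_nat_0_less_iff zero_less_Suc zero_less_divide_1_iff)
    then obtain a b where ab: "\<And>k. dist z (a k) < 1 / real (Suc k)"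
      "\<And>k. (a k, b k) \<in> near_orbit (1 / real (Suc k))"
      "\<And>k q. q \<in> RP `` {z} \<Longrightarrow> dist q (b k) \<ge> e" by metis
    have "\<forall>k. b k \<in> X" using ab(2) by (auto simp: near_orbit_def)
    then obtain c r where c: "c \<in> X" "strict_mono r" "(b \<circ> r) \<longlonglongrightarrow> c"
      using compact_carrier seq_compactE[of X b] compact_eq_seq_compact_metric by metis
    have "(z, c) \<in> RP"
    proof (rule RP_closure[OF z c(1)])
      fix e' :: real assume e': "e' > 0"
      obtain k0 where k0: "1 / real (Suc k0) < e'" using e' nat_approx_posE by blast
      have "\<forall>\<^sub>F k in sequentially. dist ((b \<circ> r) k) c < e'" using c(3) e' by (rule tendstoD)
      then obtain k where k: "k \<ge> k0" "dist (b (r k)) c < e'"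
        unfolding eventually_sequentially by (metis comp_apply nle_le order_refl)
      have "r k \<ge> k0" using k(1) c(2) seq_suble order_trans by blast
      then have "1 / real (Suc (r k)) \<le> 1 / real (Suc k0)" by (simp add: frac_le)
      then show "\<exists>a b. (a, b) \<in> RP \<union> near_orbit e' \<and> dist z a < e' \<and> dist c b < e'"
        using ab(1,2)[of "r k"] k(2) k0 near_orbit_mono[of "1 / real (Suc (r k))" e']
        by (intro exI[of _ "a (r k)"] exI[of _ "b (r k)"]) (auto simp: dist_commute)
    qed
    then have far: "dist c (b k) \<ge> e" for k using ab(3) by simp
    have "\<forall>\<^sub>F k in sequentially. dist ((b \<circ> r) k) c < e" using c(3) e by (rule tendstoD)
    then obtain k where "dist (b (r k)) c < e" unfolding eventually_sequentially by auto
    then show False using far[of "r k"] by (simp add: dist_commute)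
  qed
  then show thesis using that by blast
qed

end

section \<open>Minimal sets in products\<close>

text \<open>The second factor will be \<open>X\<close> itself for pairs, and the space
  \<open>seqs\<close> for a point together with a tuple.\<close>

locale action_pair = minimal_action G X \<phi> + Y: compact_t2_action G Y \<psi>
  for G :: "('g, 'm) monoid_scheme" (structure)
    and X :: "'a::metric_space set"
    and \<phi> :: "'g \<Rightarrow> 'a \<Rightarrow> 'a"
    and Y :: "'b::metric_space set"
    and \<psi> :: "'g \<Rightarrow> 'b \<Rightarrow> 'b"
begin

lemma product_action: "compact_t2_action G (X \<times> Y) (\<lambda>g. map_prod (\<phi> g) (\<psi> g))"
proof unfold_locales
  show "compact (X \<times> Y)" by (intro compact_Times compact_carrier Y.compact_carrier)
  show "closed (X \<times> Y)" by (intro closed_Times closed_carrier Y.closed_carrier)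
  fix g assume g: "g \<in> carrier G"
  have "continuous_on (X \<times> Y) (\<lambda>p. (\<phi> g (fst p), \<psi> g (snd p)))"
    by (intro continuous_on_Pair continuous_on_compose2[OF cont[OF g]]
        continuous_on_compose2[OF Y.cont[OF g]] continuous_intros) auto
  then show "continuous_on (X \<times> Y) (map_prod (\<phi> g) (\<psi> g))" by (simp add: map_prod_def case_prod_beta')
qed (auto simp: stay Y.stay act_one Y.act_one act_mult Y.act_mult)

sublocale P: compact_t2_action G "X \<times> Y" "\<lambda>g. map_prod (\<phi> g) (\<psi> g)"
  by (rule product_action)

lemma invariant_eq_carrier:
  assumes "closed K" "K \<noteq> {}" "invariant K"
  shows "K = X"
  using minimal_set_eq[OF minimal] assms invariant_subset by blast

lemma fst_invariant_closed:
  assumes "closed N" "N \<noteq> {}" "P.invariant N"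
  shows "fst ` N = X"
proof (rule invariant_eq_carrier)
  have "N \<subseteq> X \<times> Y" using assms P.invariant_subset by blast
  then have "compact N" using compact_Int_closed[OF P.compact_carrier assms(1)] by (simp add: Int_absorb1)
  then show "closed (fst ` N)" by (intro compact_imp_closed compact_continuous_image continuous_on_fst continuous_on_id)
  show "invariant (fst ` N)"
    unfolding invariant_def
  proof (intro conjI ballI)
    show "fst ` N \<subseteq> X" using \<open>N \<subseteq> X \<times> Y\<close> by auto
    fix g x assume gx: "g \<in> carrier G" "x \<in> fst ` N"
    then obtain y where "(x, y) \<in> N" by auto
    then have "(\<phi> g x, \<psi> g y) \<in> N" using P.invariantD[OF assms(3) gx(1)] by fastforce
    then show "\<phi> g x \<in> fst ` N" by force
  qed
qed (use assms in auto)

text \<open>The projection of a minimal set onto the minimal \<open>X\<close> is semi-open. Finitely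
  many preimages of the projection \<open>C\<close> of a small closed box cover \<open>X\<close>, so
  one of them has interior relative to \<open>X\<close>; translating it back puts an open set into
  \<open>C\<close>.\<close>

lemma minimal_set_semi_open:
  assumes N: "P.minimal_set N" and ad: "(a, d0) \<in> N" "open A" "a \<in> A" "open D" "d0 \<in> D"
  obtains B where "open B" "B \<inter> X \<noteq> {}" "B \<inter> X \<subseteq> A" "\<And>b. b \<in> B \<Longrightarrow> b \<in> X \<Longrightarrow> \<exists>d\<in>D. (b, d) \<in> N"
proof -
  obtain r where r: "r > 0" "cball a r \<subseteq> A" using ad open_contains_cball by blast
  obtain s where s: "s > 0" "cball d0 s \<subseteq> D" using ad open_contains_cball by blast
  define C where "C = fst ` (N \<inter> cball a r \<times> cball d0 s)"
  have "compact (N \<inter> cball a r \<times> cball d0 s)"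
    by (rule compact_Int_closed[OF P.minimal_setD(5)[OF N]]) (simp add: closed_Times)
  then have closedC: "closed C" unfolding C_def
    by (intro compact_imp_closed compact_continuous_image continuous_on_fst continuous_on_id)
  have op: "open (ball a r \<times> ball d0 s)" by (intro open_Times) auto
  have "N \<inter> ball a r \<times> ball d0 s \<noteq> {}" using ad r s by auto
  from P.minimal_set_syndetic[OF N op this] obtain F where F: "finite F" "F \<subseteq> carrier G"
    "\<And>p. p \<in> N \<Longrightarrow> \<exists>f\<in>F. map_prod (\<phi> f) (\<psi> f) p \<in> ball a r \<times> ball d0 s" by blast
  define \<C> where "\<C> = (\<lambda>f. X \<inter> \<phi> f -` C) ` F"
  have pr: "fst ` N = X"
    by (rule fst_invariant_closed) (use P.minimal_setD[OF N] in simp_all)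
  have cover: "UNIV \<inter> X \<subseteq> \<Union>\<C>"
  proof
    fix x assume "x \<in> UNIV \<inter> X"
    then obtain y where xy: "(x, y) \<in> N" "x \<in> X" using pr by auto
    from F(3)[OF xy(1)]
    obtain f where f: "f \<in> F" "map_prod (\<phi> f) (\<psi> f) (x, y) \<in> ball a r \<times> ball d0 s"
      by (elim bexE)
    have fc: "f \<in> carrier G" using f(1) F(2) by blast
    have "map_prod (\<phi> f) (\<psi> f) (x, y) \<in> N"
      by (rule P.invariantD[OF P.minimal_setD(3)[OF N] fc xy(1)])
    with f have "\<phi> f x \<in> C" unfolding C_def by force
    then show "x \<in> \<Union>\<C>" using f(1) xy(2) by (auto simp: \<C>_def)
  qed
  have ne: "UNIV \<inter> X \<noteq> {}" using minimal minimal_setD(1) by blast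
  have fin: "finite \<C>" using F(1) by (simp add: \<C>_def)
  have cl: "closed E" if "E \<in> \<C>" for E
  proof -
    from that obtain f where f: "f \<in> F" "E = X \<inter> \<phi> f -` C" unfolding \<C>_def by (elim imageE)
    then have "continuous_on X (\<phi> f)" using F(2) cont by blast
    then show ?thesis unfolding f(2) by (rule continuous_closed_preimage[OF _ closed_carrier closedC])
  qed
  have "\<exists>E\<in>\<C>. \<exists>B'. open B' \<and> B' \<subseteq> UNIV \<and> B' \<inter> X \<noteq> {} \<and> B' \<inter> X \<subseteq> E"
    by (rule finite_closed_cover_interior[OF fin _ open_UNIV ne cover]) (rule cl)
  then obtain E B' where E: "E \<in> \<C>" and B'0: "open B' \<and> B' \<subseteq> UNIV \<and> B' \<inter> X \<noteq> {} \<and> B' \<inter> X \<subseteq> E"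
    by (elim bexE exE)
  from E obtain f where "f \<in> F" "E = X \<inter> \<phi> f -` C" unfolding \<C>_def by (elim imageE)
  with B'0 have B': "f \<in> F" "open B'" "B' \<inter> X \<noteq> {}" "B' \<inter> X \<subseteq> \<phi> f -` C" by auto
  have f: "f \<in> carrier G" using B'(1) F(2) by blast
  \<comment> \<open>\<open>B\<close> will be an ambient open set whose trace on \<open>X\<close> is
    the image of \<open>B' \<inter> X\<close> under \<open>\<phi> f\<close>.\<close>
  have "continuous_on X (\<phi> (inv f))" using f by (intro cont) simp
  then obtain B where B: "open B" "B \<inter> X = \<phi> (inv f) -` B' \<inter> X"
    using B'(2) continuous_on_open_invariant by metis
  have *: "b \<in> C" if "b \<in> B \<inter> X" for b
  proof -
    have "\<phi> (inv f) b \<in> B'" "b \<in> X" using that B(2) by auto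
    then have "\<phi> f (\<phi> (inv f) b) \<in> C" using B'(4) f stay[of "inv f" b] by auto
    then show ?thesis using f \<open>b \<in> X\<close> by simp
  qed
  show thesis
  proof (rule that[OF B(1)])
    obtain x where "x \<in> B'" "x \<in> X" using B'(3) by blast
    then have "\<phi> f x \<in> B \<inter> X" unfolding B(2) using f stay by simp
    then show "B \<inter> X \<noteq> {}" by blast
    show "B \<inter> X \<subseteq> A" using * r(2) by (force simp: C_def)
    show "\<exists>d\<in>D. (b, d) \<in> N" if "b \<in> B" "b \<in> X" for b using *[of b] that s(2) by (force simp: C_def)
  qed
qed

text \<open>For \<open>p\<close> in \<open>X\<close> this strengthens density in \<open>Y\<close> of
  the points \<open>d\<close> with \<open>(p, d)\<close> minimal: a single minimal set reaches
  \<open>D\<close> over a whole neighbourhood of \<open>p\<close>.\<close>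

definition linked :: "'a \<Rightarrow> bool" where
  "linked p \<longleftrightarrow> (\<forall>D. open D \<longrightarrow> D \<inter> Y \<noteq> {} \<longrightarrow>
     (\<exists>N B. P.minimal_set N \<and> open B \<and> p \<in> B \<and> (\<forall>b\<in>B \<inter> X. \<exists>d\<in>D. (b, d) \<in> N)))"

lemma linkedD:
  assumes "linked p" "open D" "D \<inter> Y \<noteq> {}"
  obtains N B where "P.minimal_set N" "open B" "p \<in> B" "\<And>b. b \<in> B \<Longrightarrow> b \<in> X \<Longrightarrow> \<exists>d\<in>D. (b, d) \<in> N"
  using assms unfolding linked_def by (metis IntI)

text \<open>For one basic \<open>D\<close>, semi-openness of minimal sets makes the union of the
  admissible \<open>B\<close> dense in \<open>X\<close>; a countable basis leaves countably many
  such conditions.\<close>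

lemma generic_linked:
  assumes dense: "\<And>A D. open A \<Longrightarrow> open D \<Longrightarrow> A \<inter> X \<noteq> {} \<Longrightarrow> D \<inter> Y \<noteq> {} \<Longrightarrow>
    \<exists>N. P.minimal_set N \<and> N \<inter> A \<times> D \<noteq> {}"
  shows "generic X linked"
proof -
  obtain \<B> where \<B>: "countable \<B>" "\<And>V. V \<in> \<B> \<Longrightarrow> open V"
    "\<And>y r. y \<in> Y \<Longrightarrow> r > 0 \<Longrightarrow> \<exists>V\<in>\<B>. y \<in> V \<and> V \<subseteq> ball y r"
    using compact_countable_basis[OF Y.compact_carrier] by blast
  define link where "link D B \<longleftrightarrow> open B \<and> (\<exists>N. P.minimal_set N \<and> (\<forall>b\<in>B \<inter> X. \<exists>d\<in>D. (b, d) \<in> N))" for D B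
  have "generic X (\<lambda>p. \<forall>D\<in>{D \<in> \<B>. D \<inter> Y \<noteq> {}}. p \<in> \<Union>{B. link D B})"
  proof (rule generic_ball)
    show "countable {D \<in> \<B>. D \<inter> Y \<noteq> {}}" using \<B>(1) by (rule countable_subset[rotated]) auto
    fix D assume D: "D \<in> {D \<in> \<B>. D \<inter> Y \<noteq> {}}"
    show "generic X (\<lambda>p. p \<in> \<Union>{B. link D B})"
    proof (rule generic_dense_open, unfold dense_open_in_def, intro conjI allI impI)
      show "open (\<Union>{B. link D B})" by (auto simp: link_def)
      fix A assume A: "open A" "A \<inter> X \<noteq> {}"
      obtain N a d where N: "P.minimal_set N" "(a, d) \<in> N" "a \<in> A" "d \<in> D"
        using dense[OF A(1) _ A(2), of D] D \<B>(2) by auto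
      have "open D" using D \<B>(2) by blast
      from minimal_set_semi_open[OF N(1,2) A(1) N(3) this N(4)]
      obtain B where B: "open B" "B \<inter> X \<noteq> {}" "B \<inter> X \<subseteq> A" "\<And>b. b \<in> B \<Longrightarrow> b \<in> X \<Longrightarrow> \<exists>d\<in>D. (b, d) \<in> N"
        by blast
      then have "link D B" using N(1) unfolding link_def by blast
      then show "A \<inter> \<Union>{B. link D B} \<inter> X \<noteq> {}" using B by blast
    qed
  qed
  then show ?thesis
  proof (rule generic_mono)
    fix p assume p: "\<forall>D\<in>{D \<in> \<B>. D \<inter> Y \<noteq> {}}. p \<in> \<Union>{B. link D B}"
    show "linked p"
      unfolding linked_def
    proof (intro allI impI)
      fix D assume D: "open D" "D \<inter> Y \<noteq> {}"
      then obtain y r where y: "y \<in> Y" "r > 0" "ball y r \<subseteq> D" using open_contains_ball by blast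
      then obtain V where V: "V \<in> \<B>" "y \<in> V" "V \<subseteq> D" using \<B>(3) by blast
      then obtain B where "p \<in> B" "link V B" using p y(1) by blast
      moreover from this obtain N where "P.minimal_set N" "open B" "\<forall>b\<in>B \<inter> X. \<exists>d\<in>V. (b, d) \<in> N"
        unfolding link_def by (elim conjE exE)
      ultimately show "\<exists>N B. P.minimal_set N \<and> open B \<and> p \<in> B \<and> (\<forall>b\<in>B \<inter> X. \<exists>d\<in>D. (b, d) \<in> N)"
        using V(3) by (intro exI[of _ N] exI[of _ B]) (simp, blast)
    qed
  qed
qed

text \<open>The minimal set \<open>N\<close> inside \<open>S\<close> is chosen before the approximating pair, so that a whole
  neighbourhood of the compact set \<open>N\<close> still lies in \<open>U\<close>; being linked at \<open>p\<close> then leaves the freedom to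
  move \<open>p\<close>.\<close>

lemma regionally_proximal_transfer:
  assumes O: "P.invariant S" "open U" "S = U \<inter> (X \<times> Y)"
    and pw: "(p, w) \<in> S" "linked p" and zp: "(z, p) \<in> RP"
  shows "(z, w) \<in> closure S"
proof -
  have w: "w \<in> Y" using pw(1) O(3) by auto
  have "\<exists>q\<in>S. dist q (z, w) < e" if e: "e > 0" for e
  proof -
    have pU: "(p, w) \<in> U" using pw(1) O(3) by blast
    obtain A D0 where AD: "open A" "open D0" "p \<in> A" "w \<in> D0" "A \<times> D0 \<subseteq> U"
      using open_prod_elim[OF O(2) pU] by (metis mem_Sigma_iff)
    \<comment> \<open>\<open>D0\<close> makes \<open>N\<close> meet \<open>U\<close>, and the ball
      makes the second coordinate approximate \<open>w\<close>.\<close>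
    define D where "D = D0 \<inter> ball w (e / 2)"
    have D: "open D" "D \<inter> Y \<noteq> {}" using AD w e by (auto simp: D_def)
    obtain N B where N: "P.minimal_set N" "open B" "p \<in> B" "\<And>b. b \<in> B \<Longrightarrow> b \<in> X \<Longrightarrow> \<exists>d\<in>D. (b, d) \<in> N"
      using linkedD[OF pw(2) D] by blast
    have pX: "p \<in> X" using zp RP_subset by blast
    obtain d0 where "d0 \<in> D" "(p, d0) \<in> N" using N(4)[OF N(3) pX] by blast
    then have "N \<inter> U \<noteq> {}" using AD by (auto simp: D_def)
    then have NS: "N \<subseteq> S" using P.minimal_set_subset_open[OF N(1) O(1,2)] O(3) by blast
    obtain \<delta> where \<delta>: "\<delta> > 0" "(\<Union>q\<in>N. ball q \<delta>) \<subseteq> U"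
      using compact_subset_open_imp_ball_epsilon_subset[OF P.minimal_setD(5)[OF N(1)] O(2)] NS O(3) by blast
    obtain r where r: "r > 0" "ball p r \<subseteq> B" using N(2,3) open_contains_ball by blast
    obtain a b where ab: "(a, b) \<in> near_orbit \<delta>" "dist z a < min (e / 2) r" "dist p b < min (e / 2) r"
      using RP_D[OF zp, of "min (e / 2) r" \<delta>] e r \<delta> by auto
    then obtain g where g: "g \<in> carrier G" "dist (\<phi> g a) (\<phi> g b) < \<delta>" "a \<in> X" "b \<in> X"
      by (auto simp: near_orbit_def)
    have "b \<in> B" using ab(3) r(2) by auto
    then obtain d where d: "d \<in> D" "(b, d) \<in> N" using N(4) g(4) by blast
    have dY: "d \<in> Y" using d(2) P.minimal_setD(4)[OF N(1)] by auto
    \<comment> \<open>Replacing \<open>\<phi> g b\<close> by the \<open>\<delta>\<close>-close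
      \<open>\<phi> g a\<close> stays in the neighbourhood of \<open>N\<close>, hence in
      \<open>S\<close>; invariance of \<open>S\<close> then brings \<open>(a, d)\<close>
      back.\<close>
    have "(\<phi> g b, \<psi> g d) \<in> N" using P.invariantD[OF P.minimal_setD(3)[OF N(1)] g(1) d(2)] by simp
    moreover have "(\<phi> g a, \<psi> g d) \<in> ball (\<phi> g b, \<psi> g d) \<delta>"
      using g(2) by (simp add: dist_Pair_Pair dist_commute)
    ultimately have "(\<phi> g a, \<psi> g d) \<in> U" using \<delta>(2) by blast
    then have "map_prod (\<phi> g) (\<psi> g) (a, d) \<in> S" using O(3) g stay Y.stay dY by auto
    then have "(a, d) \<in> S" using P.invariant_iff[OF O(1) g(1)] g(3) dY by blast
    moreover have "dist (a, d) (z, w) < e"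
    proof -
      have "dist (a, d) (z, w) \<le> dist a z + dist d w"
        unfolding dist_Pair_Pair by (rule real_sqrt_sum_squares_triangle_ineq[of 0 _ _ 0, simplified] | rule sqrt_sum_squares_le_sum) auto
      moreover have "dist d w < e / 2" using d(1) by (auto simp: D_def dist_commute)
      ultimately show ?thesis using ab(2) by (simp add: dist_commute)
    qed
    ultimately show ?thesis by blast
  qed
  then show ?thesis unfolding closure_approachable by blast
qed

end

section \<open>Generic fibres\<close>

context minimal_action
begin

definition lsc_at :: "'a \<Rightarrow> bool" where
  "lsc_at z \<longleftrightarrow> (\<forall>q\<in>RP `` {z}. \<forall>r>0. \<exists>B. open B \<and> z \<in> B \<and> (\<forall>z'\<in>B \<inter> X. \<exists>q'\<in>RP `` {z'}. dist q q' < r))"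

text \<open>By upper semicontinuity the set \<open>C V\<close> of points whose section meets
  \<open>closure V\<close> is closed. Off the relative boundaries of these countably many sets, a
  section that meets \<open>closure V\<close> continues to do so nearby.\<close>

lemma generic_lsc: "generic X lsc_at"
proof -
  obtain \<B> where \<B>: "countable \<B>" "\<And>V. V \<in> \<B> \<Longrightarrow> open V"
    "\<And>y r. y \<in> X \<Longrightarrow> r > 0 \<Longrightarrow> \<exists>V\<in>\<B>. y \<in> V \<and> V \<subseteq> ball y r"
    using compact_countable_basis[OF compact_carrier] by blast
  define C where "C V = {x \<in> X. RP `` {x} \<inter> closure V \<noteq> {}}" for V
  have "generic X (\<lambda>x. \<forall>V\<in>\<B>. x \<in> C V \<longrightarrow> (\<exists>B. open B \<and> x \<in> B \<and> B \<inter> X \<subseteq> C V))"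
    by (intro generic_ball \<B>(1) generic_closed_imp_interior) (simp add: C_def RP_preimage_closed)
  then show ?thesis
  proof (rule generic_mono)
    fix z assume z: "z \<in> X" "\<forall>V\<in>\<B>. z \<in> C V \<longrightarrow> (\<exists>B. open B \<and> z \<in> B \<and> B \<inter> X \<subseteq> C V)"
    show "lsc_at z"
      unfolding lsc_at_def
    proof (intro ballI allI impI)
      fix q and r :: real assume q: "q \<in> RP `` {z}" "r > 0"
      then have "q \<in> X" using RP_subset by blast
      then obtain V where V: "V \<in> \<B>" "q \<in> V" "V \<subseteq> ball q (r / 2)"
        using \<B>(3)[of q "r / 2"] q(2) by auto
      have "closure V \<subseteq> cball q (r / 2)" using V(3) by (intro closure_minimal) auto
      then have cl: "closure V \<subseteq> ball q r" using q(2) by (auto simp: subset_iff)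
      have "z \<in> C V" using z(1) q(1) V(2) closure_subset[of V] by (auto simp: C_def)
      then obtain B where B: "open B" "z \<in> B" "B \<inter> X \<subseteq> C V" using z(2) V(1) by blast
      have "\<exists>q'\<in>RP `` {z'}. dist q q' < r" if z': "z' \<in> B \<inter> X" for z'
      proof -
        obtain q' where "q' \<in> RP `` {z'}" "q' \<in> closure V" using z' B(3) by (auto simp: C_def)
        then show ?thesis using cl by (intro bexI[of _ q']) auto
      qed
      then show "\<exists>B. open B \<and> z \<in> B \<and> (\<forall>z'\<in>B \<inter> X. \<exists>q'\<in>RP `` {z'}. dist q q' < r)"
        using B by blast
    qed
  qed
qed

text \<open>In \<open>RP\<close> both coordinates may be perturbed; here the first one is frozen at
  \<open>z\<close>.\<close>

definition fiberwise_approximable :: "'a \<Rightarrow> bool" where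
  "fiberwise_approximable z \<longleftrightarrow> (\<forall>q\<in>RP `` {z}. \<forall>r>0. \<forall>e>0. \<exists>c. dist q c < r \<and> (z, c) \<in> near_orbit e)"

text \<open>The set \<open>T V e\<close> of first coordinates is open in \<open>X\<close>, and
  \<open>(z, q) \<in> RP\<close> with \<open>q \<in> V\<close> puts \<open>z\<close> into its
  closure; a generic point of the closure lies in the set itself.\<close>

lemma generic_fiberwise_approximable: "generic X fiberwise_approximable"
proof -
  obtain \<B> where \<B>: "countable \<B>" "\<And>V. V \<in> \<B> \<Longrightarrow> open V"
    "\<And>y r. y \<in> X \<Longrightarrow> r > 0 \<Longrightarrow> \<exists>V\<in>\<B>. y \<in> V \<and> V \<subseteq> ball y r"
    using compact_countable_basis[OF compact_carrier] by blast
  define T where "T V e = {a. \<exists>b\<in>V. (a, b) \<in> near_orbit e}" for V e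
  have "\<exists>U. open U \<and> U \<inter> X = T V e" for V e
  proof -
    define U where "U = \<Union>{B. open B \<and> B \<inter> X \<subseteq> T V e}"
    have "T V e \<subseteq> U"
    proof
      fix a assume "a \<in> T V e"
      then obtain b where b: "b \<in> V" "(a, b) \<in> near_orbit e" by (auto simp: T_def)
      then have bX: "b \<in> X" by (simp add: near_orbit_def)
      obtain r where r: "r > 0" "\<And>a' b'. a' \<in> X \<Longrightarrow> b' \<in> X \<Longrightarrow> dist a a' < r \<Longrightarrow> dist b b' < r \<Longrightarrow> (a', b') \<in> near_orbit e"
        using near_orbit_open[OF b(2)] by blast
      have "ball a r \<inter> X \<subseteq> T V e" using r b(1) bX by (auto simp: T_def intro!: bexI[of _ b])
      then show "a \<in> U" using r(1) unfolding U_def by (intro UnionI[of "ball a r"]) auto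
    qed
    moreover have "T V e \<subseteq> X" by (auto simp: T_def near_orbit_def)
    ultimately have "U \<inter> X = T V e" unfolding U_def by blast
    moreover have "open U" by (auto simp: U_def)
    ultimately show ?thesis by blast
  qed
  then obtain U where U: "\<And>V e. open (U V e)" "\<And>V e. U V e \<inter> X = T V e" by metis
  have "generic X (\<lambda>x. \<forall>(V, k)\<in>\<B> \<times> (UNIV :: nat set). x \<in> closure (U V (1 / real (Suc k)) \<inter> X)
      \<longrightarrow> x \<in> U V (1 / real (Suc k)))"
    by (rule generic_ball) (use \<B>(1) U(1) in \<open>auto intro!: generic_closure_imp\<close>)
  then show ?thesis
  proof (rule generic_mono)
    fix z assume z: "z \<in> X" "\<forall>(V, k)\<in>\<B> \<times> (UNIV :: nat set). z \<in> closure (U V (1 / real (Suc k)) \<inter> X)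
      \<longrightarrow> z \<in> U V (1 / real (Suc k))"
    show "fiberwise_approximable z"
      unfolding fiberwise_approximable_def
    proof (intro ballI allI impI)
      fix q and r e :: real assume q: "q \<in> RP `` {z}" "r > 0" "e > 0"
      then have "q \<in> X" using RP_subset by blast
      then obtain V where V: "V \<in> \<B>" "q \<in> V" "V \<subseteq> ball q r" using \<B>(3)[of q r] q(2) by auto
      obtain s where s: "s > 0" "ball q s \<subseteq> V" using V(2) \<B>(2)[OF V(1)] open_contains_ball by blast
      obtain k where k: "1 / real (Suc k) < e" using nat_approx_posE[OF q(3)] by blast
      have "z \<in> closure (T V (1 / real (Suc k)))"
        unfolding closure_approachable
      proof (intro allI impI)
        fix \<epsilon> :: real assume "\<epsilon> > 0"
        then obtain a b where ab: "(a, b) \<in> near_orbit (1 / real (Suc k))" "dist z a < min \<epsilon> s" "dist q b < min \<epsilon> s"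
          using RP_D[of z q "min \<epsilon> s" "1 / real (Suc k)"] q(1) s(1) by auto
        then have "b \<in> V" using s(2) by auto
        then show "\<exists>y\<in>T V (1 / real (Suc k)). dist y z < \<epsilon>"
          using ab by (intro bexI[of _ a]) (auto simp: T_def dist_commute)
      qed
      then have "z \<in> T V (1 / real (Suc k))" using z V(1) U(2) by fastforce
      then obtain c where "c \<in> V" "(z, c) \<in> near_orbit (1 / real (Suc k))" by (auto simp: T_def)
      then show "\<exists>c. dist q c < r \<and> (z, c) \<in> near_orbit e"
        using V(3) near_orbit_mono[of "1 / real (Suc k)" e] k by (intro exI[of _ c]) auto
    qed
  qed
qed

section \<open>Gathering points of a fibre over a generic base point\<close>

definition gatherable :: "nat \<Rightarrow> (nat \<Rightarrow> 'a) \<Rightarrow> bool" where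
  "gatherable n x \<longleftrightarrow> (\<forall>r>0. \<forall>W. open W \<longrightarrow> W \<inter> X \<noteq> {} \<longrightarrow>
     (\<exists>c. \<exists>g\<in>carrier G. \<forall>i\<in>{1..n}. c i \<in> X \<and> dist (x i) (c i) < r \<and> \<phi> g (c i) \<in> W))"

text \<open>Fixing the base point \<open>z\<close> makes the recurrence of the pairs \<open>(z, c i)\<close> combine: the tolerance for
  the last pair is chosen after the finite set that serves the previous ones.\<close>

lemma gatherable_generic_fiber:
  fixes x :: "nat \<Rightarrow> 'a"
  assumes XX: "action_pair G X \<phi> X \<phi>"
    and z: "z \<in> X" "action_pair.linked G X \<phi> X \<phi> z" "fiberwise_approximable z"
    and x: "\<And>i. i \<in> {1..n} \<Longrightarrow> (z, x i) \<in> RP"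
  shows "gatherable n x"
  unfolding gatherable_def
proof (intro allI impI)
  interpret XX: action_pair G X \<phi> X \<phi> by (rule XX)
  fix r :: real and W :: "'a set" assume r: "r > 0" and W: "open W" "W \<inter> X \<noteq> {}"
  \<comment> \<open>The induction hypothesis is syndeticity: the times at which the first
    \<open>k\<close> points come \<open>e\<close>-close to the translate of \<open>z\<close> can be
    reached from every \<open>g\<close> by some \<open>f \<in> F\<close>.\<close>
  have step: "\<exists>c F. finite F \<and> F \<subseteq> carrier G \<and> (\<forall>i\<in>{1..k}. c i \<in> X \<and> dist (x i) (c i) < r) \<and>
      (\<forall>g\<in>carrier G. \<exists>f\<in>F. \<forall>i\<in>{1..k}. dist (\<phi> (f \<otimes> g) z) (\<phi> (f \<otimes> g) (c i)) < e)"
    if kn: "k \<le> n" and e: "e > 0" for k and e :: real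
    using kn
  proof (induction k)
    case 0
    show ?case by (rule exI, rule exI[of _ "{\<one>}"]) auto
  next
    case (Suc k)
    have "k \<le> n" using Suc.prems by simp
    from Suc.IH[OF this] obtain c F where cF0: "finite F \<and> F \<subseteq> carrier G \<and>
      (\<forall>i\<in>{1..k}. c i \<in> X \<and> dist (x i) (c i) < r) \<and>
      (\<forall>g\<in>carrier G. \<exists>f\<in>F. \<forall>i\<in>{1..k}. dist (\<phi> (f \<otimes> g) z) (\<phi> (f \<otimes> g) (c i)) < e)"
      by (elim exE)
    then have cF: "finite F" "F \<subseteq> carrier G" "\<And>i. i \<in> {1..k} \<Longrightarrow> c i \<in> X \<and> dist (x i) (c i) < r"
      "\<And>g. g \<in> carrier G \<Longrightarrow> \<exists>f\<in>F. \<forall>i\<in>{1..k}. dist (\<phi> (f \<otimes> g) z) (\<phi> (f \<otimes> g) (c i)) < e"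
      by simp_all
    \<comment> \<open>Elements of \<open>F\<close> spread \<open>\<delta>\<close>-close points by
      less than \<open>e\<close>, so closeness of the new pair survives the later correction by
      \<open>F\<close>.\<close>
    obtain \<delta> where \<delta>: "\<delta> > 0" "\<And>f a b. f \<in> F \<Longrightarrow> a \<in> X \<Longrightarrow> b \<in> X \<Longrightarrow> dist a b < \<delta> \<Longrightarrow> dist (\<phi> f a) (\<phi> f b) < e"
      using equicontinuous_finite[OF cF(1,2) e] by blast
    have "x (Suc k) \<in> RP `` {z}" using x[of "Suc k"] Suc.prems by simp
    then obtain c1 where c1: "dist (x (Suc k)) c1 < r" "(z, c1) \<in> near_orbit \<delta>"
      using z(3) r \<delta>(1) unfolding fiberwise_approximable_def by blast
    then obtain s where s: "s > 0" "\<And>a' b'. a' \<in> X \<Longrightarrow> b' \<in> X \<Longrightarrow> dist z a' < s \<Longrightarrow> dist c1 b' < s \<Longrightarrow> (a', b') \<in> near_orbit \<delta>"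
      using near_orbit_open by metis
    \<comment> \<open>\<open>c1\<close> is replaced by a nearby \<open>d\<close> with
      \<open>(z, d)\<close> minimal and still in \<open>near_orbit \<delta>\<close>, so that its
      close return recurs syndetically.\<close>
    define D where "D = ball c1 s \<inter> ball (x (Suc k)) r"
    have "c1 \<in> D \<inter> X" using c1 s(1) by (auto simp: D_def near_orbit_def)
    then have D: "open D" "D \<inter> X \<noteq> {}" by (simp add: D_def open_Int, blast)
    obtain N d where N: "XX.P.minimal_set N" and d: "d \<in> D" "(z, d) \<in> N"
      using XX.linkedD[OF z(2) D] z(1) by metis
    have dX: "d \<in> X" using d(2) XX.P.minimal_setD(4)[OF N] by auto
    have "(z, d) \<in> near_orbit \<delta>" using s z(1) dX d(1) by (auto simp: D_def)
    then obtain h where h: "h \<in> carrier G" "dist (\<phi> h z) (\<phi> h d) < \<delta>" by (auto simp: near_orbit_def)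
    define E where "E = {p :: 'a \<times> 'a. dist (fst p) (snd p) < \<delta>}"
    have "open E" unfolding E_def by (intro open_Collect_less continuous_intros)
    moreover have "(\<phi> h z, \<phi> h d) \<in> N"
      using XX.P.invariantD[OF XX.P.minimal_setD(3)[OF N] h(1) d(2)] by simp
    then have "N \<inter> E \<noteq> {}" using h(2) by (auto simp: E_def)
    ultimately obtain F' where F': "finite F'" "F' \<subseteq> carrier G"
      "\<And>p. p \<in> N \<Longrightarrow> \<exists>f\<in>F'. map_prod (\<phi> f) (\<phi> f) p \<in> E"
      using XX.P.minimal_set_syndetic[OF N] by metis
    define F2 where "F2 = (\<lambda>(f, f'). f \<otimes> f') ` (F \<times> F')"
    have "\<exists>f\<in>F2. \<forall>i\<in>{1..Suc k}. dist (\<phi> (f \<otimes> g) z) (\<phi> (f \<otimes> g) ((c(Suc k := d)) i)) < e"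
      if g: "g \<in> carrier G" for g
    proof -
      have "(\<phi> g z, \<phi> g d) \<in> N"
        using XX.P.invariantD[OF XX.P.minimal_setD(3)[OF N] g d(2)] by simp
      then obtain f' where f': "f' \<in> F'" "dist (\<phi> f' (\<phi> g z)) (\<phi> f' (\<phi> g d)) < \<delta>"
        using F'(3) by (fastforce simp: E_def)
      have c': "f' \<in> carrier G" "f' \<otimes> g \<in> carrier G" using f'(1) F'(2) g by auto
      obtain f where f: "f \<in> F" "\<And>i. i \<in> {1..k} \<Longrightarrow> dist (\<phi> (f \<otimes> (f' \<otimes> g)) z) (\<phi> (f \<otimes> (f' \<otimes> g)) (c i)) < e"
        using cF(4)[OF c'(2)] by blast
      have fc: "f \<in> carrier G" using f(1) cF(2) by blast
      have assoc: "f \<otimes> f' \<otimes> g = f \<otimes> (f' \<otimes> g)" using fc c' g by (simp add: m_assoc)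
      have "dist (\<phi> (f \<otimes> (f' \<otimes> g)) z) (\<phi> (f \<otimes> (f' \<otimes> g)) d) < e"
        using \<delta>(2)[OF f(1), of "\<phi> f' (\<phi> g z)" "\<phi> f' (\<phi> g d)"] f'(2) z(1) dX c' g fc
        by (simp add: act_mult stay)
      then show ?thesis
        using f assoc f'(1) by (intro bexI[of _ "f \<otimes> f'"]) (auto simp: F2_def)
    qed
    moreover have "finite F2" "F2 \<subseteq> carrier G" using cF(1,2) F'(1,2) by (auto simp: F2_def)
    moreover have "\<forall>i\<in>{1..Suc k}. (c(Suc k := d)) i \<in> X \<and> dist (x i) ((c(Suc k := d)) i) < r"
      using cF(3) dX d(1) by (auto simp: D_def le_Suc_eq)
    ultimately show ?case by blast
  qed
  \<comment> \<open>This \<open>\<delta>\<close> lets the whole ball about the translate of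
    \<open>z\<close> be moved into \<open>W\<close> once all points have come into it.\<close>
  obtain \<delta> where \<delta>: "\<delta> > 0" "\<And>x. x \<in> X \<Longrightarrow> \<exists>h\<in>carrier G. \<forall>y\<in>X. dist x y < \<delta> \<longrightarrow> \<phi> h y \<in> W"
    using uniform_visits[OF W] by blast
  obtain c F where c: "F \<subseteq> carrier G" "\<And>i. i \<in> {1..n} \<Longrightarrow> c i \<in> X \<and> dist (x i) (c i) < r"
    "\<And>g. g \<in> carrier G \<Longrightarrow> \<exists>f\<in>F. \<forall>i\<in>{1..n}. dist (\<phi> (f \<otimes> g) z) (\<phi> (f \<otimes> g) (c i)) < \<delta>"
    using step[OF order_refl \<delta>(1)] by blast
  obtain f where f: "f \<in> F" "\<And>i. i \<in> {1..n} \<Longrightarrow> dist (\<phi> (f \<otimes> \<one>) z) (\<phi> (f \<otimes> \<one>) (c i)) < \<delta>"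
    using c(3)[OF one_closed] by blast
  have fc: "f \<in> carrier G" using f c(1) by blast
  obtain h where h: "h \<in> carrier G" "\<And>y. y \<in> X \<Longrightarrow> dist (\<phi> f z) y < \<delta> \<Longrightarrow> \<phi> h y \<in> W"
    using \<delta>(2)[of "\<phi> f z"] stay fc z(1) by blast
  have "\<phi> (h \<otimes> f) (c i) \<in> W" if "i \<in> {1..n}" for i
    using h(2)[of "\<phi> f (c i)"] f(2)[OF that] c(2)[OF that] fc h(1) by (simp add: act_mult stay)
  then show "\<exists>c. \<exists>g\<in>carrier G. \<forall>i\<in>{1..n}. c i \<in> X \<and> dist (x i) (c i) < r \<and> \<phi> g (c i) \<in> W"
    using c(2) h(1) fc by (intro exI[of _ c] bexI[of _ "h \<otimes> f"]) auto
qed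

end

section \<open>Finite generic fibres\<close>

text \<open>The factor \<open>3\<close> lets two points move by less than \<open>\<eta>\<close> each
  and still stay more than \<open>\<eta>\<close> apart.\<close>

lemma finite_separated:
  fixes S :: "'b::metric_space set"
  assumes "finite S"
  obtains \<eta> where "\<eta> > 0" "\<And>p q. p \<in> S \<Longrightarrow> q \<in> S \<Longrightarrow> p \<noteq> q \<Longrightarrow> 3 * \<eta> \<le> dist p q"
proof -
  \<comment> \<open>The value \<open>1\<close> keeps the minimum defined for sets with at most one
    point.\<close>
  define T where "T = insert 1 ((\<lambda>(p, q). dist p q / 3) ` {(p, q) \<in> S \<times> S. p \<noteq> q})"
  have "{(p, q) \<in> S \<times> S. p \<noteq> q} \<subseteq> S \<times> S" by auto
  then have fin: "finite T" unfolding T_def using assms by (meson finite.insertI finite_SigmaI finite_imageI finite_subset)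
  show thesis
  proof (rule that[of "Min T"])
    show "Min T > 0" using fin by (subst Min_gr_iff) (auto simp: T_def)
    fix p q assume "p \<in> S" "q \<in> S" "p \<noteq> q"
    then have "dist p q / 3 \<in> T" by (force simp: T_def)
    then show "3 * Min T \<le> dist p q" using Min_le[OF fin] by fastforce
  qed
qed

context minimal_action
begin

lemma near_orbit_all_imp_RP:
  assumes "x \<in> X" "y \<in> X" "\<And>e. e > 0 \<Longrightarrow> \<exists>g\<in>carrier G. dist (\<phi> g x) (\<phi> g y) < e"
  shows "(x, y) \<in> RP"
  unfolding RP_iff
proof (intro conjI allI impI)
  fix e :: real assume e: "e > 0"
  then show "\<exists>a b. (a, b) \<in> near_orbit e \<and> dist x a < e \<and> dist y b < e"
    using assms by (intro exI[of _ x] exI[of _ y]) (simp add: near_orbit_def)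
qed (use assms in auto)

lemma lsc_finite_nbhd:
  assumes "lsc_at z" "finite (RP `` {z})" "r > 0"
  obtains B where "open B" "z \<in> B"
    "\<And>z' q. z' \<in> B \<Longrightarrow> z' \<in> X \<Longrightarrow> q \<in> RP `` {z} \<Longrightarrow> \<exists>q'\<in>RP `` {z'}. dist q q' < r"
proof -
  have "\<forall>q\<in>RP `` {z}. \<exists>B. open B \<and> z \<in> B \<and> (\<forall>z'\<in>B \<inter> X. \<exists>q'\<in>RP `` {z'}. dist q q' < r)"
    using assms(1,3) unfolding lsc_at_def by simp
  from bchoice[OF this] obtain B where B0:
    "\<forall>q\<in>RP `` {z}. open (B q) \<and> z \<in> B q \<and> (\<forall>z'\<in>B q \<inter> X. \<exists>q'\<in>RP `` {z'}. dist q q' < r)"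
    by (elim exE)
  then have B: "\<And>q. q \<in> RP `` {z} \<Longrightarrow> open (B q)" "\<And>q. q \<in> RP `` {z} \<Longrightarrow> z \<in> B q"
    "\<And>q z'. q \<in> RP `` {z} \<Longrightarrow> z' \<in> B q \<inter> X \<Longrightarrow> \<exists>q'\<in>RP `` {z'}. dist q q' < r"
    by simp_all
  show thesis
  proof (rule that)
    show "open (\<Inter>q\<in>RP `` {z}. B q)" using assms(2) B(1) by (rule open_INT[rule_format])
    show "z \<in> (\<Inter>q\<in>RP `` {z}. B q)" using B(2) by (rule INT_I)
    fix z' q assume "z' \<in> (\<Inter>q\<in>RP `` {z}. B q)" "z' \<in> X" and q: "q \<in> RP `` {z}"
    then have "z' \<in> B q \<inter> X" by (auto simp del: Image_singleton_iff)
    then show "\<exists>q'\<in>RP `` {z'}. dist q q' < r" by (rule B(3)[OF q])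
  qed
qed

text \<open>Two points with the same choice would be less than \<open>2 * \<eta>\<close> apart, so
  the choice is injective; the bound on the cardinality makes it onto. Thus no point of the nearby
  section is unaccounted for.\<close>

lemma RP_sections_match:
  assumes sep: "\<And>p q. p \<in> RP `` {z} \<Longrightarrow> q \<in> RP `` {z} \<Longrightarrow> p \<noteq> q \<Longrightarrow> 3 * \<eta> \<le> dist p q" and pos: "\<eta> > 0"
    and near: "\<And>q. q \<in> RP `` {z} \<Longrightarrow> \<exists>q'\<in>RP `` {z'}. dist q q' < \<eta>"
    and fin: "finite (RP `` {z'})" "card (RP `` {z'}) \<le> card (RP `` {z})"
  obtains s where "bij_betw s (RP `` {z}) (RP `` {z'})" "\<And>q. q \<in> RP `` {z} \<Longrightarrow> dist q (s q) < \<eta>"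
proof -
  obtain s where s: "\<And>q. q \<in> RP `` {z} \<Longrightarrow> s q \<in> RP `` {z'}" "\<And>q. q \<in> RP `` {z} \<Longrightarrow> dist q (s q) < \<eta>"
    using near by metis
  have inj: "inj_on s (RP `` {z})"
  proof (rule inj_onI, rule ccontr)
    fix p q assume pq: "p \<in> RP `` {z}" "q \<in> RP `` {z}" "s p = s q" "p \<noteq> q"
    then have "dist p q < 3 * \<eta>" using s(2)[OF pq(1)] s(2)[OF pq(2)] dist_triangle2[of p q "s q"] pos by simp
    then show False using sep[OF pq(1,2,4)] by simp
  qed
  have sub: "s ` RP `` {z} \<subseteq> RP `` {z'}" using s(1) by (rule image_subsetI)
  have "s ` RP `` {z} = RP `` {z'}"
    using card_seteq[OF fin(1) sub] card_image[OF inj] fin(2) by simp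
  then show thesis using that[of s] inj s(2) by (simp add: bij_betw_def)
qed

text \<open>Translating so that \<open>z\<close> returns near itself, the finite set \<open>RP `` {z}\<close> returns near itself without
  collapsing.\<close>

lemma finite_section_distal:
  assumes z: "z \<in> X" "lsc_at z" "finite (RP `` {z})"
    and q: "q \<in> RP `` {z}" "q' \<in> RP `` {z}"
    and prox: "\<And>e. e > 0 \<Longrightarrow> \<exists>g\<in>carrier G. dist (\<phi> g q) (\<phi> g q') < e"
  shows "q = q'"
proof (rule ccontr)
  assume neq: "q \<noteq> q'"
  obtain \<eta> where \<eta>: "\<eta> > 0" "\<And>p q. p \<in> RP `` {z} \<Longrightarrow> q \<in> RP `` {z} \<Longrightarrow> p \<noteq> q \<Longrightarrow> 3 * \<eta> \<le> dist p q"
    using finite_separated[OF z(3)] by blast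
  obtain B where B: "open B" "z \<in> B"
    "\<And>z' q. z' \<in> B \<Longrightarrow> z' \<in> X \<Longrightarrow> q \<in> RP `` {z} \<Longrightarrow> \<exists>q'\<in>RP `` {z'}. dist q q' < \<eta>"
    using lsc_finite_nbhd[OF z(2,3) \<eta>(1)] by blast
  have "B \<inter> X \<noteq> {}" using B(2) z(1) by blast
  then obtain F where F: "finite F" "F \<subseteq> carrier G" "\<And>x. x \<in> X \<Longrightarrow> \<exists>f\<in>F. \<phi> f x \<in> B"
    using syndetic_visits[OF B(1)] by metis
  \<comment> \<open>Bringing \<open>\<phi> g z\<close> back into \<open>B\<close> costs an element
    of \<open>F\<close>; closeness within \<open>d\<close> leaves the pair
    \<open>\<eta>\<close>-close after that.\<close>
  obtain d where d: "d > 0"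
    "\<And>f a b. f \<in> F \<Longrightarrow> a \<in> X \<Longrightarrow> b \<in> X \<Longrightarrow> dist a b < d \<Longrightarrow> dist (\<phi> f a) (\<phi> f b) < \<eta>"
    using equicontinuous_finite[OF F(1,2) \<eta>(1)] by blast
  obtain g where g: "g \<in> carrier G" "dist (\<phi> g q) (\<phi> g q') < d" using prox[OF d(1)] by blast
  obtain f where f: "f \<in> F" "\<phi> f (\<phi> g z) \<in> B" using F(3)[of "\<phi> g z"] g(1) z(1) stay by blast
  have fc: "f \<in> carrier G" using f F by blast
  define h where "h = f \<otimes> g"
  have h: "h \<in> carrier G" using fc g by (simp add: h_def)
  have qX: "q \<in> X" "q' \<in> X" using q RP_subset by blast+
  have act: "\<phi> h x = \<phi> f (\<phi> g x)" if "x \<in> X" for x using fc g(1) that by (simp add: h_def act_mult)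
  have close: "dist (\<phi> h q) (\<phi> h q') < \<eta>"
    unfolding act[OF qX(1)] act[OF qX(2)] by (rule d(2)[OF f(1) _ _ g(2)]) (use qX g stay in auto)
  have hz: "\<phi> h z \<in> B" "\<phi> h z \<in> X" using f(2) act[OF z(1)] stay[OF h z(1)] by auto
  have img: "RP `` {\<phi> h z} = \<phi> h ` (RP `` {z})" by (rule RP_image[OF h z(1)])
  have fin: "finite (RP `` {\<phi> h z})" using img z(3) by simp
  have "card (RP `` {\<phi> h z}) \<le> card (RP `` {z})" unfolding img using z(3) by (rule card_image_le)
  from RP_sections_match[OF \<eta>(2,1) B(3)[OF hz] fin this]
  obtain s where s: "bij_betw s (RP `` {z}) (RP `` {\<phi> h z})" "\<And>q. q \<in> RP `` {z} \<Longrightarrow> dist q (s q) < \<eta>"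
    by metis
  have "\<phi> h q \<in> s ` RP `` {z}" "\<phi> h q' \<in> s ` RP `` {z}"
    using q img s(1) by (auto simp: bij_betw_def)
  then obtain p p' where p: "p \<in> RP `` {z}" "p' \<in> RP `` {z}" "\<phi> h q = s p" "\<phi> h q' = s p'" by blast
  have "\<phi> h q \<noteq> \<phi> h q'" using neq inj_onD[OF act_inj[OF h]] qX by blast
  then have "p \<noteq> p'" using p by auto
  then have "3 * \<eta> \<le> dist p p'" using \<eta>(2) p by blast
  \<comment> \<open>The two images are less than \<open>\<eta>\<close> apart and each is within
    \<open>\<eta>\<close> of its partner in the section of \<open>z\<close>, so the partners are too
    close for the separation.\<close>
  moreover have "dist p p' \<le> dist p (s p) + dist (s p) (s p') + dist p' (s p')"
    using dist_triangle[of p p' "s p"] dist_triangle[of "s p" p' "s p'"] by (simp add: dist_commute)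
  ultimately show False using s(2)[OF p(1)] s(2)[OF p(2)] close p(3,4) by simp
qed

text \<open>Tuples are encoded as sequences, of which only the entries \<open>1, \<dots>, n\<close> matter; this keeps \<open>n\<close> out of
  the types.\<close>

definition seqs :: "(nat \<Rightarrow> 'a) set" where
  "seqs = {y. \<forall>i. y i \<in> X}"

lemma seq_action: "compact_t2_action G seqs (\<lambda>g y. \<phi> g \<circ> y)"
proof unfold_locales
  have "seqs = PiE UNIV (\<lambda>_. X)" by (auto simp: seqs_def)
  then show "compact seqs" using compact_PiE_UNIV[of "\<lambda>_ :: nat. X"] compact_carrier by simp
  then show "closed seqs" by (rule compact_imp_closed)
  fix g assume g: "g \<in> carrier G"
  show "continuous_on seqs (\<lambda>y. \<phi> g \<circ> y)"
  proof (rule continuous_on_coordinatewise_then_product)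
    fix i
    have "continuous_on seqs (\<lambda>y. y i)"
      by (rule continuous_on_subset[OF continuous_on_product_coordinates]) simp
    then show "continuous_on seqs (\<lambda>y. (\<phi> g \<circ> y) i)"
      unfolding o_def by (rule continuous_on_compose2[OF cont[OF g]]) (auto simp: seqs_def)
  qed
qed (auto simp: seqs_def stay fun_eq_iff act_one act_mult)

lemma self_pair: "action_pair G X \<phi> X \<phi>" ..

lemma seq_pair: "action_pair G X \<phi> seqs (\<lambda>g y. \<phi> g \<circ> y)"
  unfolding action_pair_def using minimal_action_axioms seq_action by simp

text \<open>Auslander--Ellis yields a minimal pair in the orbit closure of \<open>(z, q)\<close> and
  proximal to it. As \<open>RP\<close> is closed and invariant, it contains this pair and its
  minimal set. Distality of the section of \<open>z\<close> then identifies the two pairs.\<close>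

lemma finite_section_pair_minimal:
  assumes z: "z \<in> X" "lsc_at z" "finite (RP `` {z})" and q: "q \<in> RP `` {z}"
  obtains N where "compact_action.minimal_set G (X \<times> X) (\<lambda>g. map_prod (\<phi> g) (\<phi> g)) N" "(z, q) \<in> N" "N \<subseteq> RP"
proof -
  interpret XX: action_pair G X \<phi> X \<phi> by (rule self_pair)
  have zq: "(z, q) \<in> X \<times> X" "(z, q) \<in> RP" using z q RP_subset by blast+
  have inv: "XX.P.invariant RP"
    unfolding XX.P.invariant_def using RP_act RP_subset by auto
  obtain N p s where N: "XX.P.minimal_set N" "p \<in> N" "p \<in> closure (XX.P.orbit_set (z, q))"
    "(s, s) \<in> closure ((\<lambda>g. (map_prod (\<phi> g) (\<phi> g) (z, q), map_prod (\<phi> g) (\<phi> g) p)) ` carrier G)"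
    by (rule XX.P.proximal_minimal_point[OF zq(1)], rule that, assumption+)
  have "closure (XX.P.orbit_set (z, q)) \<subseteq> RP"
    by (intro closure_minimal RP_closed XX.P.orbit_subset inv zq(2))
  then have pRP: "p \<in> RP" using N(3) by blast
  have NRP: "N \<subseteq> RP"
    using XX.P.minimal_set_dense_orbit[OF N(1,2)] closure_minimal[OF XX.P.orbit_subset[OF inv pRP] RP_closed] by simp
  have prox: "\<exists>g\<in>carrier G. dist (map_prod (\<phi> g) (\<phi> g) (z, q)) (map_prod (\<phi> g) (\<phi> g) p) < e" if e: "e > 0" for e
  proof -
    have "open {t :: ('a \<times> 'a) \<times> ('a \<times> 'a). dist (fst t) (snd t) < e}"
      by (intro open_Collect_less continuous_intros)
    moreover have "(s, s) \<in> {t. dist (fst t) (snd t) < e}" using e by simp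
    ultimately have "(\<lambda>g. (map_prod (\<phi> g) (\<phi> g) (z, q), map_prod (\<phi> g) (\<phi> g) p)) ` carrier G \<inter> {t. dist (fst t) (snd t) < e} \<noteq> {}"
      using N(4) by (metis (no_types, lifting) closure_iff_nhds_not_empty order_refl)
    then show ?thesis by auto
  qed
  obtain z1 q1 where p: "p = (z1, q1)" by (cases p)
  have X1: "z1 \<in> X" "q1 \<in> X" using pRP p RP_subset by blast+
  have pr1: "\<exists>g\<in>carrier G. dist (\<phi> g z) (\<phi> g z1) < e" if "e > 0" for e
    using prox[OF that] p dist_fst_le by (smt (verit) fst_map_prod fst_conv)
  have pr2: "\<exists>g\<in>carrier G. dist (\<phi> g q) (\<phi> g q1) < e" if "e > 0" for e
    using prox[OF that] p dist_snd_le by (smt (verit) snd_map_prod snd_conv)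
  \<comment> \<open>The first coordinate has to be settled before the second: only with
    \<open>z1 = z\<close> does \<open>(z1, q1) \<in> RP\<close> place \<open>q1\<close> in the
    section of \<open>z\<close>.\<close>
  have "z = z1"
  proof (rule finite_section_distal[OF z])
    show "z \<in> RP `` {z}" using RP_refl z(1) by simp
    show "z1 \<in> RP `` {z}" using near_orbit_all_imp_RP[OF z(1) X1(1) pr1] by simp
  qed (rule pr1)
  moreover have "q = q1"
  proof (rule finite_section_distal[OF z q])
    show "q1 \<in> RP `` {z}" using pRP p \<open>z = z1\<close> by simp
  qed (rule pr2)
  ultimately show thesis using that[OF N(1)] N(2) p NRP by blast
qed

lemma open_box:
  fixes D :: "(nat \<Rightarrow> 'b::topological_space) set"
  assumes "open D" "y \<in> D"
  obtains U where "\<And>i. open (U i)" "\<And>i. y i \<in> U i" "\<And>v. (\<And>i. v i \<in> U i) \<Longrightarrow> v \<in> D"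
proof -
  have "openin (product_topology (\<lambda>i :: nat. euclidean :: 'b topology) UNIV) D" using assms(1) by (simp add: open_fun_def)
  from product_topology_open_contains_basis[OF this assms(2)]
  obtain U where U: "y \<in> PiE UNIV U \<and> (\<forall>i. openin euclidean (U i)) \<and> finite {i. U i \<noteq> topspace euclidean} \<and> PiE UNIV U \<subseteq> D"
    by blast
  show thesis
  proof (rule that)
    show "open (U i)" for i using U by simp
    show "y i \<in> U i" for i using U by (auto simp: PiE_iff)
    show "v \<in> D" if "\<And>i. v i \<in> U i" for v using U that by (auto simp: PiE_iff subset_iff)
  qed
qed

text \<open>The base point and all entries are perturbed to points with finite, lower semicontinuous
  sections. A minimal point proximal to the resulting tuple is proximal to it in every coordinate,
  and each coordinate is distal within its own section, so the tuple is itself minimal.\<close>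

lemma seq_pair_minimal_dense:
  assumes gen: "generic X (\<lambda>z. lsc_at z \<and> finite (RP `` {z}))"
    and A: "open A" "A \<inter> X \<noteq> {}" and D: "open D" "D \<inter> seqs \<noteq> {}"
  shows "\<exists>N. compact_action.minimal_set G (X \<times> seqs) (\<lambda>g. map_prod (\<phi> g) (\<lambda>y. \<phi> g \<circ> y)) N \<and> N \<inter> A \<times> D \<noteq> {}"
proof -
  interpret S: action_pair G X \<phi> seqs "\<lambda>g y. \<phi> g \<circ> y" by (rule seq_pair)
  obtain a where a: "a \<in> A" "a \<in> X" "lsc_at a" "finite (RP `` {a})"
    using generic_dense[OF compact_carrier gen A] by blast
  obtain y0 where y0: "y0 \<in> D" "y0 \<in> seqs" using D(2) by blast
  obtain U where U: "\<And>i. open (U i)" "\<And>i. y0 i \<in> U i" "\<And>v. (\<And>i. v i \<in> U i) \<Longrightarrow> v \<in> D"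
    using open_box[OF D(1) y0(1)] by blast
  have "\<exists>t. t \<in> U i \<and> t \<in> X \<and> lsc_at t \<and> finite (RP `` {t})" for i
  proof -
    have "U i \<inter> X \<noteq> {}" using U(2)[of i] y0(2) by (auto simp: seqs_def)
    then show ?thesis using generic_dense[OF compact_carrier gen U(1)] by metis
  qed
  then obtain y where y: "\<And>i. y i \<in> U i" "\<And>i. y i \<in> X" "\<And>i. lsc_at (y i)" "\<And>i. finite (RP `` {y i})" by metis
  have ay: "(a, y) \<in> X \<times> seqs" using a(2) y(2) by (simp add: seqs_def)
  obtain N p s where N: "S.P.minimal_set N" "p \<in> N"
    "(s, s) \<in> closure ((\<lambda>g. (map_prod (\<phi> g) (\<lambda>y. \<phi> g \<circ> y) (a, y), map_prod (\<phi> g) (\<lambda>y. \<phi> g \<circ> y) p)) ` carrier G)"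
    by (rule S.P.proximal_minimal_point[OF ay], rule that, assumption+)
  obtain a1 y1 where p: "p = (a1, y1)" by (cases p)
  have X1: "a1 \<in> X" "\<And>i. y1 i \<in> X" using S.P.minimal_setD(4)[OF N(1)] N(2) p by (auto simp: seqs_def)
  have prox: "\<exists>g\<in>carrier G. dist (k (map_prod (\<phi> g) (\<lambda>y. \<phi> g \<circ> y) (a, y))) (k (map_prod (\<phi> g) (\<lambda>y. \<phi> g \<circ> y) p)) < e"
    if e: "e > 0" and k: "continuous_on UNIV k" for e and k :: "'a \<times> (nat \<Rightarrow> 'a) \<Rightarrow> 'a"
  proof -
    have "open {t. dist (k (fst t)) (k (snd t)) < e}"
      by (intro open_Collect_less continuous_intros continuous_on_compose2[OF k]) auto
    moreover have "(s, s) \<in> {t. dist (k (fst t)) (k (snd t)) < e}" using e by simp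
    ultimately have "(\<lambda>g. (map_prod (\<phi> g) (\<lambda>y. \<phi> g \<circ> y) (a, y), map_prod (\<phi> g) (\<lambda>y. \<phi> g \<circ> y) p)) ` carrier G \<inter> {t. dist (k (fst t)) (k (snd t)) < e} \<noteq> {}"
      using N(3) by (metis (no_types, lifting) closure_iff_nhds_not_empty order_refl)
    then show ?thesis by auto
  qed
  have pr1: "\<exists>g\<in>carrier G. dist (\<phi> g a) (\<phi> g a1) < e" if "e > 0" for e
    using prox[OF that, of fst] p by (simp add: continuous_on_fst)
  have coord: "continuous_on UNIV (\<lambda>t :: 'a \<times> (nat \<Rightarrow> 'a). snd t i)" for i
    by (rule continuous_on_product_then_coordinatewise) (intro continuous_intros)
  have pr2: "\<exists>g\<in>carrier G. dist (\<phi> g (y i)) (\<phi> g (y1 i)) < e" if "e > 0" for e i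
    using prox[OF that coord[of i]] p by simp
  \<comment> \<open>Proximality puts \<open>c\<close> into the section of \<open>b\<close>, where
    distinct points are never proximal.\<close>
  have distal: "b = c" if "b \<in> X" "c \<in> X" "lsc_at b" "finite (RP `` {b})"
    "\<And>e. e > 0 \<Longrightarrow> \<exists>g\<in>carrier G. dist (\<phi> g b) (\<phi> g c) < e" for b c
    by (rule finite_section_distal[OF that(1,3,4) _ _ that(5)])
      (use RP_refl[OF that(1)] near_orbit_all_imp_RP[OF that(1,2,5)] in auto)
  have "a = a1" by (rule distal[OF a(2) X1(1) a(3,4) pr1])
  moreover have "y = y1"
  proof
    show "y i = y1 i" for i by (rule distal[OF y(2) X1(2) y(3,4) pr2])
  qed
  ultimately have "(a, y) \<in> N" using N(2) p by simp
  moreover have "y \<in> D" using U(3) y(1) by blast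
  ultimately show ?thesis using N(1) a(1) by blast
qed

section \<open>Passing generic properties to all points of a section\<close>

definition thin :: "nat \<Rightarrow> 'a \<Rightarrow> bool" where
  "thin n z \<longleftrightarrow> lsc_at z \<and> finite (RP `` {z}) \<and> card (RP `` {z}) \<le> n"

text \<open>Suppose that every section over an open set leaves \<open>U\<close>. Near a thin
  \<open>z\<close> of maximal section size the thin sections split into single-valued branches, and
  one branch stays outside \<open>U\<close> over the thin points of an open set. A minimal subset of
  \<open>RP\<close> through this branch spreads the fact by syndeticity: finitely many preimages of
  \<open>- U\<close> cover \<open>X\<close>, so \<open>- U\<close> has relative interior, against
  density of \<open>U\<close>.\<close>

lemma generic_section_avoids:
  assumes gen: "generic X (thin n)" and U: "dense_open_in X U"
  shows "dense_open_in X (- {x \<in> X. RP `` {x} \<inter> - U \<noteq> {}})"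
  unfolding dense_open_in_def
proof (intro conjI allI impI)
  interpret XX: action_pair G X \<phi> X \<phi> by (rule self_pair)
  have opU: "open U" using U by (simp add: dense_open_in_def)
  then have clU: "closed (- U)" by (simp add: closed_Compl)
  then show "open (- {x \<in> X. RP `` {x} \<inter> - U \<noteq> {}})" using RP_preimage_closed by (simp add: open_Compl)
  fix A assume A: "open A" "A \<inter> X \<noteq> {}"
  show "A \<inter> - {x \<in> X. RP `` {x} \<inter> - U \<noteq> {}} \<inter> X \<noteq> {}"
  proof (rule ccontr)
    assume "\<not> ?thesis"
    then have bad: "RP `` {x} \<inter> - U \<noteq> {}" if "x \<in> A" "x \<in> X" for x using that by blast
    \<comment> \<open>The cardinality bound in \<open>thin\<close> allows a maximum, and maximality
      at \<open>z\<close> supplies the bound on nearby sections that the matching requires.\<close>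
    define Z where "Z x \<longleftrightarrow> x \<in> A \<and> x \<in> X \<and> thin n x" for x
    obtain z1 where "Z z1" using generic_dense[OF compact_carrier gen A] unfolding Z_def by metis
    moreover have "\<forall>x. Z x \<longrightarrow> card (RP `` {x}) < Suc n" by (simp add: Z_def thin_def)
    ultimately obtain z where z: "Z z" "\<And>x. Z x \<Longrightarrow> card (RP `` {x}) \<le> card (RP `` {z})"
      using ex_has_greatest_nat[of Z z1 "\<lambda>x. card (RP `` {x})" "Suc n"] by metis
    have z': "z \<in> A" "z \<in> X" "lsc_at z" "finite (RP `` {z})" using z(1) by (simp_all add: Z_def thin_def)
    obtain \<eta> where \<eta>: "\<eta> > 0" "\<And>p q. p \<in> RP `` {z} \<Longrightarrow> q \<in> RP `` {z} \<Longrightarrow> p \<noteq> q \<Longrightarrow> 3 * \<eta> \<le> dist p q"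
      using finite_separated[OF z'(4)] by metis
    obtain B0 where B0: "open B0" "z \<in> B0"
      "\<And>z' q. z' \<in> B0 \<Longrightarrow> z' \<in> X \<Longrightarrow> q \<in> RP `` {z} \<Longrightarrow> \<exists>q'\<in>RP `` {z'}. dist q q' < \<eta>"
      using lsc_finite_nbhd[OF z'(3,4) \<eta>(1)] by metis
    define B where "B = A \<inter> B0"
    have B: "open B" "z \<in> B" using A(1) B0(1,2) z'(1) by (auto simp: B_def)
    have match: "\<exists>s. bij_betw s (RP `` {z}) (RP `` {b}) \<and> (\<forall>q\<in>RP `` {z}. dist q (s q) < \<eta>)"
      if b: "b \<in> B" "Z b" for b
    proof -
      have "b \<in> B0" "b \<in> X" "finite (RP `` {b})" using b by (auto simp: B_def Z_def thin_def)
      from RP_sections_match[OF \<eta>(2,1) B0(3)[OF this(1,2)] this(3) z(2)[OF b(2)]]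
      show ?thesis by metis
    qed
    \<comment> \<open>The points with a section point outside \<open>U\<close> near
      \<open>l\<close>. These sets cover the thin points of \<open>B\<close>, hence by closedness
      all of \<open>B \<inter> X\<close>, and so one of them has relative interior.\<close>
    define C where "C l = {x \<in> X. RP `` {x} \<inter> (- U \<inter> cball l \<eta>) \<noteq> {}}" for l
    have clC: "closed (C l)" for l unfolding C_def by (intro RP_preimage_closed closed_Int clU closed_cball)
    have coverZ: "\<exists>l\<in>RP `` {z}. b \<in> C l" if b: "b \<in> B" "Z b" for b
    proof -
      obtain s where s: "bij_betw s (RP `` {z}) (RP `` {b})" "\<forall>q\<in>RP `` {z}. dist q (s q) < \<eta>"
        using match[OF b] by blast
      have bX: "b \<in> A" "b \<in> X" using b(2) by (auto simp: Z_def)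
      obtain d where d: "d \<in> RP `` {b}" "d \<in> - U" using bad[OF bX] by blast
      then obtain l where l: "l \<in> RP `` {z}" "d = s l" using s(1) unfolding bij_betw_def by blast
      then have "d \<in> cball l \<eta>" using s(2)[rule_format, OF l(1)] by simp
      then show ?thesis using d l(1) bX(2) unfolding C_def by blast
    qed
    have cover: "B \<inter> X \<subseteq> \<Union>(C ` RP `` {z})"
    proof (rule ccontr)
      assume "\<not> ?thesis"
      then have ne: "(B - \<Union>(C ` RP `` {z})) \<inter> X \<noteq> {}" by blast
      have op: "open (B - \<Union>(C ` RP `` {z}))"
        using B(1) clC z'(4) by (intro open_Diff closed_Union) auto
      obtain b where b: "b \<in> B - \<Union>(C ` RP `` {z})" "b \<in> X" "thin n b"
        using generic_dense[OF compact_carrier gen op ne] by metis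
      then have "Z b" by (auto simp: Z_def B_def)
      then show False using coverZ[of b] b(1) by blast
    qed
    have BX: "B \<inter> X \<noteq> {}" using B(2) z'(2) by blast
    have "\<exists>E\<in>C ` RP `` {z}. \<exists>B'. open B' \<and> B' \<subseteq> B \<and> B' \<inter> X \<noteq> {} \<and> B' \<inter> X \<subseteq> E"
      by (rule finite_closed_cover_interior[OF _ _ B(1) BX cover]) (use z'(4) clC in auto)
    then obtain l B' where l: "l \<in> RP `` {z}" and B': "open B'" "B' \<subseteq> B" "B' \<inter> X \<noteq> {}" "B' \<inter> X \<subseteq> C l"
      by blast
    \<comment> \<open>Large enough to contain \<open>cball l \<eta>\<close>, and small enough for a
      single section point: \<open>2 * \<eta>\<close> plus the matching error \<open>\<eta>\<close>
      does not exceed the separation.\<close>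
    define D where "D = ball l (2 * \<eta>)"
    have outside: "d \<notin> U" if b: "b \<in> B'" "b \<in> X" "thin n b" and d: "d \<in> RP `` {b}" "d \<in> D" for b d
    proof -
      have bB: "b \<in> B" "Z b" using b B'(2) by (auto simp: Z_def B_def)
      obtain s where s: "bij_betw s (RP `` {z}) (RP `` {b})" "\<forall>q\<in>RP `` {z}. dist q (s q) < \<eta>"
        using match[OF bB] by blast
      have only: "e = s l" if e: "e \<in> RP `` {b}" "dist l e < 2 * \<eta>" for e
      proof -
        obtain k where k: "k \<in> RP `` {z}" "e = s k" using s(1) e(1) unfolding bij_betw_def by blast
        have "dist k e < \<eta>" using s(2) k by blast
        then have "dist l k < 3 * \<eta>" using e(2) dist_triangle2[of l k e] by simp
        then have "l = k" using \<eta>(2)[OF l k(1)] by fastforce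
        then show ?thesis using k(2) by simp
      qed
      have "b \<in> C l" using B'(4) b by blast
      then obtain e where e: "e \<in> RP `` {b}" "e \<in> - U" "e \<in> cball l \<eta>" unfolding C_def by blast
      have "dist l e \<le> \<eta>" using e(3) by simp
      then have "dist l e < 2 * \<eta>" using \<eta>(1) by linarith
      then have "e = s l" by (rule only[OF e(1)])
      moreover have "d = s l" using only[OF d(1)] d(2) by (simp add: D_def)
      ultimately show ?thesis using e(2) by simp
    qed
    obtain b where b: "b \<in> B'" "b \<in> X" "thin n b"
      using generic_dense[OF compact_carrier gen B'(1,3)] by metis
    have "b \<in> C l" using B'(4) b by blast
    then obtain q where q: "q \<in> RP `` {b}" "q \<in> cball l \<eta>" unfolding C_def by blast
    have "lsc_at b" "finite (RP `` {b})" using b(3) by (auto simp: thin_def)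
    then obtain N where N: "XX.P.minimal_set N" "(b, q) \<in> N" "N \<subseteq> RP"
      using finite_section_pair_minimal[OF b(2) _ _ q(1)] by metis
    have opD: "open D" and opB'D: "open (B' \<times> D)" using B'(1) by (auto simp: D_def intro: open_Times)
    \<comment> \<open>\<open>outside\<close> speaks of thin base points only. A point of
      \<open>N\<close> in \<open>B' \<times> (D \<inter> U)\<close> would by semi-openness have
      companions in this set over a relatively open set, hence over a thin point.\<close>
    have sub: "d \<notin> U" if bd: "(b', d) \<in> N" "b' \<in> B'" "d \<in> D" for b' d
    proof
      assume dU: "d \<in> U"
      have "open (D \<inter> U)" "d \<in> D \<inter> U" using opD opU bd dU by auto
      from XX.minimal_set_semi_open[OF N(1) bd(1) B'(1) bd(2) this]
      obtain B2 where B2: "open B2" "B2 \<inter> X \<noteq> {}" "B2 \<inter> X \<subseteq> B'"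
        "\<forall>b. b \<in> B2 \<longrightarrow> b \<in> X \<longrightarrow> (\<exists>d\<in>D \<inter> U. (b, d) \<in> N)" by metis
      obtain b2 where b2: "b2 \<in> B2" "b2 \<in> X" "thin n b2"
        using generic_dense[OF compact_carrier gen B2(1,2)] by metis
      then obtain d2 where d2: "d2 \<in> D \<inter> U" "(b2, d2) \<in> N" using B2(4) by blast
      have "d2 \<in> RP `` {b2}" using d2(2) N(3) by blast
      moreover have "b2 \<in> B'" using b2 B2(3) by blast
      ultimately show False using outside[OF _ b2(2,3)] d2(1) by blast
    qed
    have "(b, q) \<in> N \<inter> B' \<times> D"
    proof -
      have "dist l q < 2 * \<eta>" using q(2) \<eta>(1) by simp
      then show ?thesis using N(2) b(1) by (simp add: D_def)
    qed
    then have "N \<inter> B' \<times> D \<noteq> {}" by blast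
    from XX.P.minimal_set_syndetic[OF N(1) opB'D this]
    obtain F where F: "finite F" "F \<subseteq> carrier G"
      "\<forall>p. p \<in> N \<longrightarrow> (\<exists>f\<in>F. map_prod (\<phi> f) (\<phi> f) p \<in> B' \<times> D)" by metis
    have sndN: "snd ` N = X"
    proof (rule XX.invariant_eq_carrier)
      show "closed (snd ` N)"
        by (intro compact_imp_closed compact_continuous_image continuous_on_snd continuous_on_id
            XX.P.minimal_setD(5)[OF N(1)])
      show "snd ` N \<noteq> {}" using N(2) by blast
      show "invariant (snd ` N)"
        unfolding invariant_def
      proof (intro conjI ballI)
        show "snd ` N \<subseteq> X" using XX.P.minimal_setD(4)[OF N(1)] by auto
        fix g y assume gy: "g \<in> carrier G" "y \<in> snd ` N"
        then obtain x where "(x, y) \<in> N" by auto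
        then have "(\<phi> g x, \<phi> g y) \<in> N"
          using XX.P.invariantD[OF XX.P.minimal_setD(3)[OF N(1)] gy(1)] by fastforce
        then show "\<phi> g y \<in> snd ` N" by force
      qed
    qed
    \<comment> \<open>Every \<open>x\<close> is the second coordinate of a point of
      \<open>N\<close>, which some \<open>f \<in> F\<close> moves into \<open>B' \<times> D\<close>,
      where second coordinates avoid \<open>U\<close>.\<close>
    define \<C> where "\<C> = (\<lambda>f. X \<inter> \<phi> f -` (- U)) ` F"
    have "UNIV \<inter> X \<subseteq> \<Union>\<C>"
    proof
      fix x assume "x \<in> UNIV \<inter> X"
      then have xX: "x \<in> X" by blast
      then obtain w where wx: "(w, x) \<in> N" using sndN by force
      then obtain f where f: "f \<in> F" "map_prod (\<phi> f) (\<phi> f) (w, x) \<in> B' \<times> D" using F(3) by metis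
      have "map_prod (\<phi> f) (\<phi> f) (w, x) \<in> N"
        by (rule XX.P.invariantD[OF XX.P.minimal_setD(3)[OF N(1)] _ wx]) (use f(1) F(2) in blast)
      then have "\<phi> f x \<notin> U" using sub f(2) by simp
      then show "x \<in> \<Union>\<C>" using f(1) xX unfolding \<C>_def by blast
    qed
    moreover have "closed E" if "E \<in> \<C>" for E
    proof -
      from that obtain f where f: "f \<in> F" "E = X \<inter> \<phi> f -` (- U)" unfolding \<C>_def by (elim imageE)
      then have "continuous_on X (\<phi> f)" using F(2) cont by blast
      then show ?thesis unfolding f(2) by (rule continuous_closed_preimage[OF _ closed_carrier clU])
    qed
    moreover have "finite \<C>" "UNIV \<inter> X \<noteq> {}" using F(1) A(2) by (auto simp: \<C>_def)
    ultimately have "\<exists>E\<in>\<C>. \<exists>B'. open B' \<and> B' \<subseteq> UNIV \<and> B' \<inter> X \<noteq> {} \<and> B' \<inter> X \<subseteq> E"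
      using finite_closed_cover_interior[of \<C> UNIV X] by fastforce
    then obtain E B3 where E: "E \<in> \<C>" and B30: "open B3 \<and> B3 \<subseteq> UNIV \<and> B3 \<inter> X \<noteq> {} \<and> B3 \<inter> X \<subseteq> E"
      by (elim bexE exE)
    from E obtain f where "f \<in> F" "E = X \<inter> \<phi> f -` (- U)" unfolding \<C>_def by (elim imageE)
    with B30 have B3: "f \<in> F" "open B3" "B3 \<inter> X \<noteq> {}" "B3 \<inter> X \<subseteq> \<phi> f -` (- U)" by auto
    have f: "f \<in> carrier G" using B3(1) F(2) by blast
    \<comment> \<open>The image of \<open>B3 \<inter> X\<close> under \<open>\<phi> f\<close> is
      relatively open and misses \<open>U\<close>.\<close>
    have "continuous_on X (\<phi> (inv f))" using f by (intro cont) simp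
    then obtain B4 where B4: "open B4" "B4 \<inter> X = \<phi> (inv f) -` B3 \<inter> X"
      using B3(2) continuous_on_open_invariant by metis
    obtain x where "x \<in> B3" "x \<in> X" using B3(3) by blast
    then have "\<phi> f x \<in> B4 \<inter> X" unfolding B4(2) using f stay by simp
    then have "B4 \<inter> X \<noteq> {}" by blast
    then obtain y where y: "y \<in> B4" "y \<in> U" "y \<in> X" using U B4(1) unfolding dense_open_in_def by blast
    then have "\<phi> (inv f) y \<in> B3 \<inter> X" using B4(2) f stay[of "inv f" y] by auto
    then have "\<phi> f (\<phi> (inv f) y) \<notin> U" using B3(4) by blast
    then show False using y f by simp
  qed
qed

text \<open>For each of the countably many dense open sets behind \<open>P\<close>, containing the
  whole section is again a dense open condition on the base point.\<close>

lemma generic_sections: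
  assumes gen: "generic X (thin n)" and P: "generic X P"
  shows "generic X (\<lambda>z. \<forall>q\<in>RP `` {z}. P q)"
proof -
  obtain \<U> where \<U>: "countable \<U>" "\<And>U. U \<in> \<U> \<Longrightarrow> dense_open_in X U"
    "\<And>x. x \<in> X \<Longrightarrow> (\<forall>U\<in>\<U>. x \<in> U) \<Longrightarrow> P x"
    using P unfolding generic_def by metis
  have "generic X (\<lambda>z. \<forall>U\<in>\<U>. z \<in> - {x \<in> X. RP `` {x} \<inter> - U \<noteq> {}})"
    by (intro generic_ball \<U>(1) generic_dense_open generic_section_avoids[OF gen] \<U>(2))
  then show ?thesis
  proof (rule generic_mono)
    fix z assume z: "z \<in> X" "\<forall>U\<in>\<U>. z \<in> - {x \<in> X. RP `` {x} \<inter> - U \<noteq> {}}"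
    show "\<forall>q\<in>RP `` {z}. P q"
    proof
      fix q assume q: "q \<in> RP `` {z}"
      have "q \<in> X" using q RP_subset by blast
      moreover have "\<forall>U\<in>\<U>. q \<in> U" using z q by blast
      ultimately show "P q" by (rule \<U>(3))
    qed
  qed
qed

section \<open>The interior of the closure of the tuples gathered in \<open>W\<close>\<close>

definition visiting :: "nat \<Rightarrow> 'a set \<Rightarrow> (nat \<Rightarrow> 'a) set" where
  "visiting n W = {y \<in> seqs. \<exists>g\<in>carrier G. \<forall>i\<in>{1..n}. \<phi> g (y i) \<in> W}"

text \<open>An ambient open set whose trace on \<open>seqs\<close> is the interior of the closure
  relative to \<open>seqs\<close>.\<close>

definition inner :: "nat \<Rightarrow> 'a set \<Rightarrow> (nat \<Rightarrow> 'a) set" where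
  "inner n W = \<Union>{U. open U \<and> U \<inter> seqs \<subseteq> closure (visiting n W)}"

lemma visiting_act:
  assumes "y \<in> visiting n W" "h \<in> carrier G"
  shows "\<phi> h \<circ> y \<in> visiting n W"
proof -
  obtain g where g: "g \<in> carrier G" "\<forall>i\<in>{1..n}. \<phi> g (y i) \<in> W" "y \<in> seqs" using assms(1) by (auto simp: visiting_def)
  have "\<phi> (g \<otimes> inv h) (\<phi> h (y i)) = \<phi> g (y i)" for i
    using g assms(2) by (simp add: act_mult stay seqs_def)
  then show ?thesis
    unfolding visiting_def using g assms(2)
    by (auto simp: seqs_def stay intro!: bexI[of _ "g \<otimes> inv h"])
qed

lemma inner_open: "open (inner n W)"
  unfolding inner_def by (intro open_Union) blast

lemma inner_subset: "inner n W \<inter> seqs \<subseteq> closure (visiting n W)"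
  unfolding inner_def by blast

lemma innerI: "open U \<Longrightarrow> y \<in> U \<Longrightarrow> U \<inter> seqs \<subseteq> closure (visiting n W) \<Longrightarrow> y \<in> inner n W"
  unfolding inner_def by blast

lemma inner_act:
  assumes y: "y \<in> inner n W" "y \<in> seqs" and h: "h \<in> carrier G"
  shows "\<phi> h \<circ> y \<in> inner n W"
proof -
  interpret S: compact_t2_action G seqs "\<lambda>g y. \<phi> g \<circ> y" by (rule seq_action)
  obtain U where U: "open U" "U \<inter> seqs = (\<lambda>y. \<phi> (inv h) \<circ> y) -` inner n W \<inter> seqs"
    using S.cont[of "inv h"] h inner_open continuous_on_open_invariant by (metis inv_closed)
  have inv: "S.invariant (closure (visiting n W))"
    by (rule S.closure_invariant) (auto simp: S.invariant_def visiting_act, auto simp: visiting_def)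
  show ?thesis
  proof (rule innerI[OF U(1)])
    have "\<phi> h \<circ> y \<in> seqs" using y(2) h S.stay by blast
    moreover have "\<phi> (inv h) \<circ> (\<phi> h \<circ> y) = y" using S.inv_act(1)[OF h y(2)] .
    ultimately have "\<phi> h \<circ> y \<in> (\<lambda>y. \<phi> (inv h) \<circ> y) -` inner n W \<inter> seqs" using y(1) by simp
    then show "\<phi> h \<circ> y \<in> U" unfolding U(2)[symmetric] by blast
    show "U \<inter> seqs \<subseteq> closure (visiting n W)"
    proof
      fix v assume v: "v \<in> U \<inter> seqs"
      then have "\<phi> (inv h) \<circ> v \<in> inner n W" "v \<in> seqs" using U(2) by auto
      moreover from this have "\<phi> (inv h) \<circ> v \<in> seqs" using h S.stay by simp
      ultimately have "\<phi> (inv h) \<circ> v \<in> closure (visiting n W)" using inner_subset by blast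
      then have "\<phi> h \<circ> (\<phi> (inv h) \<circ> v) \<in> closure (visiting n W)" using S.invariantD[OF inv h] by blast
      then show "v \<in> closure (visiting n W)" using S.inv_act(2)[OF h] v by simp
    qed
  qed
qed

text \<open>Some \<open>g\<close> moves \<open>z\<close>, hence a neighbourhood \<open>V\<close> of
  \<open>z\<close>, into \<open>W\<close>, so all tuples with entries in \<open>V\<close> are
  gathered. This starts the induction over the coordinates.\<close>

lemma const_inner:
  assumes W: "open W" "W \<inter> X \<noteq> {}" and z: "z \<in> X"
  shows "(\<lambda>_. z) \<in> inner n W"
proof -
  obtain g where g: "g \<in> carrier G" "\<phi> g z \<in> W" using visits[OF W z] by metis
  obtain V where V: "open V" "V \<inter> X = \<phi> g -` W \<inter> X"
    using cont[OF g(1)] W(1) continuous_on_open_invariant by metis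
  show ?thesis
  proof (rule innerI)
    show "open {y. \<forall>i\<in>{1..n}. y i \<in> V}" by (rule product_topology_basis'[of "{1..n}" "\<lambda>_. V" "\<lambda>i. i"]) (use V in auto)
    show "(\<lambda>_. z) \<in> {y. \<forall>i\<in>{1..n}. y i \<in> V}" using V(2) g z by auto
    have "{y. \<forall>i\<in>{1..n}. y i \<in> V} \<inter> seqs \<subseteq> visiting n W"
    proof
      fix y assume y: "y \<in> {y. \<forall>i\<in>{1..n}. y i \<in> V} \<inter> seqs"
      have "\<phi> g (y i) \<in> W" if "i \<in> {1..n}" for i
      proof -
        have "y i \<in> V \<inter> X" using y that by (auto simp: seqs_def)
        then show ?thesis unfolding V(2) by blast
      qed
      then have "\<exists>g\<in>carrier G. \<forall>i\<in>{1..n}. \<phi> g (y i) \<in> W" using g(1) by blast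
      then show "y \<in> visiting n W" using y by (simp add: visiting_def)
    qed
    then show "{y. \<forall>i\<in>{1..n}. y i \<in> V} \<inter> seqs \<subseteq> closure (visiting n W)" using closure_subset by blast
  qed
qed

lemma update_continuous: "continuous_on S (\<lambda>t :: 'a \<times> (nat \<Rightarrow> 'a). (snd t)(i := fst t))"
proof (rule continuous_on_coordinatewise_then_product)
  fix j
  have "continuous_on S (\<lambda>t :: 'a \<times> (nat \<Rightarrow> 'a). snd t j)"
    by (rule continuous_on_product_then_coordinatewise) (intro continuous_intros)
  then show "continuous_on S (\<lambda>t :: 'a \<times> (nat \<Rightarrow> 'a). ((snd t)(i := fst t)) j)"
    by (cases "j = i") (auto intro: continuous_intros)
qed

abbreviation seq_linked :: "'a \<Rightarrow> bool" where
  "seq_linked \<equiv> action_pair.linked G X \<phi> seqs (\<lambda>g y. \<phi> g \<circ> y)"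

text \<open>The transfer lemma makes \<open>w(i := z')\<close> a limit of gathered tuples if
  \<open>w\<close> is near \<open>y\<close> and \<open>z'\<close> is regionally proximal to a linked
  \<open>p'\<close> near \<open>y i\<close>. Lower semicontinuity at \<open>q\<close>, with symmetry
  of \<open>RP\<close>, provides such a \<open>p'\<close> for every good \<open>z'\<close> near
  \<open>q\<close>. Density of the good points then yields a full neighbourhood of
  \<open>y(i := q)\<close>, as \<open>inner\<close> demands.\<close>

lemma inner_update:
  assumes gen: "generic X (\<lambda>z. \<forall>q\<in>RP `` {z}. seq_linked q)"
    and y: "y \<in> inner n W" "y \<in> seqs" and q: "q \<in> RP `` {y i}" "lsc_at q"
  shows "y(i := q) \<in> inner n W"
proof -
  interpret S: action_pair G X \<phi> seqs "\<lambda>g y. \<phi> g \<circ> y" by (rule seq_pair)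
  define upd where "upd t = (snd t)(i := fst t)" for t :: "'a \<times> (nat \<Rightarrow> 'a)"
  have upd_cont: "continuous_on T upd" for T unfolding upd_def by (rule update_continuous)
  define V where "V = upd -` inner n W"
  have opV: "open V" unfolding V_def using inner_open upd_cont by (rule open_vimage)
  \<comment> \<open>Coordinate \<open>i\<close> is split off as a first component so that the
    transfer lemma can act on it; \<open>upd\<close> overwrites the entry of \<open>w\<close> at
    \<open>i\<close>.\<close>
  define T where "T = V \<inter> (X \<times> seqs)"
  have invT: "S.P.invariant T"
    unfolding S.P.invariant_def
  proof (intro conjI ballI)
    show "T \<subseteq> X \<times> seqs" by (simp add: T_def)
    fix g t assume gt: "g \<in> carrier G" "t \<in> T"
    obtain x w where t: "t = (x, w)" by (cases t)
    have xw: "w(i := x) \<in> inner n W" "x \<in> X" "w \<in> seqs" using gt(2) t by (auto simp: T_def V_def upd_def)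
    then have "w(i := x) \<in> seqs" by (simp add: seqs_def)
    then have "\<phi> g \<circ> w(i := x) \<in> inner n W" using inner_act xw(1) gt(1) by blast
    then have "(\<phi> g \<circ> w)(i := \<phi> g x) \<in> inner n W" by (simp add: fun_upd_comp)
    then show "map_prod (\<phi> g) (\<lambda>y. \<phi> g \<circ> y) t \<in> T"
      using xw(2,3) gt(1) stay by (auto simp: t T_def V_def upd_def seqs_def)
  qed
  have TC: "upd ` closure T \<subseteq> closure (visiting n W)"
  proof (rule image_closure_subset[OF upd_cont closed_closure])
    have "upd t \<in> seqs" if "t \<in> T" for t using that by (auto simp: T_def upd_def seqs_def)
    then show "upd ` T \<subseteq> closure (visiting n W)" using inner_subset by (fastforce simp: T_def V_def)
  qed
  have p: "y i \<in> X" using y(2) by (simp add: seqs_def)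
  have qX: "q \<in> X" using q RP_subset by blast
  have "(y i, y) \<in> V" using y(1) by (simp add: V_def upd_def)
  then obtain A D where AD: "open A" "open D" "y i \<in> A" "y \<in> D" "A \<times> D \<subseteq> V"
    using open_prod_elim[OF opV] by (metis mem_Sigma_iff)
  obtain r where r: "r > 0" "ball (y i) r \<subseteq> A" using AD(1,3) open_contains_ball by blast
  have "y i \<in> RP `` {q}" using q(1) RP_sym by blast
  then obtain B where B: "open B" "q \<in> B" "\<forall>z'\<in>B \<inter> X. \<exists>q'\<in>RP `` {z'}. dist (y i) q' < r"
    using q(2) r(1) unfolding lsc_at_def by blast
  define good where "good z \<longleftrightarrow> (\<forall>q\<in>RP `` {z}. seq_linked q)" for z
  have core: "w(i := z') \<in> closure (visiting n W)"
    if z': "z' \<in> B" "z' \<in> X" "good z'" and w: "w \<in> D" "w \<in> seqs" for z' w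
  proof -
    obtain p' where p': "p' \<in> RP `` {z'}" "dist (y i) p' < r" using B(3) z' by blast
    have "p' \<in> A" using p'(2) r(2) by auto
    moreover have "p' \<in> X" using p'(1) RP_subset by blast
    ultimately have "(p', w) \<in> T" using AD(5) w by (auto simp: T_def)
    moreover have "seq_linked p'" using z'(3) p'(1) by (simp add: good_def)
    ultimately have "(z', w) \<in> closure T"
      using S.regionally_proximal_transfer[OF invT opV T_def] p'(1) by simp
    then have "upd (z', w) \<in> closure (visiting n W)" using TC by blast
    then show ?thesis by (simp add: upd_def)
  qed
  have coord: "continuous_on UNIV (\<lambda>v :: nat \<Rightarrow> 'a. v i)" by simp
  have updi: "continuous_on UNIV (\<lambda>v :: nat \<Rightarrow> 'a. v(i := y i))"
  proof (rule continuous_on_coordinatewise_then_product)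
    show "continuous_on UNIV (\<lambda>v. (v(i := y i)) j)" for j by (cases "j = i") auto
  qed
  show ?thesis
  proof (rule innerI)
    \<comment> \<open>Entry \<open>i\<close> is tested in \<open>B\<close> and the others in
      \<open>D\<close>, with \<open>y i\<close> put back at \<open>i\<close> because
      \<open>D\<close> is a neighbourhood of \<open>y\<close>.\<close>
    show "open ((\<lambda>v. v i) -` B \<inter> (\<lambda>v. v(i := y i)) -` D)"
      using B(1) AD(2) coord updi by (intro open_Int open_vimage)
    show "y(i := q) \<in> (\<lambda>v. v i) -` B \<inter> (\<lambda>v. v(i := y i)) -` D" using B(2) AD(4) by simp
    show "((\<lambda>v. v i) -` B \<inter> (\<lambda>v. v(i := y i)) -` D) \<inter> seqs \<subseteq> closure (visiting n W)"
    proof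
      fix v assume v: "v \<in> ((\<lambda>v. v i) -` B \<inter> (\<lambda>v. v(i := y i)) -` D) \<inter> seqs"
      define w where "w = v(i := y i)"
      have w: "w \<in> D" "w \<in> seqs" using v p by (auto simp: w_def seqs_def)
      define Z where "Z = {z' \<in> B \<inter> X. good z'}"
      \<comment> \<open>\<open>core\<close> covers good entries; the others are limits of good ones,
        and the target set is closed.\<close>
      have "v i \<in> closure Z"
      proof (rule ccontr)
        assume "v i \<notin> closure Z"
        then have "open (B - closure Z)" "(B - closure Z) \<inter> X \<noteq> {}"
          using v B(1) by (auto simp: seqs_def open_Diff)
        then obtain z' where "z' \<in> B - closure Z" "z' \<in> X" "good z'"
          using generic_dense[OF compact_carrier gen] unfolding good_def by metis
        then show False using closure_subset[of Z] by (auto simp: Z_def)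
      qed
      moreover have "continuous_on (closure Z) (\<lambda>x. w(i := x))"
      proof (rule continuous_on_coordinatewise_then_product)
        show "continuous_on (closure Z) (\<lambda>x. (w(i := x)) j)" for j
          by (cases "j = i") (auto intro: continuous_intros)
      qed
      then have "(\<lambda>x. w(i := x)) ` closure Z \<subseteq> closure (visiting n W)"
        by (rule image_closure_subset[OF _ closed_closure]) (use core w in \<open>auto simp: Z_def\<close>)
      ultimately have "w(i := v i) \<in> closure (visiting n W)" by blast
      then show "v \<in> closure (visiting n W)" by (simp add: w_def)
    qed
  qed
qed

text \<open>Entries of the constant tuple are replaced one at a time. Until its turn comes an entry
  equals \<open>z\<close>, so \<open>l i\<close> is regionally proximal to it.\<close>

lemma section_tuple_inner:
  assumes gen: "generic X (\<lambda>z. \<forall>q\<in>RP `` {z}. seq_linked q)"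
    and W: "open W" "W \<inter> X \<noteq> {}" and z: "z \<in> X" "\<And>q. q \<in> RP `` {z} \<Longrightarrow> lsc_at q"
    and l: "\<And>i. i \<in> {1..n} \<Longrightarrow> l i \<in> RP `` {z}"
  shows "(\<lambda>i. if i \<in> {1..n} then l i else z) \<in> inner n W"
proof -
  have "(\<lambda>i. if i \<in> {1..k} then l i else z) \<in> inner n W" if "k \<le> n" for k
    using that
  proof (induction k)
    case 0
    then show ?case using const_inner[OF W z(1)] by simp
  next
    case (Suc k)
    let ?y = "\<lambda>i. if i \<in> {1..k} then l i else z"
    have lk: "l (Suc k) \<in> RP `` {z}" using l Suc.prems by simp
    have "?y i \<in> X" for i using l[of i] Suc.prems z(1) RP_subset by auto
    then have "?y \<in> seqs" by (simp add: seqs_def)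
    moreover have "?y \<in> inner n W" using Suc by simp
    moreover have "l (Suc k) \<in> RP `` {?y (Suc k)}" using lk by simp
    ultimately have "?y(Suc k := l (Suc k)) \<in> inner n W"
      using inner_update[OF gen] z(2)[OF lk] by blast
    moreover have "?y(Suc k := l (Suc k)) = (\<lambda>i. if i \<in> {1..Suc k} then l i else z)"
      by (auto simp: fun_eq_iff le_Suc_eq)
    ultimately show ?case by simp
  qed
  then show ?thesis by blast
qed

lemma box_radius:
  assumes D: "open D" "(\<lambda>i. if i \<in> {1..n} then l i else z) \<in> D"
  obtains e where "e > 0"
    "\<And>v :: nat \<Rightarrow> 'a. (\<And>i. i \<in> {1..n} \<Longrightarrow> dist (l i) (v i) < e) \<Longrightarrow> (\<And>i. i \<notin> {1..n} \<Longrightarrow> v i = z) \<Longrightarrow> v \<in> D"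
proof -
  from open_box[OF D] obtain U where U: "\<And>i :: nat. open (U i)"
    "\<And>i. (if i \<in> {1..n} then l i else z) \<in> U i" "\<And>v. (\<And>i. v i \<in> U i) \<Longrightarrow> v \<in> D" by metis
  have "\<exists>e>0. ball (l i) e \<subseteq> U i" if "i \<in> {1..n}" for i
    using U(1)[of i] U(2)[of i] that open_contains_ball by auto
  then obtain e where e: "\<And>i. i \<in> {1..n} \<Longrightarrow> e i > 0 \<and> ball (l i) (e i) \<subseteq> U i" by metis
  define m where "m = Min (insert 1 (e ` {1..n}))"
  have m: "m > 0" "\<And>i. i \<in> {1..n} \<Longrightarrow> m \<le> e i"
    unfolding m_def using e by (simp, intro Min_le) auto
  show thesis
  proof (rule that[OF m(1)])
    fix v assume v: "\<And>i. i \<in> {1..n} \<Longrightarrow> dist (l i) (v i) < m" "\<And>i. i \<notin> {1..n} \<Longrightarrow> v i = z"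
    show "v \<in> D"
    proof (rule U(3))
      fix i
      show "v i \<in> U i"
      proof (cases "i \<in> {1..n}")
        case True
        then have "dist (l i) (v i) < e i" using v(1) m(2) by fastforce
        then have "v i \<in> ball (l i) (e i)" by simp
        then show ?thesis using e[OF True] by blast
      qed (use v(2) U(2)[of i] in auto)
    qed
  qed
qed

text \<open>When the generic sections are finite, an arbitrary fibre is carried near a generic finite one, every
  tuple of which lies inside the set of tuples that can be gathered.\<close>

lemma gatherable_thin:
  assumes thin: "generic X (thin m)" and x0: "x0 \<in> X"
    and x: "\<And>i. i \<in> {1..n} \<Longrightarrow> (x0, x i) \<in> RP"
  shows "gatherable n x"
  unfolding gatherable_def
proof (intro allI impI)
  fix r :: real and W :: "'a set" assume r: "r > 0" and W: "open W" "W \<inter> X \<noteq> {}"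
  interpret S: action_pair G X \<phi> seqs "\<lambda>g y. \<phi> g \<circ> y" by (rule seq_pair)
  have fin: "generic X (\<lambda>z. lsc_at z \<and> finite (RP `` {z}))"
    using thin by (rule generic_mono) (simp add: thin_def)
  have linked: "generic X seq_linked"
    by (rule S.generic_linked) (rule seq_pair_minimal_dense[OF fin])
  have gen: "generic X (\<lambda>z. \<forall>q\<in>RP `` {z}. seq_linked q)" by (rule generic_sections[OF thin linked])
  have "generic X (\<lambda>z. \<forall>q\<in>RP `` {z}. lsc_at q)" by (rule generic_sections[OF thin generic_lsc])
  then have "generic X (\<lambda>z. (\<forall>q\<in>RP `` {z}. lsc_at q) \<and> (lsc_at z \<and> finite (RP `` {z})))"
    by (rule generic_conj[OF _ fin])
  from generic_dense[OF compact_carrier this W]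
  obtain z where z: "z \<in> X" "\<forall>q\<in>RP `` {z}. lsc_at q" "finite (RP `` {z})" by metis
  \<comment> \<open>There are finitely many tuples from the section, so one radius serves all of
    them, whichever section points the approximations select later.\<close>
  define L where "L = PiE {1..n} (\<lambda>_. RP `` {z})"
  have finL: "finite L" unfolding L_def using z(3) by (intro finite_PiE) auto
  have "\<exists>e>0. \<forall>v. (\<forall>i\<in>{1..n}. dist (l i) (v i) < e) \<longrightarrow> (\<forall>i. i \<notin> {1..n} \<longrightarrow> v i = z) \<longrightarrow> v \<in> inner n W"
    if l: "l \<in> L" for l
  proof -
    have "l i \<in> RP `` {z}" if "i \<in> {1..n}" for i using l that unfolding L_def by blast
    then have "(\<lambda>i. if i \<in> {1..n} then l i else z) \<in> inner n W"
      using section_tuple_inner[OF gen W z(1)] z(2) by blast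
    from box_radius[OF inner_open this] show ?thesis by metis
  qed
  then obtain e where e: "\<And>l. l \<in> L \<Longrightarrow> e l > 0"
    "\<And>l v. l \<in> L \<Longrightarrow> (\<forall>i\<in>{1..n}. dist (l i) (v i) < e l) \<Longrightarrow> (\<forall>i. i \<notin> {1..n} \<longrightarrow> v i = z) \<Longrightarrow> v \<in> inner n W"
    by metis
  define \<eta> where "\<eta> = Min (insert 1 (e ` L))"
  have \<eta>: "\<eta> > 0" "\<And>l. l \<in> L \<Longrightarrow> \<eta> \<le> e l" using e(1) finL by (auto simp: \<eta>_def)
  obtain d where d: "d > 0" "\<And>a b. dist z a < d \<Longrightarrow> (a, b) \<in> near_orbit d \<Longrightarrow> \<exists>q\<in>RP `` {z}. dist q b < \<eta>"
    using RP_near_section[OF z(1) \<eta>(1)] by metis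
  have "z \<in> ball z d" using d(1) by simp
  then have "open (ball z d)" "ball z d \<inter> X \<noteq> {}" using z(1) by (simp, blast)
  then obtain h where h: "h \<in> carrier G" "\<phi> h x0 \<in> ball z d" using visits[OF _ _ x0] by metis
  obtain \<rho> where \<rho>: "\<rho> > 0" "\<And>a. a \<in> X \<Longrightarrow> dist x0 a < \<rho> \<Longrightarrow> dist (\<phi> h x0) (\<phi> h a) < d - dist z (\<phi> h x0)"
    using cont_at[OF h(1) x0, of "d - dist z (\<phi> h x0)"] h(2) by auto
  \<comment> \<open>Each \<open>i\<close> has its own approximating pair \<open>(a, b)\<close>.
    Since \<open>\<phi> h a\<close> is within \<open>d\<close> of \<open>z\<close>, the point
    \<open>\<phi> h b\<close> is close to the section of \<open>z\<close> wherever \<open>a\<close>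
    lies.\<close>
  have "\<exists>b q. b \<in> X \<and> dist (x i) b < r \<and> q \<in> RP `` {z} \<and> dist q (\<phi> h b) < \<eta>" if i: "i \<in> {1..n}" for i
  proof -
    have "min \<rho> r > 0" using \<rho>(1) r by simp
    then obtain a b where ab: "(a, b) \<in> near_orbit d" "dist x0 a < min \<rho> r" "dist (x i) b < min \<rho> r"
      using RP_D[OF x[OF i] _ d(1)] by metis
    have aX: "a \<in> X" "b \<in> X" using ab(1) by (auto simp: near_orbit_def)
    have "dist z (\<phi> h a) < d" using \<rho>(2)[OF aX(1)] ab(2) dist_triangle[of z "\<phi> h a" "\<phi> h x0"] by simp
    then obtain q where "q \<in> RP `` {z}" "dist q (\<phi> h b) < \<eta>"
      using d(2) near_orbit_act[OF h(1) ab(1)] by blast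
    then show ?thesis using aX ab(3) by auto
  qed
  then obtain b q where b: "\<And>i. i \<in> {1..n} \<Longrightarrow> b i \<in> X" "\<And>i. i \<in> {1..n} \<Longrightarrow> dist (x i) (b i) < r"
    and q: "\<And>i. i \<in> {1..n} \<Longrightarrow> q i \<in> RP `` {z}" "\<And>i. i \<in> {1..n} \<Longrightarrow> dist (q i) (\<phi> h (b i)) < \<eta>"
    by metis
  define v where "v i = (if i \<in> {1..n} then \<phi> h (b i) else z)" for i
  have lL: "restrict q {1..n} \<in> L" using q(1) by (simp add: L_def)
  have "v \<in> inner n W"
  proof (rule e(2)[OF lL])
    show "\<forall>i\<in>{1..n}. dist (restrict q {1..n} i) (v i) < e (restrict q {1..n})"
      using q(2) \<eta>(2)[OF lL] by (fastforce simp: v_def)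
  qed (auto simp: v_def)
  moreover have vs: "v \<in> seqs" using b(1) h(1) stay z(1) by (simp add: v_def seqs_def)
  ultimately have vcl: "v \<in> closure (visiting n W)" using inner_subset by blast
  \<comment> \<open>\<open>E i\<close> cuts out of \<open>X\<close> the image of
    \<open>ball (x i) r \<inter> X\<close> under \<open>\<phi> h\<close>, so a gathered tuple near
    \<open>v\<close> pulls back to within \<open>r\<close> of \<open>x\<close>.\<close>
  have "\<exists>E. open E \<and> E \<inter> X = \<phi> (inv h) -` ball (x i) r \<inter> X" for i
    using cont[of "inv h"] h(1) continuous_on_open_invariant open_ball by (metis inv_closed)
  then obtain E where E: "\<And>i. open (E i)" "\<And>i. E i \<inter> X = \<phi> (inv h) -` ball (x i) r \<inter> X" by metis
  have op: "open {y. \<forall>i\<in>{1..n}. y i \<in> E i}"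
    by (rule product_topology_basis'[of "{1..n}" E "\<lambda>i. i"]) (use E(1) in auto)
  have "v i \<in> E i" if i: "i \<in> {1..n}" for i
  proof -
    have "v i \<in> \<phi> (inv h) -` ball (x i) r \<inter> X" using b[OF i] i h(1) stay by (simp add: v_def)
    then show ?thesis using E(2) by blast
  qed
  then have "v \<in> {y. \<forall>i\<in>{1..n}. y i \<in> E i}" by simp
  then have "visiting n W \<inter> {y. \<forall>i\<in>{1..n}. y i \<in> E i} \<noteq> {}"
    using vcl op by (metis (no_types, lifting) closure_iff_nhds_not_empty order_refl)
  then obtain y where y: "y \<in> visiting n W" "\<And>i. i \<in> {1..n} \<Longrightarrow> y i \<in> E i" by blast
  then obtain g where g: "g \<in> carrier G" "\<And>i. i \<in> {1..n} \<Longrightarrow> \<phi> g (y i) \<in> W" "y \<in> seqs"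
    by (auto simp: visiting_def)
  have yX: "y i \<in> X" for i using g(3) by (simp add: seqs_def)
  show "\<exists>c. \<exists>g\<in>carrier G. \<forall>i\<in>{1..n}. c i \<in> X \<and> dist (x i) (c i) < r \<and> \<phi> g (c i) \<in> W"
  proof (intro exI bexI ballI conjI)
    show "g \<otimes> h \<in> carrier G" using g h by simp
    fix i assume i: "i \<in> {1..n}"
    show "\<phi> (inv h) (y i) \<in> X" using h(1) yX stay by simp
    have "y i \<in> \<phi> (inv h) -` ball (x i) r \<inter> X" using y(2)[OF i] E(2)[of i] yX by blast
    then show "dist (x i) (\<phi> (inv h) (y i)) < r" by simp
    show "\<phi> (g \<otimes> h) (\<phi> (inv h) (y i)) \<in> W" using g h(1) yX i stay by (simp add: act_mult)
  qed
qed

end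

section \<open>Sensitivity\<close>

context minimal_action
begin

lemma gatherable_imp_sensitive:
  assumes x: "inj_on x {1..n}" and gat: "gatherable n x"
  shows "n_sensitive n G X \<phi>"
proof -
  obtain \<eta> where \<eta>: "\<eta> > 0"
    "\<And>p q. p \<in> x ` {1..n} \<Longrightarrow> q \<in> x ` {1..n} \<Longrightarrow> p \<noteq> q \<Longrightarrow> 3 * \<eta> \<le> dist p q"
    using finite_separated[of "x ` {1..n}"] by (metis finite_atLeastAtMost finite_imageI)
  show ?thesis
    unfolding n_sensitive_def
  proof (intro exI[of _ \<eta>] conjI allI impI)
    fix U assume U: "openin (top_of_set X) U \<and> U \<noteq> {}"
    then obtain W where W: "open W" "U = X \<inter> W" by (auto simp: openin_open)
    have "W \<inter> X \<noteq> {}" using U W by blast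
    with gat W(1) \<eta>(1) obtain c g where g: "g \<in> carrier G"
      and c: "\<forall>i\<in>{1..n}. c i \<in> X \<and> dist (x i) (c i) < \<eta> \<and> \<phi> g (c i) \<in> W"
      unfolding gatherable_def by blast
    have sep: "dist (c i) (c j) > \<eta>" if "i \<in> {1..n}" "j \<in> {1..n}" "i \<noteq> j" for i j
    proof -
      have "x i \<noteq> x j" using inj_onD[OF x] that by blast
      then have "3 * \<eta> \<le> dist (x i) (x j)" using \<eta>(2) that by blast
      moreover have "dist (x i) (x j) \<le> dist (x i) (c i) + dist (c i) (c j) + dist (x j) (c j)"
        using dist_triangle[of "x i" "x j" "c i"] dist_triangle[of "c i" "x j" "c j"] by (simp add: dist_commute)
      ultimately show ?thesis using c[rule_format, OF that(1)] c[rule_format, OF that(2)] by linarith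
    qed
    have undo_act: "\<phi> (inv g) (\<phi> g (c i)) = c i" if "i \<in> {1..n}" for i using c that g by simp
    show "\<exists>y :: nat \<Rightarrow> 'a. \<exists>g\<in>carrier G. y ` {1..n} \<subseteq> U \<and> inj_on y {1..n} \<and>
        (\<forall>i j. 1 \<le> i \<and> i < j \<and> j \<le> n \<longrightarrow> dist (\<phi> g (y i)) (\<phi> g (y j)) > \<eta>)"
    proof (intro exI[of _ "\<lambda>i. \<phi> g (c i)"] bexI[of _ "inv g"] conjI allI impI)
      show "(\<lambda>i. \<phi> g (c i)) ` {1..n} \<subseteq> U" using c W(2) g stay by auto
      show "inj_on (\<lambda>i. \<phi> g (c i)) {1..n}"
      proof (rule inj_onI, rule ccontr)
        fix i j assume ij: "i \<in> {1..n}" "j \<in> {1..n}" "\<phi> g (c i) = \<phi> g (c j)" "i \<noteq> j"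
        then have "c i = c j" using undo_act by metis
        then show False using sep[OF ij(1,2,4)] \<eta>(1) by simp
      qed
      fix i j assume ij: "1 \<le> i \<and> i < j \<and> j \<le> n"
      then have "i \<in> {1..n}" "j \<in> {1..n}" "i \<noteq> j" by auto
      then show "dist (\<phi> (inv g) (\<phi> g (c i))) (\<phi> (inv g) (\<phi> g (c j))) > \<eta>" using sep undo_act by simp
    qed (use g in simp)
  qed (use \<eta> in simp)
qed

text \<open>The inverse of \<open>g k\<close> returns the separated points to a tiny ball about
  \<open>p\<close>, so they form pairs in \<open>near_orbit e\<close>, and their limits keep the
  separation. The base point obtained is the first limit \<open>l 1\<close>, not
  \<open>p\<close>.\<close>

lemma sensitive_imp_large_section:
  assumes n: "n \<ge> 1" and sens: "n_sensitive n G X \<phi>"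
  shows "\<exists>x\<in>X. at_least_card n (RP `` {x})"
proof -
  obtain \<delta> where \<delta>: "\<delta> > 0" and S: "\<And>U. openin (top_of_set X) U \<Longrightarrow> U \<noteq> {} \<Longrightarrow>
      \<exists>x :: nat \<Rightarrow> 'a. \<exists>g\<in>carrier G. x ` {1..n} \<subseteq> U \<and> inj_on x {1..n} \<and>
        (\<forall>i j. 1 \<le> i \<and> i < j \<and> j \<le> n \<longrightarrow> dist (\<phi> g (x i)) (\<phi> g (x j)) > \<delta>)"
    using sens unfolding n_sensitive_def by meson
  obtain p where p: "p \<in> X" using minimal minimal_setD(1) by blast
  have "\<exists>x :: nat \<Rightarrow> 'a. \<exists>g\<in>carrier G. x ` {1..n} \<subseteq> X \<inter> ball p (1 / real (Suc k)) \<and> inj_on x {1..n} \<and>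
        (\<forall>i j. 1 \<le> i \<and> i < j \<and> j \<le> n \<longrightarrow> dist (\<phi> g (x i)) (\<phi> g (x j)) > \<delta>)" for k
  proof (rule S)
    have "p \<in> X \<inter> ball p (1 / real (Suc k))" using p by simp
    then show "X \<inter> ball p (1 / real (Suc k)) \<noteq> {}" by blast
  qed (simp add: openin_open_Int)
  then obtain x g where xg: "\<And>k :: nat. g k \<in> carrier G"
    "\<And>k. x k ` {1..n} \<subseteq> X \<inter> ball p (1 / real (Suc k))"
    "\<And>k. \<forall>i j. 1 \<le> i \<and> i < j \<and> j \<le> n \<longrightarrow> dist (\<phi> (g k) (x k i)) (\<phi> (g k) (x k j)) > \<delta>"
    by metis
  have xX: "x k i \<in> X" "dist p (x k i) < 1 / real (Suc k)" if "i \<in> {1..n}" for k i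
    using subsetD[OF xg(2)[of k] imageI[OF that]] by simp_all
  define y where "y k i = (if i \<in> {1..n} then \<phi> (g k) (x k i) else p)" for k i
  have ys: "y k \<in> seqs" for k using xX(1) xg(1) stay p by (simp add: y_def seqs_def)
  interpret S: compact_t2_action G seqs "\<lambda>g y. \<phi> g \<circ> y" by (rule seq_action)
  have "seq_compact seqs" using S.compact_carrier compact_eq_seq_compact_metric by blast
  then obtain l r where l: "l \<in> seqs" "strict_mono r" "(y \<circ> r) \<longlonglongrightarrow> l"
    using ys seq_compactE[of seqs y] by metis
  have lim: "(\<lambda>k. y (r k) i) \<longlonglongrightarrow> l i" for i
  proof -
    have "continuous_on UNIV (\<lambda>v :: nat \<Rightarrow> 'a. v i)" by simp
    from continuous_on_tendsto_compose[OF this l(3)] show ?thesis by simp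
  qed
  have lX: "l i \<in> X" for i using l(1) by (simp add: seqs_def)
  have far: "dist (l i) (l j) \<ge> \<delta>" if "1 \<le> i" "i < j" "j \<le> n" for i j
  proof (rule LIMSEQ_le_const[OF tendsto_dist[OF lim lim]])
    show "\<exists>N. \<forall>k\<ge>N. \<delta> \<le> dist (y (r k) i) (y (r k) j)"
      using xg(3) that by (intro exI[of _ 0] allI impI) (simp add: y_def less_imp_le)
  qed
  have RPl: "(l 1, l j) \<in> RP" if j: "j \<in> {1..n}" for j
  proof (rule RP_closure[OF lX lX])
    fix e :: real assume e: "e > 0"
    obtain k0 where k0: "1 / real (Suc k0) < e / 2" using e nat_approx_posE[of "e / 2"] by auto
    have "\<forall>\<^sub>F k in sequentially. dist (y (r k) 1) (l 1) < e \<and> dist (y (r k) j) (l j) < e \<and> k \<ge> k0"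
      by (intro eventually_conj tendstoD[OF lim e] eventually_ge_at_top)
    then obtain k where k: "dist (y (r k) 1) (l 1) < e" "dist (y (r k) j) (l j) < e" "k \<ge> k0"
      unfolding eventually_sequentially by blast
    have one: "1 \<in> {1..n}" using n by simp
    have "r k \<ge> k0" using k(3) seq_suble[OF l(2), of k] by simp
    then have "1 / real (Suc (r k)) \<le> 1 / real (Suc k0)" by (simp add: frac_le)
    then have "dist (x (r k) 1) (x (r k) j) < e"
      using xX(2)[OF one, of "r k"] xX(2)[OF j, of "r k"] k0 dist_triangle3[of "x (r k) 1" "x (r k) j" p] by linarith
    then have "(y (r k) 1, y (r k) j) \<in> near_orbit e"
      using one j xX(1) xg(1)[of "r k"] stay unfolding near_orbit_def y_def
      by (auto intro!: bexI[of _ "inv (g (r k))"])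
    then show "\<exists>a b. (a, b) \<in> RP \<union> near_orbit e \<and> dist (l 1) a < e \<and> dist (l j) b < e"
      using k by (intro exI[of _ "y (r k) 1"] exI[of _ "y (r k) j"]) (simp add: dist_commute)
  qed
  have inj: "inj_on l {1..n}"
  proof (rule linorder_inj_onI)
    fix i j assume "i < j" "i \<in> {1..n}" "j \<in> {1..n}"
    then show "l i \<noteq> l j" using far[of i j] \<delta> by auto
  qed auto
  have sub: "l ` {1..n} \<subseteq> RP `` {l 1}" using RPl by blast
  have "at_least_card n (RP `` {l 1})"
    unfolding at_least_card_def using card_mono[OF _ sub] card_image[OF inj] by auto
  then show ?thesis using lX by blast
qed

text \<open>Either some linked, fiberwise approximable point has a large section, or all of them
  have fewer than \<open>n\<close> points in theirs and \<open>thin n\<close> is generic; then the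
  given, possibly exceptional \<open>x0\<close> supplies the points.\<close>

lemma large_section_imp_sensitive:
  assumes dense: "\<And>A D. open A \<Longrightarrow> open D \<Longrightarrow> A \<inter> X \<noteq> {} \<Longrightarrow> D \<inter> X \<noteq> {} \<Longrightarrow>
      \<exists>N. compact_action.minimal_set G (X \<times> X) (\<lambda>g. map_prod (\<phi> g) (\<phi> g)) N \<and> N \<inter> A \<times> D \<noteq> {}"
    and x0: "x0 \<in> X" "at_least_card n (RP `` {x0})"
  shows "n_sensitive n G X \<phi>"
proof -
  interpret XX: action_pair G X \<phi> X \<phi> by (rule self_pair)
  have enum: "\<exists>x :: nat \<Rightarrow> 'a. inj_on x {1..n} \<and> (\<forall>i\<in>{1..n}. (z, x i) \<in> RP)"
    if large: "at_least_card n (RP `` {z})" for z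
  proof -
    have "\<exists>S. S \<subseteq> RP `` {z} \<and> finite S \<and> card S = n"
    proof (cases "finite (RP `` {z})")
      case True
      then have "n \<le> card (RP `` {z})" using large by (simp add: at_least_card_def)
      then show ?thesis using obtain_subset_with_card_n by metis
    next
      case False
      then show ?thesis using infinite_arbitrarily_large by metis
    qed
    then obtain S where S: "S \<subseteq> RP `` {z}" "finite S" "card S = n" by blast
    obtain x where "bij_betw x {1..n} S" using ex_bij_betw_nat_finite_1[OF S(2)] S(3) by blast
    then show ?thesis using S(1) unfolding bij_betw_def by blast
  qed
  have gen: "generic X (\<lambda>z. (XX.linked z \<and> fiberwise_approximable z) \<and> lsc_at z)"
    by (intro generic_conj XX.generic_linked dense generic_fiberwise_approximable generic_lsc)
  show ?thesis
  proof (cases "\<exists>z\<in>X. XX.linked z \<and> fiberwise_approximable z \<and> at_least_card n (RP `` {z})")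
    case True
    then obtain z where z: "z \<in> X" "XX.linked z" "fiberwise_approximable z" "at_least_card n (RP `` {z})" by blast
    obtain x :: "nat \<Rightarrow> 'a" where x: "inj_on x {1..n}" "\<And>i. i \<in> {1..n} \<Longrightarrow> (z, x i) \<in> RP"
      using enum[OF z(4)] by blast
    have "gatherable n x" by (rule gatherable_generic_fiber[OF self_pair z(1-3) x(2)])
    then show ?thesis by (rule gatherable_imp_sensitive[OF x(1)])
  next
    case False
    have thin: "generic X (thin n)"
      using gen by (rule generic_mono) (use False in \<open>auto simp: thin_def at_least_card_def\<close>)
    obtain x :: "nat \<Rightarrow> 'a" where x: "inj_on x {1..n}" "\<And>i. i \<in> {1..n} \<Longrightarrow> (x0, x i) \<in> RP"
      using enum[OF x0(2)] by blast
    have "gatherable n x" by (rule gatherable_thin[OF thin x0(1) x(2)])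
    then show ?thesis by (rule gatherable_imp_sensitive[OF x(1)])
  qed
qed

end

section \<open>From systems to the action locales\<close>

lemma minimal_system_imp_minimal_action:
  assumes "minimal_system G X \<phi>"
  shows "minimal_action G X \<phi>"
proof -
  interpret T: topological_dynamical_system G X \<phi> using assms by (simp add: minimal_system_def)
  have "group G" using T.group_hom by (simp add: group_hom_def)
  then interpret group G .
  interpret compact_t2_action G X \<phi>
  proof unfold_locales
    show "compact X" "closed X" using T.compact_space by (auto intro: compact_imp_closed)
    show "continuous_on X (\<phi> g)" if "g \<in> carrier G" for g using T.continuous_action[OF that] .
    show "\<phi> g y \<in> X" if "g \<in> carrier G" "y \<in> X" for g y using T.element_image[OF that refl] .
    show "\<phi> \<one>\<^bsub>G\<^esub> y = y" if "y \<in> X" for y using that T.id_eq_one[symmetric] by auto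
    show "\<phi> (g \<otimes>\<^bsub>G\<^esub> h) y = \<phi> g (\<phi> h y)" if "g \<in> carrier G" "h \<in> carrier G" "y \<in> X" for g h y
      using T.composition_rule[OF that(3,1,2)] .
  qed
  show ?thesis
  proof unfold_locales
    show "minimal_set X"
      unfolding minimal_set_def
    proof (intro conjI allI impI)
      show "X \<noteq> {}" by (rule T.nonempty_space)
      show "closed X" by (rule closed_carrier)
      show "invariant X" by (simp add: invariant_def stay)
      fix K assume K: "K \<noteq> {} \<and> closed K \<and> invariant K \<and> K \<subseteq> X"
      then have "subsystem G X \<phi> K"
        unfolding subsystem_def invariant_def by (auto intro: closed_subset)
      then show "K = X" using assms by (simp add: minimal_system_def)
    qed
  qed
qed

text \<open>On \<open>N\<close> the restricted diagonal action agrees with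
  \<open>map_prod (\<phi> g) (\<phi> g)\<close>, so minimality as a system makes \<open>N\<close> a
  minimal set of the product action.\<close>

lemma minimal_points_dense:
  assumes min: "minimal_system G X \<phi>"
    and dense: "X \<times> X \<subseteq> closure (minimal_points G (X \<times> X) (diagonal_action \<phi> X))"
    and A: "open A" "A \<inter> X \<noteq> {}" and D: "open D" "D \<inter> X \<noteq> {}"
  shows "\<exists>N. compact_action.minimal_set G (X \<times> X) (\<lambda>g. map_prod (\<phi> g) (\<phi> g)) N \<and> N \<inter> A \<times> D \<noteq> {}"
proof -
  interpret minimal_action G X \<phi> by (rule minimal_system_imp_minimal_action[OF min])
  interpret XX: action_pair G X \<phi> X \<phi> by (rule self_pair)
  obtain a d where ad: "a \<in> A" "a \<in> X" "d \<in> D" "d \<in> X" using A D by blast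
  then have "(a, d) \<in> closure (minimal_points G (X \<times> X) (diagonal_action \<phi> X))" using dense by blast
  moreover have "open (A \<times> D)" "(a, d) \<in> A \<times> D" using A D ad by (auto intro: open_Times)
  ultimately have "minimal_points G (X \<times> X) (diagonal_action \<phi> X) \<inter> A \<times> D \<noteq> {}"
    by (metis closure_iff_nhds_not_empty order_refl)
  then obtain p N where p: "p \<in> A \<times> D" "p \<in> N" and N: "subsystem G (X \<times> X) (diagonal_action \<phi> X) N"
    "minimal_system G N (restricted_action (diagonal_action \<phi> X) N)"
    unfolding minimal_points_def by blast
  have NX: "N \<subseteq> X \<times> X" using N(1) closedin_imp_subset unfolding subsystem_def by blast
  have diag: "diagonal_action \<phi> X g q = map_prod (\<phi> g) (\<phi> g) q" if "q \<in> X \<times> X" for g q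
    using that by (simp add: diagonal_action_def)
  have "XX.P.minimal_set N"
    unfolding XX.P.minimal_set_def
  proof (intro conjI allI impI)
    show "N \<noteq> {}" using p by blast
    show "closed N" using N(1) XX.P.closed_carrier by (auto simp: subsystem_def intro: closedin_closed_trans)
    show "XX.P.invariant N"
      unfolding XX.P.invariant_def
    proof (intro conjI ballI)
      fix g q assume g: "g \<in> carrier G" and q: "q \<in> N"
      have "diagonal_action \<phi> X g q \<in> N" using N(1) g q unfolding subsystem_def by blast
      then show "map_prod (\<phi> g) (\<phi> g) q \<in> N" using diag NX q by auto
    qed (rule NX)
    fix K assume K: "K \<noteq> {} \<and> closed K \<and> XX.P.invariant K \<and> K \<subseteq> N"
    have "subsystem G N (restricted_action (diagonal_action \<phi> X) N) K"
      unfolding subsystem_def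
    proof (intro conjI ballI subsetI)
      show "K \<noteq> {}" using K by blast
      show "closedin (top_of_set N) K" using K by (auto intro: closed_subset)
      fix g q assume g: "g \<in> carrier G" and "q \<in> restricted_action (diagonal_action \<phi> X) N g ` K"
      then obtain t where t: "t \<in> K" "q = restricted_action (diagonal_action \<phi> X) N g t" by blast
      have tN: "t \<in> N" "t \<in> X \<times> X" using t(1) K NX by auto
      have "q = map_prod (\<phi> g) (\<phi> g) t"
        using t(2) tN(1) diag[OF tN(2)] by (simp add: restricted_action_def)
      moreover have "XX.P.invariant K" using K by blast
      ultimately show "q \<in> K" using XX.P.invariantD[OF _ g t(1)] by simp
    qed
    then show "K = N" using N(2) by (simp add: minimal_system_def)
  qed
  then show ?thesis using p by blast
qed

theorem theorem1:
  fixes G :: "('g, 'm) monoid_scheme"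
    and X :: "'a::metric_space set"
    and \<phi> :: "'g \<Rightarrow> 'a \<Rightarrow> 'a"
    and n :: nat
  assumes "minimal_system G X \<phi>"
    and "n \<ge> 2"
    and "X \<times> X \<subseteq> closure (minimal_points G (X \<times> X) (diagonal_action \<phi> X))"
  shows "n_sensitive n G X \<phi> \<longleftrightarrow>
    (\<exists>x\<in>X. at_least_card n (regionally_proximal G X \<phi> `` {x}))"
proof -
  interpret minimal_action G X \<phi> by (rule minimal_system_imp_minimal_action[OF assms(1)])
  show ?thesis
  proof
    assume "n_sensitive n G X \<phi>"
    then show "\<exists>x\<in>X. at_least_card n (RP `` {x})"
      using sensitive_imp_large_section assms(2) by simp
  next
    assume "\<exists>x\<in>X. at_least_card n (RP `` {x})"
    then obtain x where x: "x \<in> X" "at_least_card n (RP `` {x})" by blast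
    show "n_sensitive n G X \<phi>"
      by (rule large_section_imp_sensitive[OF minimal_points_dense[OF assms(1,3)] x])
  qed
qed

end
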